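(* Let $X_n$ denote the additive functional induced by the toll sequence $(\log n)_{n\ge1}$ (the shape functional) on a uniformly random binary tree with $n$ nodes. Let \[ C_0:=\sum_{n=1}^\infty(\log n)\frac{\beta_n}{4^n},\qquad \beta_n=\frac1{n+1}\binom{2n}{n},\qquad \sigma^2:=8(1-\log2). \] Then \[ \frac{X_n-C_0(n+1)}{\sqrt{n\log n}}\xrightarrow{\ \mathcal L\ }\mathcal N(0,\sigma^2)\quad\text{and}\quad\frac{X_n-\mathbb{E}X_n}{\sqrt{\operatorname{Var}X_n}}\xrightarrow{\ \mathcal L\ }\mathcal N(0,1). \]
   Context: Binary trees: a binary tree is either empty (0 nodes) or consists of a root together with an ordered pair $(L(T),R(T))$ of binary trees. $|T|$ is the number of nodes. Given a toll sequence $(b_n)_{n\ge1}$, the induced additive tree functional $f$ is defined by $f(\emptyset)=0$ and $f(T)=f(L(T))+f(R(T))+b_{|T|}$ for $|T|\ge1$. $X_n:=f(T_n)$ where $T_n$ is uniformly distributed over the $\beta_n$ binary trees with $n$ nodes. $\xrightarrow{\mathcal L}$ is convergence in distribution. *)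

theory Defs
  imports "HOL-Probability.Probability" "HOL-Library.Tree"
begin

text \<open>Binary trees are skeletons of type unit tree; the number of nodes is size.\<close>

fun add_fun :: "(nat \<Rightarrow> real) \<Rightarrow> unit tree \<Rightarrow> real" where
  "add_fun b Leaf = 0"
| "add_fun b (Node l x r) = add_fun b l + add_fun b r + b (size (Node l x r))"

definition bin_trees :: "nat \<Rightarrow> unit tree set" where
  "bin_trees n = {t. size t = n}"

definition shape_dist :: "nat \<Rightarrow> real pmf" where
  "shape_dist n = map_pmf (add_fun (\<lambda>k. ln (real k))) (pmf_of_set (bin_trees n))"

definition catalan_beta :: "nat \<Rightarrow> real" where
  "catalan_beta n = real ((2 * n) choose n) / real (n + 1)"

definition C0 :: real where
  "C0 = (\<Sum>n. ln (real (Suc n)) * catalan_beta (Suc n) / 4 ^ (Suc n))"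

end

theory Submission
  imports Defs "HOL-Real_Asymp.Real_Asymp"
begin

text \<open>
  Grow a uniform random binary tree by Remy's algorithm, which grafts a new leaf at a uniformly chosen node.
  Replace the toll \<open>ln k\<close> by \<open>h k = 2 (1 + 1/3 + \<dots> + 1/(2k - 1)) - 4\<close>, which differs from \<open>ln k\<close> by a constant
  and an error in \<open>[0, 1/k]\<close>. The increments \<open>h (k + 1) - h k = 2/(2k + 1)\<close> match the number of grafting positions, so for
  the functional \<open>F\<close> with toll \<open>h\<close> and \<open>c n = (2n choose n) / 4^n\<close> the process \<open>Z n = c n (F - 2)\<close> is exactly
  a martingale. Its increments are bounded, and their conditional variances are, up to a negligible square,
  \<open>1/n\<close> times the average over the tree of a functional \<open>G\<close> whose toll is again explicit. A law of large numbers for additive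
  functionals (truncate the toll, bound second moments by generating functions) makes the conditional variance
  asymptotic to \<open>8 (1 - ln 2) / (\<pi> n)\<close>. Hence the characteristic function of \<open>Z n\<close> is multiplied at each step by
  approximately \<open>exp (- x^2 8 (1 - ln 2) / (2 \<pi> n))\<close>, and \<open>Z n / sqrt (ln n)\<close> is asymptotically normal. The
  remaining part of the shape functional is \<open>C0 (n + 1)\<close> plus a term of size \<open>sqrt n\<close> in mean square.
\<close>

section \<open>Normalised central binomial and Catalan numbers\<close>

text \<open>The obstacle is that every step of the martingale contributes variance of order 1/n, so
  the total diverges only through a harmonic sum and no finite range of sizes dominates. The order
  of the conditional variance is thus not enough: it has to be known up to o(1/n). An error of this
  size in mean absolute value suffices, because the conditional factor of the characteristic
  function can then be replaced by a deterministic one and pulled out of the average; the errors of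
  n steps add up to o(ln n), and the argument is scaled by 1/sqrt (ln n). The constants -4 and 2
  remove the affine terms from the effect of a grafting, so that F - 2 is multiplied on average by
  (2n + 2)/(2n + 1), which is c n / c (n + 1). They also make F free of a linear term in its mean,
  which is how \<open>C0\<close> is recovered. In the limiting variance, pi stems from c n ~ 1/sqrt
  (pi n), and ln 2 from an alternating harmonic series, produced when the mean 2 - 2 / c k of F
  meets a weight proportional to c k.\<close>

definition cbin :: "nat \<Rightarrow> real" where
  "cbin n = real ((2 * n) choose n) / 4 ^ n"

text \<open>Half of it is the probability that a critical binary Galton-Watson tree has n internal
  nodes.\<close>

definition bcat :: "nat \<Rightarrow> real" where
  "bcat n = cbin n / (real n + 1)"

lemma cbin_0 [simp]: "cbin 0 = 1"
  by (simp add: cbin_def)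

lemma cbin_Suc: "cbin (Suc n) = cbin n * (2 * real n + 1) / (2 * real n + 2)"
proof -
  have *: "real ((2 * m) choose m) = fact (2 * m) / (fact m * fact m)" for m
    using binomial_fact[of m "2 * m", where 'a = real] by simp
  have "fact (2 * Suc n) = (2 * real n + 2) * ((2 * real n + 1) * fact (2 * n))"
    by (simp add: algebra_simps)
  then have "cbin (Suc n) = (2 * real n + 2) * ((2 * real n + 1) * fact (2 * n))
      / ((real n + 1) * fact n * ((real n + 1) * fact n)) / (4 * 4 ^ n)"
    unfolding cbin_def * by (simp add: algebra_simps)
  also have "\<dots> = (fact (2 * n) / (fact n * fact n) / 4 ^ n) * (2 * real n + 1) / (2 * real n + 2)"
    by (simp add: divide_simps) algebra
  finally show ?thesis
    unfolding cbin_def * .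
qed

lemma cbin_pos [simp]: "0 < cbin n"
  by (simp add: cbin_def)

lemma cbin_nonneg [simp]: "0 \<le> cbin n"
  by (simp add: less_imp_le)

lemma cbin_neq_0 [simp]: "cbin n \<noteq> 0"
  using cbin_pos[of n] by linarith

lemma bcat_pos [simp]: "0 < bcat n"
  by (simp add: bcat_def add_nonneg_pos)

lemma bcat_nonneg [simp]: "0 \<le> bcat n"
  by (simp add: less_imp_le)

lemma bcat_neq_0 [simp]: "bcat n \<noteq> 0"
  using bcat_pos[of n] by linarith

lemma bcat_0 [simp]: "bcat 0 = 1"
  by (simp add: bcat_def)

lemma bcat_catalan: "bcat n = catalan_beta n / 4 ^ n"
  by (simp add: bcat_def cbin_def catalan_beta_def field_simps)

text \<open>This is what lets sums weighted by \<open>bcat\<close> telescope.\<close>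

lemma bcat_diff: "bcat n = 2 * (cbin n - cbin (Suc n))"
  unfolding bcat_def cbin_Suc by (simp add: divide_simps) (simp add: algebra_simps)

lemma bcat_Suc: "bcat (Suc n) = bcat n * (2 * real n + 1) / (2 * real n + 4)"
  unfolding bcat_def cbin_Suc by (simp add: divide_simps) (simp add: algebra_simps)

lemma cbin_Suc_le: "cbin (Suc n) \<le> cbin n"
  using bcat_pos[of n] unfolding bcat_diff by simp

lemma cbin_antimono: "m \<le> n \<Longrightarrow> cbin n \<le> cbin m"
  by (rule lift_Suc_antimono_le[of cbin]) (rule cbin_Suc_le)

lemma cbin_le_1: "cbin n \<le> 1"
  using cbin_antimono[of 0 n] by simp

lemma bcat_antimono: "m \<le> n \<Longrightarrow> bcat n \<le> bcat m"
proof (rule lift_Suc_antimono_le[of bcat])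
  fix n
  have "bcat n * ((2 * real n + 1) / (2 * real n + 4)) \<le> bcat n * 1"
    by (intro mult_left_mono) auto
  then show "bcat (Suc n) \<le> bcat n"
    by (simp add: bcat_Suc)
qed

text \<open>The coefficient form of squaring (1 - z) powr (-1/2). The reflection k to n - k
  expresses the sum weighted by k through the plain one, and the recurrence of \<open>cbin\<close>
  relates the weighted sums for n and n + 1; together they make the plain sum constant in n.\<close>

lemma cbin_convolution: "(\<Sum>k\<le>n. cbin k * cbin (n - k)) = 1"
proof (induction n)
  case (Suc n)
  let ?s = "\<lambda>n. \<Sum>k\<le>n. cbin k * cbin (n - k)"
  let ?w = "\<lambda>n. \<Sum>k\<le>n. real k * (cbin k * cbin (n - k))"
  have sym: "real n * ?s n = 2 * ?w n" for n
  proof -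
    have "?w n = (\<Sum>k\<le>n. real (n - k) * (cbin (n - k) * cbin (n - (n - k))))"
      by (rule sum.reindex_bij_witness[of _ "\<lambda>k. n - k" "\<lambda>k. n - k"]) auto
    also have "\<dots> = (\<Sum>k\<le>n. real n * (cbin k * cbin (n - k)) - real k * (cbin k * cbin (n - k)))"
      by (intro sum.cong) (auto simp: of_nat_diff algebra_simps)
    also have "\<dots> = real n * ?s n - ?w n"
      by (simp add: sum_subtractf sum_distrib_left)
    finally show ?thesis by simp
  qed
  have "?w (Suc n) = (\<Sum>k\<le>n. (real k + 1) * (cbin (Suc k) * cbin (n - k)))"
    by (subst sum.atMost_Suc_shift) (simp add: algebra_simps)
  also have "\<dots> = (\<Sum>k\<le>n. real k * (cbin k * cbin (n - k)) + (cbin k * cbin (n - k)) / 2)"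
    by (intro sum.cong refl) (simp add: cbin_Suc field_simps)
  also have "\<dots> = ?w n + ?s n / 2"
    by (simp add: sum.distrib sum_divide_distrib)
  finally have "2 * ?w (Suc n) = (real n + 1) * ?s n"
    using sym[of n] by (simp add: algebra_simps)
  then have "(real n + 1) * ?s (Suc n) = (real n + 1) * ?s n"
    using sym[of "Suc n"] by (simp add: add.commute)
  then show ?case
    using Suc.IH by simp
qed simp

lemma cbin_sum: "(\<Sum>k\<le>n. cbin k) = (2 * real n + 1) * cbin n"
proof (induction n)
  case (Suc n)
  have "(2 * real n + 2) * cbin (Suc n) = (2 * real n + 1) * cbin n"
    unfolding cbin_Suc by (simp add: field_simps)
  then show ?case
    using Suc by (simp add: algebra_simps)
qed simp

text \<open>The factors of Wallis' product are the inverse ratios of consecutive values of the left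
  side, so the limit 2/pi is inherited from that product.\<close>

lemma cbin_wallis: "cbin n ^ 2 * (2 * real n + 1) = 1 / (\<Prod>k=1..n. (4*real k^2) / (4*real k^2 - 1))"
proof (induction n)
  case (Suc n)
  have e: "(2 * real n + 1) * (2 * real n + 3) = 4 * (1 + real n)\<^sup>2 - 1"
    by (simp add: power2_eq_square algebra_simps)
  have "cbin (Suc n) ^ 2 * (2 * real (Suc n) + 1) = (cbin n ^ 2 * (2 * real n + 1)) *
      ((2 * real n + 1) * (2 * real n + 3) / (4 * (real (Suc n))\<^sup>2))"
    by (simp add: cbin_Suc divide_simps power2_eq_square) algebra
  then show ?case
    unfolding Suc by (simp add: e)
qed simp

lemma cbin_asymp: "(\<lambda>n. cbin n ^ 2 * (2 * real n + 1)) \<longlonglongrightarrow> 2 / pi"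
  using tendsto_divide[OF tendsto_const wallis, of 1] by (simp add: cbin_wallis)

lemma cbin_sq_le: "cbin n ^ 2 * (2 * real n + 1) \<le> 1"
proof (induction n)
  case (Suc n)
  have "cbin (Suc n) ^ 2 * (2 * real (Suc n) + 1) = (cbin n ^ 2 * (2 * real n + 1)) *
      ((2 * real n + 1) * (2 * real n + 3) / ((2 * real n + 2) ^ 2))"
    by (simp add: cbin_Suc divide_simps power2_eq_square)
  also have "\<dots> \<le> 1 * 1"
    by (intro mult_mono Suc) (auto simp: divide_simps power2_eq_square algebra_simps add_nonneg_nonneg not_less)
  finally show ?case by simp
qed simp

lemma cbin_tendsto_0: "cbin \<longlonglongrightarrow> 0"
proof -
  have "(\<lambda>n. cbin n ^ 2 * (2 * real n + 1) * (1 / (2 * real n + 1))) \<longlonglongrightarrow> 2 / pi * 0"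
    by (intro tendsto_mult cbin_asymp) real_asymp
  moreover have "cbin n ^ 2 * (2 * real n + 1) * (1 / (2 * real n + 1)) = cbin n ^ 2" for n
    by (simp add: divide_simps)
  ultimately have "(\<lambda>n. cbin n ^ 2) \<longlonglongrightarrow> 0"
    by simp
  from tendsto_real_sqrt[OF this] show ?thesis
    by simp
qed

text \<open>Both sides are partial sums of the positive sequence \<open>cbin\<close>. With
  \<open>cbin_antimono\<close> this encloses \<open>cbin (n - k) / cbin n\<close> from both
  sides.\<close>

lemma cbin_ratio_le: "m \<le> n \<Longrightarrow> cbin m * (2 * real m + 1) \<le> cbin n * (2 * real n + 1)"
proof (rule lift_Suc_mono_le[of "\<lambda>m. cbin m * (2 * real m + 1)"])
  fix n
  have "(\<Sum>k\<le>n. cbin k) \<le> (\<Sum>k\<le>Suc n. cbin k)"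
    by simp
  then show "cbin n * (2 * real n + 1) \<le> cbin (Suc n) * (2 * real (Suc n) + 1)"
    unfolding cbin_sum by (simp add: mult.commute)
qed

section \<open>Generating functions and the size recursion\<close>

definition cbin_fps :: "real fps" where "cbin_fps = Abs_fps cbin"

lemma cbin_fps_square: "cbin_fps * ((1 - fps_X) * cbin_fps) = 1"
proof -
  have "cbin_fps * cbin_fps = Abs_fps (\<lambda>_. 1)"
    by (intro fps_ext) (simp add: cbin_fps_def fps_mult_nth cbin_convolution atMost_atLeast0[symmetric])
  moreover have "(1 - fps_X) * Abs_fps (\<lambda>_. 1::real) = 1"
    by (intro fps_ext) (auto simp: algebra_simps)
  ultimately show ?thesis
    by (metis mult.left_commute)
qed

lemma bcat_fps: "1 - fps_const (1/2) * (fps_X * Abs_fps bcat) = (1 - fps_X) * cbin_fps"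
proof (intro fps_ext)
  fix n
  show "fps_nth (1 - fps_const (1/2) * (fps_X * Abs_fps bcat)) n = fps_nth ((1 - fps_X) * cbin_fps) n"
    by (cases n) (simp_all add: cbin_fps_def algebra_simps bcat_diff)
qed

text \<open>The recursion says that the generating function of A times 1 - z B(z)/2 is that of
  \<Gamma>, where B generates \<open>bcat\<close>. By \<open>bcat_fps\<close> this multiplier is
  sqrt (1 - z), and its inverse generates \<open>cbin\<close>.\<close>

lemma half_convolution_solution:
  fixes A \<Gamma> :: "nat \<Rightarrow> real"
  assumes "A 0 = \<Gamma> 0"
    and "\<And>n. A (Suc n) = (\<Sum>j\<le>n. A j * bcat (n - j)) / 2 + \<Gamma> (Suc n)"
  shows "A n = (\<Sum>k\<le>n. \<Gamma> k * cbin (n - k))"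
proof -
  have "Abs_fps A * (1 - fps_const (1/2) * (fps_X * Abs_fps bcat)) = Abs_fps \<Gamma>"
  proof (intro fps_ext)
    fix n
    have "Abs_fps A * (1 - fps_const (1/2) * (fps_X * Abs_fps bcat))
        = Abs_fps A - fps_const (1/2) * (fps_X * (Abs_fps A * Abs_fps bcat))"
      by (simp add: algebra_simps)
    then show "fps_nth (Abs_fps A * (1 - fps_const (1/2) * (fps_X * Abs_fps bcat))) n = fps_nth (Abs_fps \<Gamma>) n"
      using assms by (cases n) (simp_all add: fps_mult_nth[of "Abs_fps A"] atMost_atLeast0)
  qed
  then have "Abs_fps A * ((1 - fps_X) * cbin_fps) * cbin_fps = Abs_fps \<Gamma> * cbin_fps"
    by (simp add: bcat_fps)
  then have "Abs_fps A = Abs_fps \<Gamma> * cbin_fps"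
    using cbin_fps_square by (metis mult.assoc mult.commute mult.right_neutral)
  then have "fps_nth (Abs_fps A) n = fps_nth (Abs_fps \<Gamma> * cbin_fps) n"
    by simp
  then show ?thesis
    by (simp add: fps_mult_nth cbin_fps_def atMost_atLeast0)
qed

text \<open>In the light of \<open>avg_toll\<close> with constant toll 1, this counts the 2n + 1
  subtrees of a tree with n nodes, leaves included.\<close>

lemma bcat_cbin_convolution: "(\<Sum>k\<le>n. bcat k * cbin (n - k)) = (2 * real n + 1) * bcat n"
proof -
  have "(\<Sum>k\<le>n. bcat k * cbin (n - k)) = 2 * ((\<Sum>k\<le>n. cbin k * cbin (n - k)) - (\<Sum>k\<le>n. cbin (Suc k) * cbin (n - k)))"
    unfolding sum_subtractf[symmetric] sum_distrib_left
    by (intro sum.cong refl) (subst bcat_diff, simp add: algebra_simps)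
  also have "(\<Sum>k\<le>n. cbin (Suc k) * cbin (n - k)) = 1 - cbin (Suc n)"
    using cbin_convolution[of "Suc n"] by (subst (asm) sum.atMost_Suc_shift) simp
  finally show ?thesis
    unfolding cbin_convolution by (simp add: cbin_Suc bcat_def field_simps)
qed

lemma bcat_sums: "bcat sums 2"
proof -
  have "(\<lambda>n. 2 * (cbin 0 - cbin n)) \<longlonglongrightarrow> 2 * (1 - 0)"
    using cbin_tendsto_0 by (intro tendsto_intros) auto
  moreover have "(\<Sum>k<n. bcat k) = 2 * (cbin 0 - cbin n)" for n
    by (induction n) (auto simp: bcat_diff)
  ultimately show ?thesis
    by (simp add: sums_def)
qed

section \<open>Uniform binary trees and Remy insertion\<close>

lemma bin_trees_0: "bin_trees 0 = {Leaf}"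
  by (auto simp: bin_trees_def)

lemma bin_trees_Suc:
  "bin_trees (Suc n) = (\<Union>j\<in>{..n}. (\<lambda>(l, r). Node l () r) ` (bin_trees j \<times> bin_trees (n - j)))"
proof (intro equalityI subsetI)
  fix t assume "t \<in> bin_trees (Suc n)"
  then obtain l r where "t = Node l () r" "size l + size r = n"
    by (cases t) (auto simp: bin_trees_def)
  then show "t \<in> (\<Union>j\<in>{..n}. (\<lambda>(l, r). Node l () r) ` (bin_trees j \<times> bin_trees (n - j)))"
    by (intro UN_I[of "size l"]) (auto simp: bin_trees_def)
qed (auto simp: bin_trees_def)

lemma finite_bin_trees [simp]: "finite (bin_trees n)"
  by (induction n rule: less_induct) (case_tac x; auto simp: bin_trees_0 bin_trees_Suc)

lemma bin_trees_nonempty [simp]: "bin_trees n \<noteq> {}"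
proof (induction n)
  case (Suc n)
  then obtain t where "t \<in> bin_trees n"
    by blast
  then have "Node Leaf () t \<in> bin_trees (Suc n)"
    by (simp add: bin_trees_def)
  then show ?case by blast
qed (simp add: bin_trees_0)

lemma sum_bin_trees_Suc:
  fixes f :: "unit tree \<Rightarrow> 'a::comm_monoid_add"
  shows "(\<Sum>t\<in>bin_trees (Suc n). f t) = (\<Sum>j\<le>n. \<Sum>l\<in>bin_trees j. \<Sum>r\<in>bin_trees (n - j). f (Node l () r))"
proof -
  have "(\<Sum>t\<in>bin_trees (Suc n). f t)
      = (\<Sum>j\<le>n. \<Sum>t\<in>(\<lambda>(l, r). Node l () r) ` (bin_trees j \<times> bin_trees (n - j)). f t)"
    unfolding bin_trees_Suc by (subst sum.UNION_disjoint) (auto, auto simp: bin_trees_def)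
  also have "\<dots> = (\<Sum>j\<le>n. \<Sum>(l, r)\<in>bin_trees j \<times> bin_trees (n - j). f (Node l () r))"
    by (intro sum.cong refl, subst sum.reindex) (auto simp: inj_on_def case_prod_unfold)
  finally show ?thesis
    by (simp add: sum.cartesian_product)
qed

text \<open>All trees obtained from \<open>t\<close> by grafting a new leaf next to one of its \<open>2n + 1\<close> (internal or external)
  nodes, on the left or on the right (Remy's algorithm).\<close>

fun remy :: "unit tree \<Rightarrow> unit tree list" where
  "remy Leaf = [Node Leaf () Leaf, Node Leaf () Leaf]"
| "remy (Node l x r) = [Node Leaf () (Node l x r), Node (Node l x r) () Leaf]
     @ map (\<lambda>l'. Node l' x r) (remy l) @ map (\<lambda>r'. Node l x r') (remy r)"

lemma length_remy: "length (remy t) = 4 * size t + 2"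
  by (induction t) auto

lemma size_remy: "t' \<in> set (remy t) \<Longrightarrow> size t' = Suc (size t)"
  by (induction t arbitrary: t') auto

text \<open>Removing any one of its n + 2 leaves together with the parent node shows that a tree
  with n + 1 nodes arises n + 2 times. The induction proves this with weights: a pair of subtree
  sizes (j, n - j) receives j + 1 from grafts on the left and n - j + 1 from grafts on the right.
  Vector values also cover the complex averages needed for characteristic functions.\<close>

lemma remy_sum:
  fixes g :: "unit tree \<Rightarrow> 'a::real_vector"
  shows "(\<Sum>t\<in>bin_trees n. \<Sum>t'\<leftarrow>remy t. g t') = (real n + 2) *\<^sub>R (\<Sum>t\<in>bin_trees (Suc n). g t)"
proof (induction n arbitrary: g rule: less_induct)
  case (less n)
  show ?case
  proof (cases n)
    case 0
    then show ?thesis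
      by (simp add: sum_bin_trees_Suc bin_trees_0 scaleR_2)
  next
    case (Suc m)
    let ?S = "\<lambda>a b. \<Sum>l\<in>bin_trees a. \<Sum>r\<in>bin_trees b. g (Node l () r)"
    have L: "(\<Sum>l\<in>bin_trees j. \<Sum>r\<in>bin_trees (m - j). \<Sum>l'\<leftarrow>remy l. g (Node l' () r))
        = (real j + 2) *\<^sub>R ?S (Suc j) (m - j)" if "j \<le> m" for j
    proof -
      have "(\<Sum>l\<in>bin_trees j. \<Sum>r\<in>bin_trees (m - j). \<Sum>l'\<leftarrow>remy l. g (Node l' () r))
        = (\<Sum>r\<in>bin_trees (m - j). \<Sum>l\<in>bin_trees j. \<Sum>l'\<leftarrow>remy l. g (Node l' () r))"
        by (rule sum.swap)
      also have "\<dots> = (\<Sum>r\<in>bin_trees (m - j). (real j + 2) *\<^sub>R (\<Sum>l\<in>bin_trees (Suc j). g (Node l () r)))"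
        using that Suc by (intro sum.cong refl less) auto
      also have "\<dots> = (real j + 2) *\<^sub>R (\<Sum>r\<in>bin_trees (m - j). \<Sum>l\<in>bin_trees (Suc j). g (Node l () r))"
        by (simp add: scaleR_sum_right)
      also have "(\<Sum>r\<in>bin_trees (m - j). \<Sum>l\<in>bin_trees (Suc j). g (Node l () r)) = ?S (Suc j) (m - j)"
        by (rule sum.swap)
      finally show ?thesis .
    qed
    have R: "(\<Sum>l\<in>bin_trees j. \<Sum>r\<in>bin_trees (m - j). \<Sum>r'\<leftarrow>remy r. g (Node l () r'))
        = (real (m - j) + 2) *\<^sub>R ?S j (Suc m - j)" if "j \<le> m" for j
      using that Suc by (subst less) (auto simp: scaleR_sum_right Suc_diff_le)
    have "(\<Sum>t\<in>bin_trees n. \<Sum>t'\<leftarrow>remy t. g t')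
       = (\<Sum>t\<in>bin_trees n. g (Node Leaf () t) + g (Node t () Leaf))
       + ((\<Sum>j\<le>m. \<Sum>l\<in>bin_trees j. \<Sum>r\<in>bin_trees (m - j). \<Sum>l'\<leftarrow>remy l. g (Node l' () r))
       + (\<Sum>j\<le>m. \<Sum>l\<in>bin_trees j. \<Sum>r\<in>bin_trees (m - j). \<Sum>r'\<leftarrow>remy r. g (Node l () r')))"
      unfolding Suc sum_bin_trees_Suc
      by (simp add: sum.distrib o_def add.assoc)
    \<comment> \<open>The two grafts at the root supply the boundary terms with an empty left or
      right subtree, which grafting inside that subtree cannot produce.\<close>
    also have "(\<Sum>t\<in>bin_trees n. g (Node Leaf () t) + g (Node t () Leaf)) = ?S 0 n + ?S n 0"
      by (simp add: bin_trees_0 sum.distrib)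
    also have "(\<Sum>j\<le>m. \<Sum>l\<in>bin_trees j. \<Sum>r\<in>bin_trees (m - j). \<Sum>l'\<leftarrow>remy l. g (Node l' () r))
        = (\<Sum>j\<le>m. (real (Suc j) + 1) *\<^sub>R ?S (Suc j) (n - Suc j))"
      by (intro sum.cong refl) (simp add: L Suc)
    also have "\<dots> = (\<Sum>j\<le>n. (real j + 1) *\<^sub>R ?S j (n - j)) - ?S 0 n"
      unfolding Suc by (subst sum.atMost_Suc_shift[of _ m]) simp
    also have "(\<Sum>j\<le>m. \<Sum>l\<in>bin_trees j. \<Sum>r\<in>bin_trees (m - j). \<Sum>r'\<leftarrow>remy r. g (Node l () r'))
        = (\<Sum>j\<le>m. (real (n - j) + 1) *\<^sub>R ?S j (n - j))"
      by (intro sum.cong refl) (simp add: R Suc of_nat_diff)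
    also have "\<dots> = (\<Sum>j\<le>n. (real (n - j) + 1) *\<^sub>R ?S j (n - j)) - ?S n 0"
      unfolding Suc by simp
    also have "?S 0 n + ?S n 0 + ((\<Sum>j\<le>n. (real j + 1) *\<^sub>R ?S j (n - j)) - ?S 0 n
          + ((\<Sum>j\<le>n. (real (n - j) + 1) *\<^sub>R ?S j (n - j)) - ?S n 0))
        = (\<Sum>j\<le>n. (real j + 1) *\<^sub>R ?S j (n - j)) + (\<Sum>j\<le>n. (real (n - j) + 1) *\<^sub>R ?S j (n - j))"
      by simp
    also have "\<dots> = (\<Sum>j\<le>n. (real n + 2) *\<^sub>R ?S j (n - j))"
      unfolding sum.distrib[symmetric] scaleR_add_left[symmetric]
      by (intro sum.cong refl arg_cong2[where f = scaleR]) (auto simp: of_nat_diff)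
    finally show ?thesis
      by (simp add: sum_bin_trees_Suc scaleR_sum_right)
  qed
qed

text \<open>Remy's proof of the Catalan formula: pairs of a tree and a grafting are counted in two
  ways.\<close>

lemma card_bin_trees: "real (card (bin_trees n)) = bcat n * 4 ^ n"
proof (induction n)
  case (Suc n)
  have "(\<Sum>t\<in>bin_trees n. real (length (remy t))) = (\<Sum>t\<in>bin_trees n. 4 * real n + 2)"
    by (intro sum.cong) (auto simp: length_remy bin_trees_def)
  then have "(4 * real n + 2) * real (card (bin_trees n)) = (real n + 2) * real (card (bin_trees (Suc n)))"
    using remy_sum[of "\<lambda>_. 1::real" n] by (simp add: sum_list_triv algebra_simps)
  then show ?case
    unfolding Suc by (simp add: bcat_Suc field_simps)
qed (simp add: bin_trees_0)

section \<open>Averages over uniform trees\<close>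

definition avg :: "nat \<Rightarrow> (unit tree \<Rightarrow> 'a::real_vector) \<Rightarrow> 'a" where
  "avg n f = (\<Sum>t\<in>bin_trees n. f t) /\<^sub>R real (card (bin_trees n))"

lemma card_bin_trees_pos [simp]: "0 < card (bin_trees n)"
  by (simp add: card_gt_0_iff)

lemma avg_cong: "(\<And>t. size t = n \<Longrightarrow> f t = g t) \<Longrightarrow> avg n f = avg n g"
  unfolding avg_def by (metis (mono_tags, lifting) bin_trees_def mem_Collect_eq sum.cong)

lemma avg_0 [simp]: "avg 0 f = f Leaf"
  by (simp add: avg_def bin_trees_0)

lemma avg_const [simp]: "avg n (\<lambda>_. c) = c"
  by (simp add: avg_def sum_constant_scaleR)

lemma avg_add: "avg n (\<lambda>t. f t + g t) = avg n f + avg n g"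
  by (simp add: avg_def sum.distrib scaleR_add_right)

lemma avg_diff: "avg n (\<lambda>t. f t - g t) = avg n f - avg n g"
  by (simp add: avg_def sum_subtractf scaleR_diff_right)

lemma avg_cmult: "avg n (\<lambda>t. c * f t) = c * avg n f" for c :: "'a::real_algebra"
  by (simp add: avg_def sum_distrib_left mult_scaleR_right)

lemma avg_multc: "avg n (\<lambda>t. f t * c) = avg n f * c" for c :: "'a::real_algebra"
  by (simp add: avg_def sum_distrib_right)

lemma avg_divide: "avg n (\<lambda>t. f t / c) = avg n f / c" for c :: real
  unfolding avg_def by (simp flip: sum_divide_distrib)

lemma avg_mono: "(\<And>t. size t = n \<Longrightarrow> f t \<le> g t) \<Longrightarrow> avg n f \<le> avg n g" for f :: "unit tree \<Rightarrow> real"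
  unfolding avg_def by (auto simp: bin_trees_def intro!: divide_right_mono mult_left_mono sum_mono)

lemma norm_avg_le: "norm (avg n f) \<le> avg n (\<lambda>t. norm (f t))" for f :: "unit tree \<Rightarrow> 'a::real_normed_vector"
  unfolding avg_def by (auto intro!: mult_left_mono sum_norm_le)

lemma abs_avg_le: "\<bar>avg n f\<bar> \<le> avg n (\<lambda>t. \<bar>f t\<bar>)" for f :: "unit tree \<Rightarrow> real"
  using norm_avg_le[of n f] by simp

lemma avg_le_const: "(\<And>t. size t = n \<Longrightarrow> f t \<le> c) \<Longrightarrow> avg n f \<le> c" for f :: "unit tree \<Rightarrow> real"
  using avg_mono[of n f "\<lambda>_. c"] by simp

lemma avg_nonneg: "(\<And>t. size t = n \<Longrightarrow> 0 \<le> f t) \<Longrightarrow> 0 \<le> avg n f" for f :: "unit tree \<Rightarrow> real"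
  using avg_mono[of n "\<lambda>_. 0" f] by simp

lemma avg_square_le: "(avg n f)\<^sup>2 \<le> avg n (\<lambda>t. (f t)\<^sup>2)" for f :: "unit tree \<Rightarrow> real"
proof -
  have "0 \<le> avg n (\<lambda>t. (f t - avg n f)\<^sup>2)"
    by (rule avg_nonneg) simp
  also have "(\<lambda>t. (f t - avg n f)\<^sup>2) = (\<lambda>t. (f t)\<^sup>2 + ((avg n f)\<^sup>2 - 2 * avg n f * f t))"
    by (simp add: fun_eq_iff power2_eq_square algebra_simps)
  also have "avg n \<dots> = avg n (\<lambda>t. (f t)\<^sup>2) - (avg n f)\<^sup>2"
    by (simp add: avg_add avg_diff avg_cmult) (simp add: power2_eq_square)
  finally show ?thesis by simp
qed

lemma avg_abs_le_sqrt: "avg n (\<lambda>t. \<bar>f t\<bar>) \<le> sqrt (avg n (\<lambda>t. (f t)\<^sup>2))" for f :: "unit tree \<Rightarrow> real"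
  using avg_square_le[of n "\<lambda>t. \<bar>f t\<bar>"] by (intro real_le_rsqrt) simp

text \<open>A uniform grafting of a uniform tree is again uniform. This is the Markov chain behind
  the martingale, with one step written as an inner average.\<close>

lemma avg_Suc_remy:
  "avg (Suc n) g = avg n (\<lambda>t. (\<Sum>t'\<leftarrow>remy t. g t') /\<^sub>R (4 * real n + 2))"
proof -
  have e: "real (card (bin_trees (Suc n))) * (real n + 2) = (4 * real n + 2) * real (card (bin_trees n))"
    unfolding card_bin_trees by (simp add: bcat_Suc field_simps)
  have "avg n (\<lambda>t. (\<Sum>t'\<leftarrow>remy t. g t') /\<^sub>R (4 * real n + 2))
    = (\<Sum>t\<in>bin_trees n. \<Sum>t'\<leftarrow>remy t. g t') /\<^sub>R ((4 * real n + 2) * real (card (bin_trees n)))"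
    by (simp add: avg_def scaleR_sum_right[symmetric])
  also have "\<dots> = ((real n + 2) / ((real n + 2) * real (card (bin_trees (Suc n))))) *\<^sub>R (\<Sum>t\<in>bin_trees (Suc n). g t)"
    unfolding e[symmetric] remy_sum by (simp add: divide_inverse mult.commute)
  also have "(real n + 2) / ((real n + 2) * real (card (bin_trees (Suc n)))) = inverse (real (card (bin_trees (Suc n))))"
    by (simp add: divide_simps add_nonneg_eq_0_iff)
  finally show ?thesis
    by (simp add: avg_def)
qed

text \<open>Tolls may depend on the whole subtree, and leaves carry one as well, so every function
  of trees is an additive functional. In particular a multiple of size plus one has its toll at the
  leaves only.\<close>

fun toll :: "(unit tree \<Rightarrow> real) \<Rightarrow> unit tree \<Rightarrow> real" where
  "toll \<Phi> Leaf = \<Phi> Leaf"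
| "toll \<Phi> (Node l x r) = \<Phi> (Node l x r) - \<Phi> l - \<Phi> r"

lemma avg_Suc_scaled:
  fixes f :: "unit tree \<Rightarrow> real"
  shows "bcat (Suc n) * avg (Suc n) f
    = (\<Sum>j\<le>n. \<Sum>l\<in>bin_trees j. \<Sum>r\<in>bin_trees (n - j). f (Node l () r)) / 4 ^ Suc n"
  unfolding avg_def sum_bin_trees_Suc card_bin_trees by (simp add: field_simps)

lemma sum_bin_trees: "(\<Sum>t\<in>bin_trees n. f t) = bcat n * 4 ^ n * avg n f" for f :: "unit tree \<Rightarrow> real"
  unfolding avg_def card_bin_trees by (simp add: field_simps)

lemma four_power_split: "j \<le> n \<Longrightarrow> (4::real) ^ j * 4 ^ (n - j) = 4 ^ n"
  by (simp flip: power_add)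

text \<open>The quotient \<open>bcat k * cbin (n - k) / bcat n\<close> is the expected number of
  subtrees with k nodes in a uniform tree with n nodes, and each of these is itself uniform. The
  proof splits at the root, where the two subtrees contribute equally by symmetry.\<close>

theorem avg_toll:
  "bcat n * avg n \<Phi> = (\<Sum>k\<le>n. bcat k * avg k (toll \<Phi>) * cbin (n - k))"
proof (rule half_convolution_solution[where A = "\<lambda>n. bcat n * avg n \<Phi>"])
  fix n
  let ?A = "\<lambda>j. bcat j * avg j \<Phi>"
  have "bcat (Suc n) * avg (Suc n) \<Phi> - bcat (Suc n) * avg (Suc n) (toll \<Phi>)
      = (\<Sum>j\<le>n. \<Sum>l\<in>bin_trees j. \<Sum>r\<in>bin_trees (n - j). \<Phi> l + \<Phi> r) / 4 ^ Suc n"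
    unfolding avg_Suc_scaled diff_divide_distrib[symmetric] sum_subtractf[symmetric] by simp
  also have "(\<Sum>j\<le>n. \<Sum>l\<in>bin_trees j. \<Sum>r\<in>bin_trees (n - j). \<Phi> l + \<Phi> r)
      = (\<Sum>j\<le>n. 4 ^ n * (?A j * bcat (n - j) + bcat j * ?A (n - j)))"
  proof (intro sum.cong refl)
    fix j assume "j \<in> {..n}"
    then have "4 ^ n = (4 ^ j * 4 ^ (n - j) :: real)"
      by (simp add: four_power_split)
    then show "(\<Sum>l\<in>bin_trees j. \<Sum>r\<in>bin_trees (n - j). \<Phi> l + \<Phi> r) = 4 ^ n * (?A j * bcat (n - j) + bcat j * ?A (n - j))"
      by (simp add: sum.distrib sum_bin_trees card_bin_trees avg_cmult algebra_simps avg_multc)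
  qed
  also have "\<dots> = 4 ^ n * ((\<Sum>j\<le>n. ?A j * bcat (n - j)) + (\<Sum>j\<le>n. bcat j * ?A (n - j)))"
    by (simp add: sum.distrib sum_distrib_left[symmetric])
  also have "(\<Sum>j\<le>n. bcat j * ?A (n - j)) = (\<Sum>j\<le>n. ?A j * bcat (n - j))"
    by (rule sum.reindex_bij_witness[of _ "\<lambda>k. n - k" "\<lambda>k. n - k"]) auto
  finally show "?A (Suc n) = (\<Sum>j\<le>n. ?A j * bcat (n - j)) / 2 + bcat (Suc n) * avg (Suc n) (toll \<Phi>)"
    by (simp add: field_simps)
qed simp

section \<open>Moments of additive functionals\<close>

lemma bcat_tendsto_0: "bcat \<longlonglongrightarrow> 0"
  using bcat_sums summable_LIMSEQ_zero sums_summable by blast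

lemma bcat_second_diff: "bcat j - bcat (Suc j) = bcat j * 3 / (2 * (real j + 2))"
  unfolding bcat_Suc by (simp add: field_simps)

text \<open>The summand is a second difference of \<open>cbin\<close>, a coefficient of (1 - z) powr
  (3/2) from degree 2 on. Its product with the series of \<open>cbin\<close> is 1 - z, whose
  coefficient at degree n + 2 vanishes; the right side compensates for the two initial coefficients
  1 and -3/2.\<close>

lemma bcat_second_diff_convolution:
  "(\<Sum>j\<le>n. (bcat j - bcat (Suc j)) / 2 * cbin (n - j)) = 3 / 2 * cbin (Suc n) - cbin (Suc (Suc n))"
proof -
  have "(\<Sum>j\<le>n. (bcat j - bcat (Suc j)) / 2 * cbin (n - j))
      = (\<Sum>j\<le>n. cbin j * cbin (n - j) - 2 * (cbin (Suc j) * cbin (n - j)) + cbin (Suc (Suc j)) * cbin (n - j))"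
    by (intro sum.cong refl) (simp add: bcat_diff field_simps)
  also have "\<dots> = (\<Sum>j\<le>n. cbin j * cbin (n - j)) - 2 * (\<Sum>j\<le>n. cbin (Suc j) * cbin (n - j))
      + (\<Sum>j\<le>n. cbin (Suc (Suc j)) * cbin (n - j))"
    by (simp add: sum.distrib sum_subtractf sum_distrib_left)
  also have "(\<Sum>j\<le>n. cbin (Suc j) * cbin (n - j)) = 1 - cbin (Suc n)"
    using cbin_convolution[of "Suc n"] by (subst (asm) sum.atMost_Suc_shift) simp
  also have "(\<Sum>j\<le>n. cbin (Suc (Suc j)) * cbin (n - j)) = 1 - cbin (Suc (Suc n)) - cbin 1 * cbin (Suc n)"
    using cbin_convolution[of "Suc (Suc n)"] by (simp add: sum.atMost_Suc_shift del: sum.atMost_Suc)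
  also have "cbin 1 = 1 / 2"
    using cbin_Suc[of 0] by simp
  finally show ?thesis
    by (simp add: cbin_convolution)
qed

lemma bcat_second_diff_sum: "(\<Sum>j\<le>n. (bcat j - bcat (Suc j)) / 2) = (1 - bcat (Suc n)) / 2"
  by (induction n) (auto simp: field_simps)

lemma bcat_second_diff_sums: "(\<lambda>j. (bcat (j + n) - bcat (Suc (j + n))) / 2) sums (bcat n / 2)"
proof -
  have "(\<lambda>m. (bcat n - bcat (m + n)) / 2) \<longlonglongrightarrow> (bcat n - 0) / 2"
    using LIMSEQ_ignore_initial_segment[OF bcat_tendsto_0, of n] by (intro tendsto_intros) auto
  moreover have "(\<Sum>j<m. (bcat (j + n) - bcat (Suc (j + n))) / 2) = (bcat n - bcat (m + n)) / 2" for m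
    by (induction m) (auto simp: field_simps)
  ultimately show ?thesis
    unfolding sums_def by (simp only: diff_zero)
qed

text \<open>The second differences of \<open>cbin\<close> are the coefficients of \<open>(1 - z) powr (3/2)\<close>, whose product with
  the generating function \<open>(1 - z) powr (-1/2)\<close> of \<open>cbin\<close> is a polynomial; so a toll of order \<open>1/k\<close> is
  dominated by one for which the centred mean can be computed exactly.\<close>

lemma avg_bounded:
  assumes sums: "(\<lambda>k. bcat k * avg k (toll \<Phi>)) sums 0"
    and bd: "\<And>k. k \<ge> 1 \<Longrightarrow> \<bar>avg k (toll \<Phi>)\<bar> \<le> A / real k"
  shows "\<exists>M. \<forall>n. \<bar>avg n \<Phi>\<bar> \<le> M"
proof -
  define a where "a k = bcat k * avg k (toll \<Phi>)" for k
  define e where "e j = (bcat j - bcat (Suc j)) / 2" for j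
  \<comment> \<open>The factor 4/3 turns \<open>bcat j * A / (j + 2)\<close> into a multiple of
    \<open>e j\<close>. In \<open>W\<close>, the 7/4 is 5/4 from the main sum (3/4 from the
    difference of two \<open>cbin\<close> values and at most 1/2 from the remaining product) plus
    1/2 from the tail.\<close>
  define A' where "A' = 4 / 3 * A"
  define W where "W = 7 / 4 * A' + \<bar>a 1\<bar> / 2"
  have e_eq: "e j = bcat j * 3 / (4 * (real j + 2))" for j
    unfolding e_def bcat_second_diff by simp
  have e_nonneg: "0 \<le> e j" for j
    unfolding e_eq by simp
  have A_nonneg: "A \<ge> 0"
    using bd[of 1] by simp
  have a_le: "\<bar>a (j + 2)\<bar> \<le> A' * e j" for j
  proof -
    have "\<bar>a (j + 2)\<bar> = bcat (j + 2) * \<bar>avg (j + 2) (toll \<Phi>)\<bar>"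
      by (simp add: a_def abs_mult)
    also have "\<dots> \<le> bcat j * (A / real (j + 2))"
      by (intro mult_mono bcat_antimono bd) auto
    also have "\<dots> = A' * e j"
      unfolding A'_def e_eq by (simp add: field_simps)
    finally show ?thesis .
  qed
  have a_le': "- (A' * e j) \<le> a (j + 2)" "a (j + 2) \<le> A' * e j" for j
    using a_le[of j] by (auto simp: abs_le_iff)
  have main: "\<bar>avg (N + 2) \<Phi>\<bar> \<le> 2 * W" for N
  proof -
    define \<tau> where "\<tau> = (\<Sum>k\<le>N + 2. a k)"
    have "{..<N + 3} = {..N + 2}"
      by auto
    then have tail: "(\<lambda>j. a (j + (N + 3))) sums (- \<tau>)"
      using sums_split_initial_segment[OF sums[folded a_def], of "N + 3"] unfolding \<tau>_def by simp
    have E: "(\<lambda>j. A' * e (j + (N + 1))) sums (A' * (bcat (N + 1) / 2))"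
      unfolding e_def by (intro sums_mult bcat_second_diff_sums)
    have shift: "- (A' * e (j + (N + 1))) \<le> a (j + (N + 3))" "a (j + (N + 3)) \<le> A' * e (j + (N + 1))" for j
    proof -
      have "j + (N + 3) = j + (N + 1) + 2"
        by simp
      then show "- (A' * e (j + (N + 1))) \<le> a (j + (N + 3))" "a (j + (N + 3)) \<le> A' * e (j + (N + 1))"
        using a_le'[of "j + (N + 1)"] by metis+
    qed
    have "- \<tau> \<le> A' * (bcat (N + 1) / 2)"
      by (rule sums_le[OF shift(2) tail E])
    moreover have "- (A' * (bcat (N + 1) / 2)) \<le> - \<tau>"
      by (rule sums_le[OF shift(1) sums_minus[OF E] tail])
    ultimately have \<tau>: "\<bar>\<tau>\<bar> \<le> A' * (bcat (N + 1) / 2)"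
      by linarith
    have split: "(\<Sum>k\<le>N + 2. f k) = f 0 + f 1 + (\<Sum>j\<le>N. f (j + 2))" for f :: "nat \<Rightarrow> real"
      by (simp add: numeral_2_eq_2 sum.atMost_Suc_shift add.assoc del: sum.atMost_Suc)
    have "bcat (N + 2) * avg (N + 2) \<Phi> = (\<Sum>k\<le>N + 2. a k * cbin (N + 2 - k))"
      unfolding a_def by (rule avg_toll)
    \<comment> \<open>Subtracting \<open>cbin (N + 2)\<close> from the kernel removes the term k =
      0. The compensating sum \<tau> is minus a tail of a null series, so everything left is of the
      order of \<open>bcat\<close>, which the division by \<open>bcat (N + 2)\<close>
      cancels.\<close>
    also have "\<dots> = (\<Sum>k\<le>N + 2. a k * (cbin (N + 2 - k) - cbin (N + 2))) + cbin (N + 2) * \<tau>"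
      unfolding \<tau>_def sum_distrib_left sum.distrib[symmetric]
      by (intro sum.cong refl) (simp add: algebra_simps)
    also have "(\<Sum>k\<le>N + 2. a k * (cbin (N + 2 - k) - cbin (N + 2)))
        = a 1 * (cbin (N + 1) - cbin (N + 2)) + (\<Sum>j\<le>N. a (j + 2) * (cbin (N - j) - cbin (N + 2)))"
      unfolding split by simp
    finally have eq: "bcat (N + 2) * avg (N + 2) \<Phi> = a 1 * (cbin (N + 1) - cbin (N + 2))
        + (\<Sum>j\<le>N. a (j + 2) * (cbin (N - j) - cbin (N + 2))) + cbin (N + 2) * \<tau>" .
    have cd: "cbin (N + 1) - cbin (N + 2) = bcat (N + 1) / 2"
      using bcat_diff[of "N + 1"] by simp
    have "\<bar>\<Sum>j\<le>N. a (j + 2) * (cbin (N - j) - cbin (N + 2))\<bar> \<le> (\<Sum>j\<le>N. A' * (e j * (cbin (N - j) - cbin (N + 2))))"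
    proof (intro order.trans[OF sum_abs] sum_mono)
      fix j
      have d: "0 \<le> cbin (N - j) - cbin (N + 2)"
        by (simp add: cbin_antimono)
      then have "\<bar>a (j + 2) * (cbin (N - j) - cbin (N + 2))\<bar> = \<bar>a (j + 2)\<bar> * (cbin (N - j) - cbin (N + 2))"
        by (simp only: abs_mult abs_of_nonneg)
      also have "\<dots> \<le> (A' * e j) * (cbin (N - j) - cbin (N + 2))"
        by (intro mult_right_mono a_le d)
      finally show "\<bar>a (j + 2) * (cbin (N - j) - cbin (N + 2))\<bar> \<le> A' * (e j * (cbin (N - j) - cbin (N + 2)))"
        by (simp only: mult.assoc)
    qed
    also have "\<dots> = A' * ((\<Sum>j\<le>N. e j * cbin (N - j)) - cbin (N + 2) * (\<Sum>j\<le>N. e j))"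
      unfolding sum_distrib_left sum_subtractf[symmetric]
      by (intro sum.cong refl) (simp add: algebra_simps)
    also have "\<dots> = A' * (3 / 2 * (cbin (N + 1) - cbin (N + 2)) + cbin (N + 2) * bcat (N + 1) / 2)"
      unfolding e_def bcat_second_diff_convolution bcat_second_diff_sum by (simp add: field_simps)
    also have "\<dots> \<le> A' * (5 / 4 * bcat (N + 1))"
    proof (intro mult_left_mono)
      have "cbin (N + 2) * bcat (N + 1) \<le> 1 * bcat (N + 1)"
        by (intro mult_right_mono cbin_le_1) auto
      then show "3 / 2 * (cbin (N + 1) - cbin (N + 2)) + cbin (N + 2) * bcat (N + 1) / 2 \<le> 5 / 4 * bcat (N + 1)"
        unfolding cd by simp
    qed (use A_nonneg in \<open>simp add: A'_def\<close>)
    finally have s1: "\<bar>\<Sum>j\<le>N. a (j + 2) * (cbin (N - j) - cbin (N + 2))\<bar> \<le> A' * (5 / 4 * bcat (N + 1))" .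
    have s2: "\<bar>cbin (N + 2) * \<tau>\<bar> \<le> 1 * (A' * (bcat (N + 1) / 2))"
      unfolding abs_mult by (intro mult_mono \<tau>) (auto simp: cbin_le_1)
    have s3: "\<bar>a 1 * (cbin (N + 1) - cbin (N + 2))\<bar> = \<bar>a 1\<bar> * (bcat (N + 1) / 2)"
      unfolding cd by (simp add: abs_mult)
    have "\<bar>bcat (N + 2) * avg (N + 2) \<Phi>\<bar> \<le> \<bar>a 1\<bar> * (bcat (N + 1) / 2) + A' * (5 / 4 * bcat (N + 1)) + 1 * (A' * (bcat (N + 1) / 2))"
      using s1 s2 s3 unfolding eq by linarith
    also have "\<dots> = bcat (N + 1) * W"
      by (simp add: W_def field_simps)
    also have "\<dots> \<le> (2 * bcat (N + 2)) * W"
    proof (intro mult_right_mono)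
      have "bcat (N + 1) * (1 / 2) \<le> bcat (N + 1) * ((2 * real (N + 1) + 1) / (2 * real (N + 1) + 4))"
        by (intro mult_left_mono) (auto simp: field_simps)
      also have "\<dots> = bcat (N + 2)"
        using bcat_Suc[of "N + 1"] by simp
      finally show "bcat (N + 1) \<le> 2 * bcat (N + 2)"
        by simp
    qed (use A_nonneg in \<open>simp add: W_def A'_def\<close>)
    finally have "bcat (N + 2) * \<bar>avg (N + 2) \<Phi>\<bar> \<le> bcat (N + 2) * (2 * W)"
      by (simp add: abs_mult)
    then show ?thesis
      by (simp del: add_2_eq_Suc')
  qed
  have "\<bar>avg n \<Phi>\<bar> \<le> max (max \<bar>avg 0 \<Phi>\<bar> \<bar>avg 1 \<Phi>\<bar>) (2 * W)" for n
  proof (cases "n < 2")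
    case True
    then have "n = 0 \<or> n = 1" by auto
    then show ?thesis by auto
  next
    case False
    then have "n - 2 + 2 = n"
      by simp
    then have "\<bar>avg n \<Phi>\<bar> \<le> 2 * W"
      using main[of "n - 2"] by simp
    then show ?thesis
      by simp
  qed
  then show ?thesis by blast
qed

text \<open>The toll of the square is twice the product over the two subtrees, plus twice toll times
  value, minus the squared toll. Given the sizes the subtrees are independent, so the product
  averages to a product of means; the last term is dropped. A bounded mean toll then gives linear
  growth.\<close>

lemma avg_square_bound:
  assumes M: "\<And>n. \<bar>avg n \<Phi>\<bar> \<le> M"
    and B: "\<And>n. \<bar>avg n (\<lambda>t. toll \<Phi> t * \<Phi> t)\<bar> \<le> B"
  shows "avg n (\<lambda>t. (\<Phi> t)\<^sup>2) \<le> (2 * M\<^sup>2 + 2 * B) * (2 * real n + 1)"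
proof -
  define \<pi> where "\<pi> t = (case t of Leaf \<Rightarrow> 0 | Node l _ r \<Rightarrow> \<Phi> l * \<Phi> r)" for t :: "unit tree"
  have avg_\<pi>: "avg (Suc k) \<pi> \<le> M\<^sup>2" for k
  proof -
    have "bcat (Suc k) * avg (Suc k) \<pi>
        = (\<Sum>j\<le>k. (\<Sum>l\<in>bin_trees j. \<Phi> l) * (\<Sum>r\<in>bin_trees (k - j). \<Phi> r)) / 4 ^ Suc k"
      unfolding avg_Suc_scaled by (simp add: \<pi>_def sum_product)
    also have "\<dots> \<le> (\<Sum>j\<le>k. M\<^sup>2 * (real (card (bin_trees j)) * real (card (bin_trees (k - j))))) / 4 ^ Suc k"
    proof (intro divide_right_mono sum_mono)
      fix j
      have "avg j \<Phi> * avg (k - j) \<Phi> \<le> \<bar>avg j \<Phi>\<bar> * \<bar>avg (k - j) \<Phi>\<bar>"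
        by (metis abs_ge_self abs_mult)
      also have "\<dots> \<le> M * M"
        using M[of 0] by (intro mult_mono M) auto
      finally have m: "avg j \<Phi> * avg (k - j) \<Phi> \<le> M\<^sup>2"
        by (simp add: power2_eq_square)
      have "(\<Sum>l\<in>bin_trees j. \<Phi> l) * (\<Sum>r\<in>bin_trees (k - j). \<Phi> r)
          = (avg j \<Phi> * avg (k - j) \<Phi>) * (real (card (bin_trees j)) * real (card (bin_trees (k - j))))"
        unfolding sum_bin_trees card_bin_trees by simp
      also have "\<dots> \<le> M\<^sup>2 * (real (card (bin_trees j)) * real (card (bin_trees (k - j))))"
        by (intro mult_right_mono m) auto
      finally show "(\<Sum>l\<in>bin_trees j. \<Phi> l) * (\<Sum>r\<in>bin_trees (k - j). \<Phi> r)
          \<le> M\<^sup>2 * (real (card (bin_trees j)) * real (card (bin_trees (k - j))))" .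
    qed simp
    also have "\<dots> = M\<^sup>2 * (bcat (Suc k) * avg (Suc k) (\<lambda>_. 1))"
      unfolding avg_Suc_scaled by (simp add: sum_distrib_left)
    finally show ?thesis
      by simp
  qed
  have t: "avg k (toll (\<lambda>t. (\<Phi> t)\<^sup>2)) \<le> 2 * M\<^sup>2 + 2 * B" for k
  proof (cases k)
    case 0
    have "0 \<le> \<bar>\<Phi> Leaf * \<Phi> Leaf\<bar>"
      by simp
    with B[of 0] 0 show ?thesis
      by (simp add: power2_eq_square) (smt (verit) zero_le_square)
  next
    case (Suc m)
    have "avg k (toll (\<lambda>t. (\<Phi> t)\<^sup>2)) \<le> avg k (\<lambda>t. 2 * \<pi> t + 2 * (toll \<Phi> t * \<Phi> t))"
    proof (rule avg_mono)
      fix t :: "unit tree" assume "size t = k"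
      with Suc obtain l r where t: "t = Node l () r"
        by (cases t) auto
      have "2 * \<pi> t + 2 * (toll \<Phi> t * \<Phi> t) - toll (\<lambda>t. (\<Phi> t)\<^sup>2) t = (toll \<Phi> t)\<^sup>2"
        unfolding t by (simp add: \<pi>_def power2_eq_square algebra_simps)
      then show "toll (\<lambda>t. (\<Phi> t)\<^sup>2) t \<le> 2 * \<pi> t + 2 * (toll \<Phi> t * \<Phi> t)"
        by (smt (verit) zero_le_power2)
    qed
    also have "\<dots> = 2 * avg k \<pi> + 2 * avg k (\<lambda>t. toll \<Phi> t * \<Phi> t)"
      unfolding avg_add avg_cmult by simp
    also have "\<dots> \<le> 2 * M\<^sup>2 + 2 * B"
      using avg_\<pi>[of m] B[of k] Suc by (intro add_mono mult_left_mono) auto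
    finally show ?thesis .
  qed
  have "bcat n * avg n (\<lambda>t. (\<Phi> t)\<^sup>2) = (\<Sum>k\<le>n. bcat k * avg k (toll (\<lambda>t. (\<Phi> t)\<^sup>2)) * cbin (n - k))"
    by (rule avg_toll)
  also have "\<dots> \<le> (\<Sum>k\<le>n. bcat k * (2 * M\<^sup>2 + 2 * B) * cbin (n - k))"
    by (intro sum_mono mult_right_mono mult_left_mono t) auto
  also have "\<dots> = (2 * M\<^sup>2 + 2 * B) * (\<Sum>k\<le>n. bcat k * cbin (n - k))"
    unfolding sum_distrib_left by (intro sum.cong refl) (simp add: algebra_simps)
  also have "\<dots> = bcat n * ((2 * M\<^sup>2 + 2 * B) * (2 * real n + 1))"
    by (simp add: bcat_cbin_convolution)
  finally show ?thesis
    by simp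
qed

section \<open>Asymptotics of convolutions with \<open>cbin\<close>\<close>

lemma cbin_shift_ratio: "(\<lambda>n. cbin (n - k) / cbin n) \<longlonglongrightarrow> 1"
proof (rule tendsto_sandwich)
  show "\<forall>\<^sub>F n in sequentially. 1 \<le> cbin (n - k) / cbin n"
    by (intro always_eventually allI) (simp add: cbin_antimono)
  show "\<forall>\<^sub>F n in sequentially. cbin (n - k) / cbin n \<le> (2 * real n + 1) / (2 * (real n - real k) + 1)"
    using eventually_ge_at_top[of k]
  proof eventually_elim
    case (elim n)
    then show ?case
      using cbin_ratio_le[of "n - k" n] by (simp add: divide_simps of_nat_diff mult.commute)
  qed
  show "(\<lambda>n. (2 * real n + 1) / (2 * (real n - real k) + 1)) \<longlonglongrightarrow> 1"
    by real_asymp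
qed simp

text \<open>Indices up to n/2 are handled by dominated convergence. For larger ones the terms of
  \<open>a\<close> are o(1/n), while the \<open>cbin\<close> factors add up to at most
  \<open>(2 * n + 1) * cbin n\<close>.\<close>

lemma cbin_convolution_limit:
  fixes a :: "nat \<Rightarrow> real"
  assumes abs: "summable (\<lambda>k. \<bar>a k\<bar>)" and lim: "(\<lambda>k. real k * a k) \<longlonglongrightarrow> 0"
  shows "(\<lambda>n. (\<Sum>k\<le>n. a k * cbin (n - k)) / cbin n) \<longlonglongrightarrow> suminf a"
proof -
  \<comment> \<open>For k at most n/2, \<open>cbin_ratio_le\<close> bounds the quotient by (2n +
    1)/(n + 1), hence the dominating sequence with factor 2.\<close>
  define f where "f k n = (if k \<le> n div 2 then a k * (cbin (n - k) / cbin n) else 0)" for k n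
  have "(\<lambda>n. suminf (\<lambda>k. f k n)) \<longlonglongrightarrow> suminf a"
  proof (rule conjunct2[OF conjunct2[OF tannerys_theorem[where M = "\<lambda>k. 2 * \<bar>a k\<bar>"]]])
    fix k
    have "(\<lambda>n. a k * (cbin (n - k) / cbin n)) \<longlonglongrightarrow> a k * 1"
      by (intro tendsto_mult cbin_shift_ratio tendsto_const)
    then show "(\<lambda>n. f k n) \<longlonglongrightarrow> a k"
      unfolding mult_1_right
    proof (rule Lim_transform_eventually)
      show "\<forall>\<^sub>F n in sequentially. a k * (cbin (n - k) / cbin n) = f k n"
        using eventually_ge_at_top[of "2 * k"] by eventually_elim (auto simp: f_def)
    qed
  next
    have "norm (f k n) \<le> 2 * \<bar>a k\<bar>" for k n
    proof (cases "k \<le> n div 2")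
      case True
      then have k: "k \<le> n" "real n + 1 \<le> 2 * real (n - k) + 1" by auto
      have "cbin (n - k) * (real n + 1) \<le> cbin (n - k) * (2 * real (n - k) + 1)"
        by (intro mult_left_mono k) auto
      also have "\<dots> \<le> cbin n * (2 * real n + 1)"
        using k by (intro cbin_ratio_le) auto
      also have "\<dots> \<le> 2 * cbin n * (real n + 1)"
        by (simp add: algebra_simps)
      finally have "cbin (n - k) / cbin n \<le> 2"
        by (simp add: divide_simps)
      then have "\<bar>a k\<bar> * (cbin (n - k) / cbin n) \<le> \<bar>a k\<bar> * 2"
        by (intro mult_left_mono) auto
      with True show ?thesis
        by (simp add: f_def abs_mult)
    qed (simp add: f_def)
    then show "\<forall>\<^sub>F (k, n) in sequentially \<times>\<^sub>F sequentially. norm (f k n) \<le> 2 * \<bar>a k\<bar>"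
      by (intro always_eventually) auto
  qed (use abs in auto)
  moreover have "suminf (\<lambda>k. f k n) = (\<Sum>k\<le>n div 2. a k * cbin (n - k)) / cbin n" for n
    by (subst suminf_finite[of "{..n div 2}"]) (auto simp: f_def sum_divide_distrib)
  ultimately have L1: "(\<lambda>n. (\<Sum>k\<le>n div 2. a k * cbin (n - k)) / cbin n) \<longlonglongrightarrow> suminf a"
    by simp
  have L2: "(\<lambda>n. (\<Sum>k\<in>{n div 2<..n}. a k * cbin (n - k)) / cbin n) \<longlonglongrightarrow> 0"
  proof (rule LIMSEQ_I)
    fix r :: real assume "r > 0"
    \<comment> \<open>With r/7, the bound 2r/(7n) on the terms times 2n + 1, which is at most 3n,
      leaves 6r/7.\<close>
    then obtain K where K: "\<bar>real k * a k\<bar> < r / 7" if "k \<ge> K" for k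
      using LIMSEQ_D[OF lim, of "r / 7"] by auto
    show "\<exists>N. \<forall>n\<ge>N. norm ((\<Sum>k\<in>{n div 2<..n}. a k * cbin (n - k)) / cbin n - 0) < r"
    proof (intro exI[of _ "2 * K + 1"] allI impI)
      fix n assume n: "2 * K + 1 \<le> n"
      then have n0: "real n > 0" by simp
      have "\<bar>\<Sum>k\<in>{n div 2<..n}. a k * cbin (n - k)\<bar> \<le> (\<Sum>k\<in>{n div 2<..n}. 2 * r / (7 * real n) * cbin (n - k))"
      proof (intro order.trans[OF sum_abs] sum_mono)
        fix k assume k: "k \<in> {n div 2<..n}"
        then have "real n * \<bar>a k\<bar> \<le> 2 * real k * \<bar>a k\<bar>"
          by (intro mult_right_mono) auto
        also have "\<dots> \<le> 2 * (r / 7)"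
          using K[of k] k n by (force simp: abs_mult mult.commute mult.left_commute)
        finally have "\<bar>a k\<bar> \<le> 2 * r / (7 * real n)"
          using n0 by (simp add: field_simps)
        then show "\<bar>a k * cbin (n - k)\<bar> \<le> 2 * r / (7 * real n) * cbin (n - k)"
          unfolding abs_mult by (intro mult_mono) auto
      qed
      also have "\<dots> = 2 * r / (7 * real n) * (\<Sum>k\<in>{n div 2<..n}. cbin (n - k))"
        by (simp add: sum_distrib_left)
      also have "(\<Sum>k\<in>{n div 2<..n}. cbin (n - k)) \<le> (\<Sum>k\<le>n. cbin (n - k))"
        by (intro sum_mono2) auto
      also have "(\<Sum>k\<le>n. cbin (n - k)) = (\<Sum>k\<le>n. cbin k)"
        by (rule sum.reindex_bij_witness[of _ "\<lambda>k. n - k" "\<lambda>k. n - k"]) auto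
      also have "\<dots> = (2 * real n + 1) * cbin n"
        by (rule cbin_sum)
      finally have "\<bar>\<Sum>k\<in>{n div 2<..n}. a k * cbin (n - k)\<bar> / cbin n \<le> 2 * r / (7 * real n) * (2 * real n + 1)"
        using n0 \<open>r > 0\<close> by (simp add: divide_simps)
      also have "\<dots> \<le> 2 * r / (7 * real n) * (3 * real n)"
        using n0 n \<open>r > 0\<close> by (intro mult_left_mono) auto
      also have "\<dots> < r"
        using n0 \<open>r > 0\<close> by simp
      finally show "norm ((\<Sum>k\<in>{n div 2<..n}. a k * cbin (n - k)) / cbin n - 0) < r"
        by simp
    qed
  qed
  have "(\<Sum>k\<le>n. a k * cbin (n - k)) = (\<Sum>k\<le>n div 2. a k * cbin (n - k)) + (\<Sum>k\<in>{n div 2<..n}. a k * cbin (n - k))" for n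
    by (subst sum.union_disjoint[symmetric]) (auto intro!: sum.cong)
  then show ?thesis
    using tendsto_add[OF L1 L2] by (simp add: add_divide_distrib)
qed

section \<open>A law of large numbers for additive functionals\<close>

fun addf :: "(unit tree \<Rightarrow> real) \<Rightarrow> unit tree \<Rightarrow> real" where
  "addf g Leaf = g Leaf"
| "addf g (Node l x r) = addf g l + addf g r + g (Node l x r)"

lemma toll_addf [simp]: "toll (addf g) = g"
proof
  fix t
  show "toll (addf g) t = g t"
    by (cases t) auto
qed

lemma addf_toll: "addf (toll \<Phi>) t = \<Phi> t"
  by (induction t) auto

lemma addf_add: "addf (\<lambda>t. f t + g t) t = addf f t + addf g t"
  by (induction t) auto

lemma abs_addf_le: "\<bar>addf g t\<bar> \<le> addf (\<lambda>t. \<bar>g t\<bar>) t"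
  by (induction t) auto

text \<open>Subtracting \<theta> times size plus one changes only the leaf toll, by exactly the
  amount that makes the weighted toll series vanish. The centred functional then has bounded mean,
  and its toll is zero on large subtrees.\<close>

lemma truncated_addf_square_bound:
  fixes g :: "unit tree \<Rightarrow> real"
  assumes trunc: "\<And>t. size t > K \<Longrightarrow> g t = 0"
  defines "\<theta> \<equiv> \<Sum>k\<le>K. bcat k * avg k g"
  shows "\<exists>B. \<forall>n. avg n (\<lambda>t. (addf g t - \<theta> * (real n + 1))\<^sup>2) \<le> B * (2 * real n + 1)"
proof -
  define \<Phi> where "\<Phi> t = addf g t - \<theta> * (real (size t) + 1)" for t
  define B where "B = (\<Sum>k\<le>K. \<bar>avg k (\<lambda>t. toll \<Phi> t * \<Phi> t)\<bar>)"
  have toll_Node: "toll \<Phi> t = g t" if "size t \<noteq> 0" for t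
    using that by (cases t) (auto simp: \<Phi>_def algebra_simps)
  have avg_toll_pos: "avg k (toll \<Phi>) = avg k g" if "k \<noteq> 0" for k
    using that by (intro avg_cong toll_Node) auto
  have avg_g: "avg k g = 0" if "k > K" for k
  proof -
    have "avg k g = avg k (\<lambda>_. 0)"
      using that by (intro avg_cong trunc) auto
    then show ?thesis by simp
  qed
  have "\<exists>M. \<forall>n. \<bar>avg n \<Phi>\<bar> \<le> M"
  proof (rule avg_bounded)
    have "(\<lambda>k. bcat k * avg k g) sums \<theta>"
      unfolding \<theta>_def using sums_finite[of "{..K}" "\<lambda>k. bcat k * avg k g"] by (auto simp: avg_g)
    from sums_diff[OF this sums_single[of 0 "\<lambda>_. \<theta>"]]
    have "(\<lambda>k. bcat k * avg k g - (if k = 0 then \<theta> else 0)) sums 0"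
      by simp
    moreover have "(\<lambda>k. bcat k * avg k g - (if k = 0 then \<theta> else 0)) = (\<lambda>k. bcat k * avg k (toll \<Phi>))"
      by (auto simp: fun_eq_iff avg_toll_pos \<Phi>_def)
    ultimately show "(\<lambda>k. bcat k * avg k (toll \<Phi>)) sums 0"
      by simp
  next
    fix k :: nat assume k: "1 \<le> k"
    show "\<bar>avg k (toll \<Phi>)\<bar> \<le> (\<Sum>j\<le>K. real j * \<bar>avg j g\<bar>) / real k"
    proof (cases "k \<le> K")
      case True
      have "real k * \<bar>avg k g\<bar> \<le> (\<Sum>j\<le>K. real j * \<bar>avg j g\<bar>)"
        using True by (intro member_le_sum) auto
      then show ?thesis
        using k by (simp add: avg_toll_pos field_simps)
    next
      case False
      then show ?thesis
        using k by (simp add: avg_toll_pos avg_g sum_nonneg)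
    qed
  qed
  then obtain M where M: "\<bar>avg n \<Phi>\<bar> \<le> M" for n
    by blast
  have "\<bar>avg n (\<lambda>t. toll \<Phi> t * \<Phi> t)\<bar> \<le> B" for n
  proof (cases "n \<le> K")
    case True
    then show ?thesis
      unfolding B_def by (intro member_le_sum) auto
  next
    case False
    then have "avg n (\<lambda>t. toll \<Phi> t * \<Phi> t) = avg n (\<lambda>_. 0)"
      by (intro avg_cong) (auto simp: toll_Node trunc)
    then show ?thesis
      by (simp add: B_def sum_nonneg)
  qed
  from avg_square_bound[OF M this]
  have "avg n (\<lambda>t. (\<Phi> t)\<^sup>2) \<le> (2 * M\<^sup>2 + 2 * B) * (2 * real n + 1)" for n .
  moreover have "avg n (\<lambda>t. (\<Phi> t)\<^sup>2) = avg n (\<lambda>t. (addf g t - \<theta> * (real n + 1))\<^sup>2)" for n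
    by (intro avg_cong) (simp add: \<Phi>_def)
  ultimately show ?thesis
    by auto
qed

text \<open>The part with toll truncated at size K has fluctuations of order sqrt n. The rest is
  estimated in mean absolute value: after division by n + 1 its bound converges to a tail of the
  dominating series, which is small for large K.\<close>

theorem additive_functional_lln:
  fixes \<Phi> :: "unit tree \<Rightarrow> real" and \<rho> :: "nat \<Rightarrow> real"
  assumes bd: "\<And>t. \<bar>toll \<Phi> t\<bar> \<le> \<rho> (size t)"
    and summ: "summable (\<lambda>k. bcat k * \<rho> k)"
    and lim: "(\<lambda>k. real k * (bcat k * \<rho> k)) \<longlonglongrightarrow> 0"
  shows "(\<lambda>n. avg n (\<lambda>t. \<bar>\<Phi> t / (real n + 1) - (\<Sum>k. bcat k * avg k (toll \<Phi>))\<bar>)) \<longlonglongrightarrow> 0"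
proof (rule LIMSEQ_I)
  fix \<epsilon> :: real assume "\<epsilon> > 0"
  define \<theta> where "\<theta> = (\<Sum>k. bcat k * avg k (toll \<Phi>))"
  have "\<exists>t :: unit tree. size t = k" for k
    using bin_trees_nonempty[of k] unfolding bin_trees_def by blast
  then have \<rho>_nonneg: "0 \<le> \<rho> k" for k
    using bd by (metis abs_ge_zero order.trans)
  define r where "r k = bcat k * \<rho> k" for k
  have r_nonneg: "0 \<le> r k" for k
    by (simp add: r_def \<rho>_nonneg)
  have avg_le: "\<bar>avg k (toll \<Phi>)\<bar> \<le> \<rho> k" for k
  proof -
    have "\<bar>avg k (toll \<Phi>)\<bar> \<le> avg k (\<lambda>t. \<bar>toll \<Phi> t\<bar>)"
      by (rule abs_avg_le)
    also have "\<dots> \<le> \<rho> k"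
      using bd by (intro avg_le_const) metis
    finally show ?thesis .
  qed
  then have term_le: "\<bar>bcat k * avg k (toll \<Phi>)\<bar> \<le> r k" for k
    by (simp add: r_def abs_mult)
  have summ_r: "summable r"
    using summ by (simp add: r_def[abs_def])
  have summ_t: "summable (\<lambda>k. bcat k * avg k (toll \<Phi>))"
    by (rule summable_comparison_test'[OF summ_r, of 0]) (use term_le in auto)
  have "(\<lambda>K. \<Sum>k. r (k + K)) \<longlonglongrightarrow> 0"
    by (rule suminf_exist_split2[OF summ_r])
  from LIMSEQ_D[OF this, of "\<epsilon> / 4"] \<open>\<epsilon> > 0\<close> obtain K0
    where K0: "\<bar>\<Sum>k. r (k + K)\<bar> < \<epsilon> / 4" if "K \<ge> K0" for K
    by auto
  define K where "K = K0"
  define T where "T = (\<Sum>k. r (k + Suc K))"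
  have T: "T < \<epsilon> / 4"
    using K0[of "Suc K"] by (simp add: T_def K_def)
  define g1 where "g1 t = (if size t \<le> K then toll \<Phi> t else 0)" for t
  define g2 where "g2 t = (if size t \<le> K then 0 else toll \<Phi> t)" for t
  define \<theta>1 where "\<theta>1 = (\<Sum>k\<le>K. bcat k * avg k g1)"
  have avg_g1: "avg k g1 = avg k (toll \<Phi>)" if "k \<le> K" for k
    using that by (intro avg_cong) (auto simp: g1_def)
  have \<Phi>_split: "\<Phi> t = addf g1 t + addf g2 t" for t
  proof -
    have "(\<lambda>t. g1 t + g2 t) = toll \<Phi>"
      by (auto simp: g1_def g2_def)
    then show ?thesis
      by (metis addf_add addf_toll)
  qed
  have "\<theta> = (\<Sum>k. bcat (k + Suc K) * avg (k + Suc K) (toll \<Phi>)) + \<theta>1"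
    unfolding \<theta>_def by (subst suminf_split_initial_segment[OF summ_t, of "Suc K"])
      (simp add: \<theta>1_def avg_g1 lessThan_Suc_atMost)
  moreover have "\<bar>\<Sum>k. bcat (k + Suc K) * avg (k + Suc K) (toll \<Phi>)\<bar> \<le> T"
    unfolding T_def
  proof (rule order.trans[OF summable_rabs suminf_le])
    show "summable (\<lambda>k. r (k + Suc K))"
      using summ_r by (rule summable_ignore_initial_segment)
    then show "summable (\<lambda>k. \<bar>bcat (k + Suc K) * avg (k + Suc K) (toll \<Phi>)\<bar>)"
      by (rule summable_comparison_test'[of _ 0]) (use term_le in auto)
    then show "summable (\<lambda>k. \<bar>bcat (k + Suc K) * avg (k + Suc K) (toll \<Phi>)\<bar>)" .
  qed (use term_le in auto)
  ultimately have \<theta>_diff: "\<bar>\<theta>1 - \<theta>\<bar> \<le> T"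
    by linarith
  obtain B where B: "avg n (\<lambda>t. (addf g1 t - \<theta>1 * (real n + 1))\<^sup>2) \<le> B * (2 * real n + 1)" for n
    using truncated_addf_square_bound[of K g1] unfolding \<theta>1_def by (auto simp: g1_def)
  have first: "(\<lambda>n. avg n (\<lambda>t. \<bar>addf g1 t - \<theta>1 * (real n + 1)\<bar>) / (real n + 1)) \<longlonglongrightarrow> 0"
  proof (rule tendsto_sandwich)
    show "\<forall>\<^sub>F n in sequentially. avg n (\<lambda>t. \<bar>addf g1 t - \<theta>1 * (real n + 1)\<bar>) / (real n + 1)
        \<le> sqrt (B * (2 * real n + 1)) / (real n + 1)"
      by (intro always_eventually allI divide_right_mono order.trans[OF avg_abs_le_sqrt] real_sqrt_le_mono B) auto
    show "\<forall>\<^sub>F n in sequentially. 0 \<le> avg n (\<lambda>t. \<bar>addf g1 t - \<theta>1 * (real n + 1)\<bar>) / (real n + 1)"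
      by (intro always_eventually allI divide_nonneg_nonneg avg_nonneg) auto
    have "(\<lambda>n. sqrt B * (sqrt (2 * real n + 1) / (real n + 1))) \<longlonglongrightarrow> sqrt B * 0"
      by (intro tendsto_mult tendsto_const) real_asymp
    then show "(\<lambda>n. sqrt (B * (2 * real n + 1)) / (real n + 1)) \<longlonglongrightarrow> 0"
      by (simp add: real_sqrt_mult)
  qed simp
  \<comment> \<open>Since \<open>bcat n / cbin n\<close> is 1/(n + 1), the quotient in
    \<open>cbin_convolution_limit\<close> is already the normalised mean of the tail
    functional.\<close>
  define s where "s k = (if k \<le> K then 0 else r k)" for k
  have s_le: "0 \<le> s k" "s k \<le> r k" for k
    by (auto simp: s_def r_nonneg)
  have summ_s: "summable s"
    by (rule summable_comparison_test'[OF summ_r, of 0]) (use s_le in auto)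
  have "(\<lambda>n. (\<Sum>k\<le>n. s k * cbin (n - k)) / cbin n) \<longlonglongrightarrow> suminf s"
  proof (rule cbin_convolution_limit)
    show "summable (\<lambda>k. \<bar>s k\<bar>)"
      using summ_s s_le by simp
    have "(\<lambda>k. real k * r k) \<longlonglongrightarrow> 0"
      using lim by (simp add: r_def)
    then show "(\<lambda>k. real k * s k) \<longlonglongrightarrow> 0"
    proof (rule Lim_transform_eventually)
      show "\<forall>\<^sub>F k in sequentially. real k * r k = real k * s k"
        using eventually_gt_at_top[of K] by eventually_elim (auto simp: s_def)
    qed
  qed
  moreover have "suminf s = T"
    unfolding T_def by (subst suminf_split_initial_segment[OF summ_s, of "Suc K"]) (simp add: s_def)
  ultimately have second: "(\<lambda>n. (\<Sum>k\<le>n. s k * cbin (n - k)) / cbin n) \<longlonglongrightarrow> T"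
    by simp
  have second_le: "avg n (\<lambda>t. \<bar>addf g2 t\<bar>) / (real n + 1) \<le> (\<Sum>k\<le>n. s k * cbin (n - k)) / cbin n" for n
  proof -
    have "avg n (\<lambda>t. \<bar>addf g2 t\<bar>) \<le> avg n (addf (\<lambda>t. \<bar>g2 t\<bar>))"
      by (intro avg_mono abs_addf_le)
    then have "bcat n * avg n (\<lambda>t. \<bar>addf g2 t\<bar>) \<le> bcat n * avg n (addf (\<lambda>t. \<bar>g2 t\<bar>))"
      by simp
    also have "\<dots> = (\<Sum>k\<le>n. bcat k * avg k (\<lambda>t. \<bar>g2 t\<bar>) * cbin (n - k))"
      by (subst avg_toll) simp
    also have "\<dots> \<le> (\<Sum>k\<le>n. s k * cbin (n - k))"
    proof (intro sum_mono mult_right_mono)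
      fix k
      have "avg k (\<lambda>t. \<bar>g2 t\<bar>) \<le> (if k \<le> K then 0 else \<rho> k)"
        using bd by (intro avg_le_const) (auto simp: g2_def)
      then have "bcat k * avg k (\<lambda>t. \<bar>g2 t\<bar>) \<le> bcat k * (if k \<le> K then 0 else \<rho> k)"
        by (intro mult_left_mono) auto
      also have "\<dots> = s k"
        by (simp add: s_def r_def)
      finally show "bcat k * avg k (\<lambda>t. \<bar>g2 t\<bar>) \<le> s k" .
    qed auto
    finally have "bcat n * avg n (\<lambda>t. \<bar>addf g2 t\<bar>) / cbin n \<le> (\<Sum>k\<le>n. s k * cbin (n - k)) / cbin n"
      by (intro divide_right_mono) auto
    then show ?thesis
      by (simp add: bcat_def)
  qed
  have "\<forall>\<^sub>F n in sequentially. avg n (\<lambda>t. \<bar>addf g1 t - \<theta>1 * (real n + 1)\<bar>) / (real n + 1) < \<epsilon> / 4"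
    using order_tendstoD(2)[OF first, of "\<epsilon> / 4"] \<open>\<epsilon> > 0\<close> by simp
  moreover have "\<forall>\<^sub>F n in sequentially. (\<Sum>k\<le>n. s k * cbin (n - k)) / cbin n < \<epsilon> / 4"
    using order_tendstoD(2)[OF second T] .
  ultimately have "\<forall>\<^sub>F n in sequentially. avg n (\<lambda>t. \<bar>\<Phi> t / (real n + 1) - \<theta>\<bar>) < \<epsilon>"
  proof eventually_elim
    case (elim n)
    have "avg n (\<lambda>t. \<bar>\<Phi> t / (real n + 1) - \<theta>\<bar>)
        \<le> avg n (\<lambda>t. \<bar>addf g1 t - \<theta>1 * (real n + 1)\<bar> / (real n + 1) + \<bar>addf g2 t\<bar> / (real n + 1) + T)"
    proof (rule avg_mono)
      fix t
      have n: "real n + 1 > 0"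
        by simp
      have "\<Phi> t / (real n + 1) - \<theta> = (addf g1 t - \<theta>1 * (real n + 1)) / (real n + 1)
          + addf g2 t / (real n + 1) + (\<theta>1 - \<theta>)"
        unfolding \<Phi>_split using n by (simp add: add_divide_distrib diff_divide_distrib)
      moreover have "\<bar>u + v + w\<bar> \<le> \<bar>u\<bar> + \<bar>v\<bar> + \<bar>w\<bar>" for u v w :: real
        by linarith
      ultimately have "\<bar>\<Phi> t / (real n + 1) - \<theta>\<bar> \<le> \<bar>(addf g1 t - \<theta>1 * (real n + 1)) / (real n + 1)\<bar>
          + \<bar>addf g2 t / (real n + 1)\<bar> + \<bar>\<theta>1 - \<theta>\<bar>"
        by metis
      also have "\<dots> \<le> \<bar>(addf g1 t - \<theta>1 * (real n + 1)) / (real n + 1)\<bar> + \<bar>addf g2 t / (real n + 1)\<bar> + T"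
        by (intro add_left_mono \<theta>_diff)
      finally show "\<bar>\<Phi> t / (real n + 1) - \<theta>\<bar>
          \<le> \<bar>addf g1 t - \<theta>1 * (real n + 1)\<bar> / (real n + 1) + \<bar>addf g2 t\<bar> / (real n + 1) + T"
        using n by (simp only: abs_divide abs_of_pos)
    qed
    also have "\<dots> = avg n (\<lambda>t. \<bar>addf g1 t - \<theta>1 * (real n + 1)\<bar>) / (real n + 1)
        + avg n (\<lambda>t. \<bar>addf g2 t\<bar>) / (real n + 1) + T"
      unfolding avg_add avg_divide by simp
    also have "\<dots> < \<epsilon>"
      using elim second_le[of n] T \<open>\<epsilon> > 0\<close> by linarith
    finally show ?case .
  qed
  moreover have "0 \<le> avg n (\<lambda>t. \<bar>\<Phi> t / (real n + 1) - \<theta>\<bar>)" for n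
    by (rule avg_nonneg) simp
  ultimately show "\<exists>N. \<forall>n\<ge>N. norm (avg n (\<lambda>t. \<bar>\<Phi> t / (real n + 1) - (\<Sum>k. bcat k * avg k (toll \<Phi>))\<bar>) - 0) < \<epsilon>"
    unfolding eventually_sequentially \<theta>_def by simp
qed

section \<open>The harmonic toll\<close>

text \<open>The doubled sum of odd reciprocals is ln k up to a constant and a vanishing error. The
  shift gives a node without proper subtrees the toll -2, which is used in
  \<open>bcat_htoll_sums\<close> and \<open>hfun_remy_sum\<close>.\<close>

definition htoll :: "nat \<Rightarrow> real" where
  "htoll k = 2 * (\<Sum>i<k. 1 / (2 * real i + 1)) - 4"

abbreviation hfun :: "unit tree \<Rightarrow> real" where
  "hfun \<equiv> add_fun htoll"

lemma htoll_0 [simp]: "htoll 0 = -4"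
  by (simp add: htoll_def)

lemma htoll_Suc: "htoll (Suc k) = htoll k + 2 / (2 * real k + 1)"
  by (simp add: htoll_def)

lemma htoll_mono: "m \<le> n \<Longrightarrow> htoll m \<le> htoll n"
  by (rule lift_Suc_mono_le[of htoll]) (auto simp: htoll_Suc)

lemma htoll_ge: "-4 \<le> htoll k"
  using htoll_mono[of 0 k] by simp

lemma htoll_le: "htoll k \<le> 4 * ln (real k + 1)"
proof (induction k)
  case (Suc k)
  have "ln ((real k + 1) / (real k + 2)) \<le> (real k + 1) / (real k + 2) - 1"
    by (intro ln_le_minus_one) auto
  also have "\<dots> = - 1 / (real k + 2)"
    by (simp add: field_simps)
  finally have "1 / (real k + 2) \<le> ln (real k + 2) - ln (real k + 1)"
    by (simp add: ln_div)
  moreover have "2 / (2 * real k + 1) \<le> 4 * (1 / (real k + 2))"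
    by (simp add: field_simps)
  ultimately show ?case
    using Suc by (simp add: htoll_Suc add.commute)
qed simp

lemma abs_htoll_le: "\<bar>htoll k\<bar> \<le> 4 * (1 + ln (real k + 1))"
proof -
  have "\<bar>a\<bar> \<le> 4 * (1 + x)" if "0 \<le> x" "-4 \<le> a" "a \<le> 4 * x" for a x :: real
    unfolding distrib_left using that by linarith
  then show ?thesis
    using htoll_ge[of k] htoll_le[of k] by simp
qed

text \<open>The midpoint estimate of the integral of 1/x makes \<open>u\<close> decrease, and the
  cruder bound by the left endpoint makes \<open>v\<close> increase. Their common limit is \<kappa>,
  and their gap is 1/k.\<close>

lemma htoll_ln:
  obtains \<kappa> where "\<And>k. k \<ge> 1 \<Longrightarrow> 0 \<le> htoll k - ln (real k) - \<kappa>"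
    and "\<And>k. k \<ge> 1 \<Longrightarrow> htoll k - ln (real k) - \<kappa> \<le> 1 / real k"
proof -
  define u where "u k = htoll (Suc k) - ln (real (Suc k))" for k
  define v where "v k = u k - 1 / real (Suc k)" for k
  have u_step: "u (Suc k) \<le> u k" for k
  proof -
    define x where "x = real k + 1"
    have x: "x > 0"
      by (simp add: x_def)
    have "2 / (2 * x + 1) \<le> ln (x + 1) - ln x"
      using ln_inverse_approx_ge[of x "x + 1"] x by (simp add: field_simps)
    then show ?thesis
      by (simp add: u_def htoll_Suc x_def algebra_simps)
  qed
  have v_step: "v k \<le> v (Suc k)" for k
  proof -
    define x where "x = real k + 1"
    have x: "x > 0"
      by (simp add: x_def)
    have "ln ((x + 1) / x) \<le> (x + 1) / x - 1"
      using x by (intro ln_le_minus_one) auto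
    then have "ln (x + 1) - ln x \<le> 1 / x"
      using x by (simp add: ln_div field_simps)
    moreover have "1 / (x + 1) \<le> 2 / (2 * x + 1)"
      using x by (simp add: field_simps)
    ultimately have "ln (x + 1) - ln x - 1 / x \<le> 2 / (2 * x + 1) - 1 / (x + 1)"
      by linarith
    then show ?thesis
      by (simp add: v_def u_def htoll_Suc[of "Suc k"] x_def algebra_simps)
  qed
  have u_mono: "m \<le> n \<Longrightarrow> u n \<le> u m" for m n
    by (rule lift_Suc_antimono_le[of u]) (rule u_step)
  have v_mono: "m \<le> n \<Longrightarrow> v m \<le> v n" for m n
    by (rule lift_Suc_mono_le[of v]) (rule v_step)
  have vu: "v k \<le> u k" for k
    by (simp add: v_def)
  have bound: "v k \<le> u n" for k n
    using v_mono[of k "max k n"] u_mono[of n "max k n"] vu[of "max k n"] by linarith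
  define \<kappa> where "\<kappa> = (INF k. u k)"
  have bdd: "bdd_below (range u)"
    using bound[of 0] by (intro bdd_belowI[of _ "v 0"]) auto
  have "0 \<le> htoll k - ln (real k) - \<kappa>" "htoll k - ln (real k) - \<kappa> \<le> 1 / real k" if "k \<ge> 1" for k
  proof -
    have "\<kappa> \<le> u (k - 1)"
      unfolding \<kappa>_def by (rule cINF_lower[OF bdd]) simp
    moreover have "v (k - 1) \<le> \<kappa>"
      unfolding \<kappa>_def by (rule cINF_greatest) (auto intro: bound)
    ultimately show "0 \<le> htoll k - ln (real k) - \<kappa>" "htoll k - ln (real k) - \<kappa> \<le> 1 / real k"
      using that by (simp_all add: u_def v_def)
  qed
  then show ?thesis
    using that by blast
qed

lemma cbin_le: "cbin n \<le> 1 / sqrt (2 * real n + 1)"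
proof -
  have "cbin n = sqrt (cbin n ^ 2)"
    by simp
  also have "\<dots> \<le> sqrt (1 / (2 * real n + 1))"
    using cbin_sq_le[of n] by (intro real_sqrt_le_mono) (simp add: field_simps)
  finally show ?thesis
    by (simp add: real_sqrt_divide)
qed

lemma bcat_le: "bcat n \<le> 1 / ((real n + 1) * sqrt (2 * real n + 1))"
  using divide_right_mono[OF cbin_le[of n], of "real n + 1"] by (simp add: bcat_def mult.commute)

text \<open>The weighted tolls have the explicit antidifference \<open>Q\<close>, which tends to 0
  and vanishes at 1 because \<open>htoll 1\<close> is -2. Hence the harmonic functional has no
  linear term in its mean.\<close>

lemma bcat_htoll_sums: "(\<lambda>k. bcat (Suc k) * htoll (Suc k)) sums 0"
proof -
  define Q where "Q k = - 2 * cbin k * (htoll k + 2)" for k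
  have "bcat k * htoll k = Q (Suc k) - Q k" for k
    unfolding Q_def bcat_def cbin_Suc htoll_Suc by (simp add: divide_simps) algebra
  moreover have "(\<lambda>n. Q (Suc n)) \<longlonglongrightarrow> 0"
  proof (rule LIMSEQ_Suc, rule Lim_null_comparison)
    show "\<forall>\<^sub>F k in sequentially. norm (Q k) \<le> 2 * (1 / sqrt (2 * real k + 1)) * (4 * (1 + ln (real k + 1)) + 2)"
    proof (intro always_eventually allI)
      fix k
      have "norm (Q k) = 2 * cbin k * \<bar>htoll k + 2\<bar>"
        by (simp add: Q_def abs_mult)
      also have "\<dots> \<le> 2 * (1 / sqrt (2 * real k + 1)) * (4 * (1 + ln (real k + 1)) + 2)"
        using abs_htoll_le[of k] by (intro mult_mono cbin_le) auto
      finally show "norm (Q k) \<le> 2 * (1 / sqrt (2 * real k + 1)) * (4 * (1 + ln (real k + 1)) + 2)" .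
    qed
  qed real_asymp
  from telescope_sums[OF this] have "(\<lambda>n. Q (Suc (Suc n)) - Q (Suc n)) sums (0 - Q (Suc 0))" .
  moreover have "Q (Suc 0) = 0"
    by (simp add: Q_def htoll_Suc)
  ultimately show ?thesis
    by simp
qed

lemma hfun_abs_le: "\<bar>hfun t\<bar> \<le> real (size t) * (4 * (1 + ln (real (size t) + 1)))"
proof -
  \<comment> \<open>The logarithm is frozen at a common n above all sizes, so the bounds for the
    subtrees simply add up.\<close>
  have "\<bar>hfun t\<bar> \<le> real (size t) * (4 * (1 + ln (real n + 1)))" if "size t \<le> n" for n
    using that
  proof (induction t)
    case (Node l x r)
    have "\<bar>htoll (size (Node l x r))\<bar> \<le> 4 * (1 + ln (real (size (Node l x r)) + 1))"
      by (rule abs_htoll_le)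
    also have "\<dots> \<le> 4 * (1 + ln (real n + 1))"
      using Node.prems by (intro mult_left_mono add_left_mono ln_mono) auto
    finally have "\<bar>htoll (size (Node l x r))\<bar> \<le> 4 * (1 + ln (real n + 1))" .
    moreover have "\<bar>hfun l\<bar> \<le> real (size l) * (4 * (1 + ln (real n + 1)))"
        "\<bar>hfun r\<bar> \<le> real (size r) * (4 * (1 + ln (real n + 1)))"
      using Node by auto
    ultimately show ?case
      by (simp add: algebra_simps)
  qed simp
  then show ?thesis by blast
qed

section \<open>Effect of a grafting on the harmonic functional\<close>

lemma hfun_remy_left:
  assumes "l' \<in> set (remy l)"
  shows "hfun (Node l' x r) - hfun (Node l x r) = hfun l' - hfun l + 2 / (2 * real (size (Node l x r)) + 1)"
  using assms by (simp add: size_remy htoll_Suc[of "Suc (size l + size r)"])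

lemma hfun_remy_right:
  assumes "r' \<in> set (remy r)"
  shows "hfun (Node l x r') - hfun (Node l x r) = hfun r' - hfun r + 2 / (2 * real (size (Node l x r)) + 1)"
  using assms by (simp add: size_remy htoll_Suc[of "Suc (size l + size r)"])

text \<open>Grafting at a subtree of size s creates a toll \<open>htoll (s + 1)\<close>, at least
  -2, and adds 2/(2m + 1) for each ancestor of size m. These sizes are distinct and exceed s, so the
  increments sum to at most \<open>htoll (size t + 1) - htoll (s + 1)\<close>.\<close>

lemma hfun_remy_bounds:
  assumes "t' \<in> set (remy t)"
  shows "-2 \<le> hfun t' - hfun t \<and> hfun t' - hfun t \<le> htoll (Suc (size t))"
  using assms
proof (induction t arbitrary: t')
  case Leaf
  then show ?case by (simp add: htoll_Suc)
next
  case (Node l x r)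
  let ?m = "size (Node l x r)"
  have h: "htoll (Suc ?m) = htoll ?m + 2 / (2 * real ?m + 1)"
    by (rule htoll_Suc)
  have pos: "0 \<le> 2 / (2 * real ?m + 1)"
    by simp
  have ge: "-2 \<le> htoll (Suc k)" for k
    using htoll_mono[of 1 "Suc k"] by (simp add: htoll_Suc)
  consider "t' = Node Leaf () (Node l x r)" | "t' = Node (Node l x r) () Leaf"
    | l' where "t' = Node l' x r" "l' \<in> set (remy l)" | r' where "t' = Node l x r'" "r' \<in> set (remy r)"
    using Node.prems by auto
  then show ?case
  proof cases
    case 3
    have "htoll (Suc (size l)) \<le> htoll ?m"
      by (intro htoll_mono) auto
    then show ?thesis
      unfolding 3(1) hfun_remy_left[OF 3(2)] h using Node.IH(1)[OF 3(2)] pos by linarith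
  next
    case 4
    have "htoll (Suc (size r)) \<le> htoll ?m"
      by (intro htoll_mono) auto
    then show ?thesis
      unfolding 4(1) hfun_remy_right[OF 4(2)] h using Node.IH(2)[OF 4(2)] pos by linarith
  qed (use ge[of ?m] in auto)
qed

text \<open>A subtree with m nodes, m positive, contributes 2 \<open>htoll (m + 1)\<close> through
  the two grafts at its root and 2/(2m + 1) for each of the 4m grafts inside, together 2
  \<open>htoll m\<close> + 4. A leaf contributes 2 \<open>htoll 1\<close> = -4. As there is one leaf
  more than there are nodes, the constants leave -4.\<close>

lemma hfun_remy_sum: "(\<Sum>t'\<leftarrow>remy t. hfun t' - hfun t) = 2 * (hfun t - 2)"
proof (induction t)
  case Leaf
  then show ?case by (simp add: htoll_Suc)
next
  case (Node l x r)
  define m where "m = size (Node l x r)"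
  define d where "d = 2 / (2 * real m + 1)"
  have md: "2 * real m * d = 2 - d"
    by (simp add: d_def field_simps)
  have L: "(\<Sum>l'\<leftarrow>remy l. hfun (Node l' x r) - hfun (Node l x r)) = 2 * (hfun l - 2) + (4 * real (size l) + 2) * d"
  proof -
    have "(\<Sum>l'\<leftarrow>remy l. hfun (Node l' x r) - hfun (Node l x r)) = (\<Sum>l'\<leftarrow>remy l. (hfun l' - hfun l) + d)"
      unfolding d_def m_def by (intro arg_cong[where f = sum_list] map_cong refl hfun_remy_left)
    also have "\<dots> = (\<Sum>l'\<leftarrow>remy l. hfun l' - hfun l) + (4 * real (size l) + 2) * d"
      by (subst sum_list_addf) (simp add: sum_list_triv length_remy)
    finally show ?thesis
      unfolding Node by simp
  qed
  have R: "(\<Sum>r'\<leftarrow>remy r. hfun (Node l x r') - hfun (Node l x r)) = 2 * (hfun r - 2) + (4 * real (size r) + 2) * d"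
  proof -
    have "(\<Sum>r'\<leftarrow>remy r. hfun (Node l x r') - hfun (Node l x r)) = (\<Sum>r'\<leftarrow>remy r. (hfun r' - hfun r) + d)"
      unfolding d_def m_def by (intro arg_cong[where f = sum_list] map_cong refl hfun_remy_right)
    also have "\<dots> = (\<Sum>r'\<leftarrow>remy r. hfun r' - hfun r) + (4 * real (size r) + 2) * d"
      by (subst sum_list_addf) (simp add: sum_list_triv length_remy)
    finally show ?thesis
      unfolding Node by simp
  qed
  have "(\<Sum>t'\<leftarrow>remy (Node l x r). hfun t' - hfun (Node l x r)) = 2 * htoll (Suc m)
      + (\<Sum>l'\<leftarrow>remy l. hfun (Node l' x r) - hfun (Node l x r))
      + (\<Sum>r'\<leftarrow>remy r. hfun (Node l x r') - hfun (Node l x r))"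
    by (simp add: o_def m_def)
  also have "\<dots> = 2 * (htoll m + d) + (2 * (hfun l - 2) + (4 * real (size l) + 2) * d)
      + (2 * (hfun r - 2) + (4 * real (size r) + 2) * d)"
    unfolding L R htoll_Suc d_def ..
  also have "\<dots> = 2 * (hfun l + hfun r + htoll m - 4) + (2 * (2 * real m * d) + 2 * d)"
    by (simp add: m_def algebra_simps)
  also have "\<dots> = 2 * (hfun (Node l x r) - 2)"
    unfolding md by (simp add: m_def)
  finally show ?case .
qed

text \<open>Up to the number of graftings, the conditional second moment of one Remy increment; this
  is the G of the overview.\<close>

definition gfun :: "unit tree \<Rightarrow> real" where
  "gfun t = (\<Sum>t'\<leftarrow>remy t. (hfun t' - hfun t)\<^sup>2)"

lemma gfun_nonneg: "0 \<le> gfun t"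
  unfolding gfun_def by (intro sum_list_nonneg) auto

lemma gfun_Leaf: "gfun Leaf = 8"
  by (simp add: gfun_def htoll_Suc)

text \<open>Passing from a subtree to the whole tree shifts each increment by the same amount 2/(2m
  + 1). Expanding the squares leaves the sum of the increments as cross term, which
  \<open>hfun_remy_sum\<close> evaluates, so only the value of \<open>hfun\<close> enters.\<close>

lemma toll_gfun:
  assumes "size t = m" "m \<noteq> 0"
  shows "toll gfun t = 2 * (htoll (Suc m))\<^sup>2 + 4 * (2 / (2 * real m + 1)) * (hfun t - htoll m - 4)
    + 4 * real m * (2 / (2 * real m + 1))\<^sup>2"
proof -
  from assms obtain l x r where t: "t = Node l x r"
    by (cases t) auto
  have m: "m = size (Node l x r)"
    using assms t by simp
  define d where "d = 2 / (2 * real m + 1)"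
  have shift: "(\<Sum>s'\<leftarrow>remy s. ((hfun s' - hfun s) + d)\<^sup>2)
      = gfun s + 2 * d * (2 * (hfun s - 2)) + (4 * real (size s) + 2) * d\<^sup>2" for s
  proof -
    have "(\<Sum>s'\<leftarrow>remy s. ((hfun s' - hfun s) + d)\<^sup>2)
        = (\<Sum>s'\<leftarrow>remy s. (hfun s' - hfun s)\<^sup>2 + (2 * d * (hfun s' - hfun s) + d\<^sup>2))"
      by (intro arg_cong[where f = sum_list] map_cong refl) (simp add: power2_sum)
    also have "\<dots> = gfun s + 2 * d * (\<Sum>s'\<leftarrow>remy s. hfun s' - hfun s) + (4 * real (size s) + 2) * d\<^sup>2"
      unfolding sum_list_addf sum_list_const_mult gfun_def by (simp add: sum_list_triv length_remy)
    finally show ?thesis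
      unfolding hfun_remy_sum .
  qed
  have L: "(\<Sum>l'\<leftarrow>remy l. (hfun (Node l' x r) - hfun (Node l x r))\<^sup>2) = (\<Sum>l'\<leftarrow>remy l. ((hfun l' - hfun l) + d)\<^sup>2)"
    unfolding d_def m by (intro arg_cong[where f = sum_list] map_cong refl arg_cong[where f = "\<lambda>x. x\<^sup>2"] hfun_remy_left)
  have R: "(\<Sum>r'\<leftarrow>remy r. (hfun (Node l x r') - hfun (Node l x r))\<^sup>2) = (\<Sum>r'\<leftarrow>remy r. ((hfun r' - hfun r) + d)\<^sup>2)"
    unfolding d_def m by (intro arg_cong[where f = sum_list] map_cong refl arg_cong[where f = "\<lambda>x. x\<^sup>2"] hfun_remy_right)
  have "gfun t = 2 * (htoll (Suc m))\<^sup>2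
      + (\<Sum>l'\<leftarrow>remy l. (hfun (Node l' x r) - hfun (Node l x r))\<^sup>2)
      + (\<Sum>r'\<leftarrow>remy r. (hfun (Node l x r') - hfun (Node l x r))\<^sup>2)"
    unfolding gfun_def t by (simp add: o_def m)
  then have "toll gfun t = 2 * (htoll (Suc m))\<^sup>2 + 4 * d * (hfun l + hfun r - 4) + (4 * real (size l) + 4 * real (size r) + 4) * d\<^sup>2"
    unfolding L R shift t by (simp add: algebra_simps)
  also have "4 * real (size l) + 4 * real (size r) + 4 = 4 * real m"
    by (simp add: m)
  also have "hfun l + hfun r - 4 = hfun t - htoll m - 4"
    by (simp add: t m)
  finally show ?thesis
    by (simp add: d_def)
qed

text \<open>The mean of F - 2 starts at -2 and is multiplied by \<open>cbin n / cbin (n + 1)\<close>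
  in each step.\<close>

lemma avg_hfun: "avg n hfun = 2 - 2 / cbin n"
proof (induction n)
  case (Suc n)
  have "avg (Suc n) hfun = avg n (\<lambda>t. hfun t + (hfun t - 2) / (2 * real n + 1))"
    unfolding avg_Suc_remy
  proof (rule avg_cong)
    fix t :: "unit tree" assume t: "size t = n"
    have "(\<Sum>t'\<leftarrow>remy t. hfun t') = (\<Sum>t'\<leftarrow>remy t. (hfun t' - hfun t) + hfun t)"
      by simp
    also have "\<dots> = 2 * (hfun t - 2) + (4 * real n + 2) * hfun t"
      unfolding sum_list_addf hfun_remy_sum by (simp add: sum_list_triv length_remy t)
    finally show "sum_list (map hfun (remy t)) /\<^sub>R (4 * real n + 2) = hfun t + (hfun t - 2) / (2 * real n + 1)"
      by (simp add: divide_simps) (simp add: algebra_simps)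
  qed
  also have "\<dots> = avg n hfun + (avg n hfun - 2) / (2 * real n + 1)"
    unfolding avg_add avg_divide avg_diff by simp
  also have "\<dots> = 2 - 2 / cbin (Suc n)"
    unfolding Suc cbin_Suc by (simp add: divide_simps) (simp add: algebra_simps)
  finally show ?case .
qed simp

text \<open>This is the limiting mean of \<open>gfun\<close> divided by n + 1. Division by the
  roughly 4n graftings turns the 32 into the 8 of the theorem.\<close>

lemma bcat_toll_gfun_sums: "(\<lambda>k. bcat k * avg k (toll gfun)) sums (32 * (1 - ln 2))"
proof -
  \<comment> \<open>an ansatz \<open>cbin k\<close> times a quadratic in \<open>htoll k\<close>; it telescopes everything except the term coming
    from \<open>2 / cbin k\<close> in the mean of \<open>hfun\<close>, which gives the alternating harmonic series\<close>
  define P where "P k = - 4 * cbin k * ((htoll k)\<^sup>2 + 4 * htoll k + 8)" for k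
  have avg_eq: "avg (Suc k) (toll gfun) = 2 * (htoll (Suc (Suc k)))\<^sup>2
      + 4 * (2 / (2 * real (Suc k) + 1)) * (avg (Suc k) hfun - htoll (Suc k) - 4)
      + 4 * real (Suc k) * (2 / (2 * real (Suc k) + 1))\<^sup>2" for k
  proof -
    have "avg (Suc k) (toll gfun) = avg (Suc k) (\<lambda>t. 2 * (htoll (Suc (Suc k)))\<^sup>2
      + 4 * (2 / (2 * real (Suc k) + 1)) * (hfun t - htoll (Suc k) - 4)
      + 4 * real (Suc k) * (2 / (2 * real (Suc k) + 1))\<^sup>2)"
      by (rule avg_cong) (rule toll_gfun, auto)
    then show ?thesis
      unfolding avg_add avg_cmult avg_diff by simp
  qed
  have term_eq: "bcat (Suc k) * avg (Suc k) (toll gfun)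
      = (P (Suc (Suc k)) - P (Suc k)) - 32 * (inverse (real (2 * Suc k + 1)) - inverse (real (2 * Suc k + 2)))" for k
  proof -
    define y where "y = real (Suc k)"
    define c where "c = cbin (Suc k)"
    define H where "H = htoll (Suc k)"
    have y: "y > 0" and c: "c > 0"
      by (auto simp: y_def c_def)
    have h2: "htoll (Suc (Suc k)) = H + 2 / (2 * y + 1)"
      by (simp add: H_def y_def htoll_Suc)
    have c2: "cbin (Suc (Suc k)) = c * (2 * y + 1) / (2 * y + 2)"
      by (simp add: c_def y_def cbin_Suc[of "Suc k"])
    have r: "real (2 * Suc k + 1) = 2 * y + 1" "real (2 * Suc k + 2) = 2 * y + 2"
      by (simp_all add: y_def)
    have "c / (y + 1) * (2 * (H + 2 / (2 * y + 1))\<^sup>2 + 4 * (2 / (2 * y + 1)) * (2 - 2 / c - H - 4) + 4 * y * (2 / (2 * y + 1))\<^sup>2)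
        = (- 4 * (c * (2 * y + 1) / (2 * y + 2)) * ((H + 2 / (2 * y + 1))\<^sup>2 + 4 * (H + 2 / (2 * y + 1)) + 8)
          - - 4 * c * (H\<^sup>2 + 4 * H + 8)) - 32 * (inverse (2 * y + 1) - inverse (2 * y + 2))"
      using y c by (simp add: divide_simps power2_eq_square) algebra
    then show ?thesis
      unfolding avg_eq avg_hfun P_def bcat_def h2 c2 r by (simp only: H_def c_def y_def)
  qed
  have "(\<lambda>n. P (Suc n)) \<longlonglongrightarrow> 0"
  proof (rule LIMSEQ_Suc, rule Lim_null_comparison)
    let ?b = "\<lambda>k. 4 * (1 / sqrt (2 * real k + 1)) * ((4 * (1 + ln (real k + 1)))\<^sup>2 + 4 * (4 * (1 + ln (real k + 1))) + 8)"
    show "\<forall>\<^sub>F k in sequentially. norm (P k) \<le> ?b k"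
    proof (intro always_eventually allI)
      fix k
      have sq: "(htoll k)\<^sup>2 \<le> (4 * (1 + ln (real k + 1)))\<^sup>2"
        using power_mono[OF abs_htoll_le[of k], of 2] by simp
      have "norm (P k) = 4 * cbin k * \<bar>(htoll k)\<^sup>2 + 4 * htoll k + 8\<bar>"
        by (simp add: P_def abs_mult)
      also have "\<dots> \<le> ?b k"
      proof (intro mult_mono cbin_le order.refl)
        have "0 \<le> (htoll k)\<^sup>2"
          by simp
        then show "\<bar>(htoll k)\<^sup>2 + 4 * htoll k + 8\<bar> \<le> (4 * (1 + ln (real k + 1)))\<^sup>2 + 4 * (4 * (1 + ln (real k + 1))) + 8"
          using sq abs_htoll_le[of k] by linarith
      qed auto
      finally show "norm (P k) \<le> ?b k" .
    qed
    show "?b \<longlonglongrightarrow> 0"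
      by real_asymp
  qed
  from telescope_sums[OF this]
  have "(\<lambda>k. P (Suc (Suc k)) - P (Suc k)) sums (0 - P (Suc 0))" .
  moreover have "P (Suc 0) = -8"
    by (simp add: P_def htoll_Suc cbin_Suc)
  ultimately have tele: "(\<lambda>k. P (Suc (Suc k)) - P (Suc k)) sums 8"
    by simp
  \<comment> \<open>The alternating harmonic series without its first pair, 1 - 1/2.\<close>
  have alt: "(\<lambda>k. inverse (real (2 * Suc k + 1)) - inverse (real (2 * Suc k + 2))) sums (ln 2 - 1 / 2)"
    using alternating_harmonic_series_sums' by (subst sums_Suc_iff) simp
  have "(\<lambda>k. (P (Suc (Suc k)) - P (Suc k)) - 32 * (inverse (real (2 * Suc k + 1)) - inverse (real (2 * Suc k + 2))))
      sums (8 - 32 * (ln 2 - 1 / 2))"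
    by (rule sums_diff[OF tele sums_mult[OF alt]])
  then have "(\<lambda>k. bcat (Suc k) * avg (Suc k) (toll gfun)) sums (8 - 32 * (ln 2 - 1 / 2))"
    unfolding term_eq .
  \<comment> \<open>The term k = 0 is the leaf toll 8, which completes 24 - 32 ln 2 to the claimed
    sum.\<close>
  then show ?thesis
    by (subst (asm) sums_Suc_iff) (simp add: gfun_Leaf algebra_simps)
qed

lemma gfun_lln: "(\<lambda>n. avg n (\<lambda>t. \<bar>gfun t / (real n + 1) - 32 * (1 - ln 2)\<bar>)) \<longlonglongrightarrow> 0"
proof -
  \<comment> \<open>84 = 32 + 32 + 16 + 4 collects the three parts of the toll, all estimated by the
    square of a logarithmic factor that is at least 1.\<close>
  define \<rho> where "\<rho> k = 84 * (1 + ln (real k + 2))\<^sup>2" for k :: nat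
  define w where "w k = 1 / ((real k + 1) * sqrt (2 * real k + 1)) * (84 * (1 + ln (real k + 2))\<^sup>2)" for k :: nat
  have bw: "bcat k * \<rho> k \<le> w k" for k
    unfolding w_def \<rho>_def by (intro mult_right_mono bcat_le) auto
  have \<rho>_nonneg: "0 \<le> \<rho> k" for k
    by (simp add: \<rho>_def)
  have "summable w"
  proof (rule summable_comparison_test_bigo)
    \<comment> \<open>Any exponent strictly between -3/2 and -1 works: \<open>w\<close> is of order
      k powr (-3/2) times a squared logarithm.\<close>
    show "summable (\<lambda>k. norm (real k powr (- 5 / 4)))"
      by (simp add: summable_real_powr_iff)
    show "w \<in> O(\<lambda>k. real k powr (- 5 / 4))"
      unfolding w_def by real_asymp
  qed
  then have summ: "summable (\<lambda>k. bcat k * \<rho> k)"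
    by (rule summable_comparison_test'[of _ 0]) (use bw \<rho>_nonneg in auto)
  have lim: "(\<lambda>k. real k * (bcat k * \<rho> k)) \<longlonglongrightarrow> 0"
  proof (rule Lim_null_comparison)
    show "\<forall>\<^sub>F k in sequentially. norm (real k * (bcat k * \<rho> k)) \<le> real k * w k"
      using \<rho>_nonneg bw by (intro always_eventually allI) (simp add: abs_mult mult_left_mono)
    show "(\<lambda>k. real k * w k) \<longlonglongrightarrow> 0"
      unfolding w_def by real_asymp
  qed
  have bd: "\<bar>toll gfun t\<bar> \<le> \<rho> (size t)" for t
  proof (cases "size t = 0")
    case True
    then have "t = Leaf" by simp
    moreover have "1 \<le> (1 + ln (2 :: real))\<^sup>2"
      by (intro one_le_power) simp
    then have "8 \<le> 84 * (1 + ln (2 :: real))\<^sup>2"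
      by linarith
    ultimately show ?thesis
      by (simp add: gfun_Leaf \<rho>_def)
  next
    case False
    define m where "m = size t"
    define d where "d = 2 / (2 * real m + 1)"
    define L where "L = 1 + ln (real m + 2)"
    have L1: "L \<ge> 1"
      by (simp add: L_def)
    have lnle: "1 + ln (real m + 1) \<le> L"
      by (simp add: L_def)
    have d: "0 \<le> d" "d \<le> 1" "d * real m \<le> 1"
      using False by (cases t; simp add: d_def m_def divide_simps)+
    have h1: "\<bar>htoll (Suc m)\<bar> \<le> 4 * L"
      using abs_htoll_le[of "Suc m"] by (simp add: L_def add.commute)
    have h0: "\<bar>htoll m\<bar> \<le> 4 * L"
      using abs_htoll_le[of m] lnle by (rule order.trans[OF _ mult_left_mono]) auto
    have "\<bar>hfun t\<bar> \<le> real m * (4 * L)"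
      unfolding m_def by (rule order.trans[OF hfun_abs_le mult_left_mono[OF mult_left_mono[OF lnle[unfolded m_def]]]]) auto
    then have "d * \<bar>hfun t\<bar> \<le> (d * real m) * (4 * L)"
      using d by (simp add: mult_left_mono mult.assoc)
    also have "\<dots> \<le> 1 * (4 * L)"
      using d L1 by (intro mult_right_mono) auto
    finally have A1: "d * \<bar>hfun t\<bar> \<le> 4 * L" by simp
    have A2: "d * \<bar>htoll m\<bar> \<le> 1 * (4 * L)"
      using d h0 by (intro mult_mono) auto
    have "\<bar>4 * d * (hfun t - htoll m - 4)\<bar> = 4 * (d * \<bar>hfun t - htoll m - 4\<bar>)"
      using d by (simp add: abs_mult)
    also have "\<dots> \<le> 4 * (d * (\<bar>hfun t\<bar> + \<bar>htoll m\<bar> + 4))"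
      using d by (intro mult_left_mono) auto
    also have "\<dots> \<le> 4 * (4 * L + 4 * L + 4)"
      using A1 A2 d by (simp add: distrib_left)
    also have "\<dots> = 32 * L + 16"
      by simp
    finally have A: "\<bar>4 * d * (hfun t - htoll m - 4)\<bar> \<le> 32 * L + 16" .
    have "4 * real m * d\<^sup>2 = 4 * (d * real m) * d"
      by (simp add: power2_eq_square)
    also have "\<dots> \<le> 4 * 1 * 1"
      using d by (intro mult_mono) auto
    finally have B: "4 * real m * d\<^sup>2 \<le> 4" by simp
    have C: "(htoll (Suc m))\<^sup>2 \<le> 16 * L\<^sup>2"
      using power_mono[OF h1, of 2] by (simp add: power_mult_distrib)
    have L2: "L \<le> L\<^sup>2" "1 \<le> L\<^sup>2"
      using L1 one_le_power[OF L1, of 2] by (simp_all add: power2_eq_square)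
    have "toll gfun t = 2 * (htoll (Suc m))\<^sup>2 + 4 * d * (hfun t - htoll m - 4) + 4 * real m * d\<^sup>2"
      unfolding d_def by (rule toll_gfun) (use False in \<open>auto simp: m_def\<close>)
    then have "\<bar>toll gfun t\<bar> \<le> 2 * (htoll (Suc m))\<^sup>2 + \<bar>4 * d * (hfun t - htoll m - 4)\<bar> + 4 * real m * d\<^sup>2"
      using zero_le_power2[of "htoll (Suc m)"] zero_le_power2[of d]
      by (simp add: abs_le_iff) (smt (verit) mult_nonneg_nonneg of_nat_0_le_iff zero_le_power2)
    also have "\<dots> \<le> 2 * (16 * L\<^sup>2) + (32 * L + 16) + 4"
      by (intro add_mono mult_left_mono A B C) auto
    also have "\<dots> \<le> 84 * L\<^sup>2"
      using L2 by linarith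
    finally show ?thesis
      by (simp add: \<rho>_def L_def m_def)
  qed
  from additive_functional_lln[OF bd summ lim] show ?thesis
    by (simp add: sums_unique[OF bcat_toll_gfun_sums, symmetric])
qed

section \<open>The martingale and its conditional variance\<close>

definition zfun :: "nat \<Rightarrow> unit tree \<Rightarrow> real" where
  "zfun n t = cbin n * (hfun t - 2)"

text \<open>The conditional variance of a step of \<open>zfun\<close>: the mean squared increment of
  \<open>hfun\<close> minus its squared mean, scaled by the new normalisation.\<close>

definition qfun :: "nat \<Rightarrow> unit tree \<Rightarrow> real" where
  "qfun n t = (cbin (Suc n))\<^sup>2 * (gfun t / (4 * real n + 2) - ((hfun t - 2) / (2 * real n + 1))\<^sup>2)"

lemma zfun_diff:
  "zfun (Suc n) t' - zfun n t = cbin (Suc n) * ((hfun t' - hfun t) - (hfun t - 2) / (2 * real n + 1))"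
proof -
  have "cbin n = cbin (Suc n) * (1 + 1 / (2 * real n + 1))"
    by (simp add: cbin_Suc divide_simps)
  then show ?thesis
    unfolding zfun_def by (simp only:) (simp add: algebra_simps)
qed

lemma zfun_remy_sum:
  assumes "size t = n"
  shows "(\<Sum>t'\<leftarrow>remy t. zfun (Suc n) t' - zfun n t) = 0"
proof -
  have "(\<Sum>t'\<leftarrow>remy t. zfun (Suc n) t' - zfun n t)
      = cbin (Suc n) * ((\<Sum>t'\<leftarrow>remy t. hfun t' - hfun t) - (\<Sum>t'\<leftarrow>remy t. (hfun t - 2) / (2 * real n + 1)))"
    unfolding zfun_diff sum_list_const_mult sum_list_subtractf ..
  also have "\<dots> = 0"
    unfolding hfun_remy_sum by (simp add: sum_list_triv length_remy assms divide_simps) (simp add: algebra_simps)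
  finally show ?thesis .
qed

lemma zfun_remy_square_sum:
  assumes "size t = n"
  shows "(\<Sum>t'\<leftarrow>remy t. (zfun (Suc n) t' - zfun n t)\<^sup>2) = (4 * real n + 2) * qfun n t"
proof -
  define a where "a = (hfun t - 2) / (2 * real n + 1)"
  have a: "hfun t - 2 = a * (2 * real n + 1)"
    by (simp add: a_def)
  have "(\<Sum>t'\<leftarrow>remy t. (zfun (Suc n) t' - zfun n t)\<^sup>2)
      = (\<Sum>t'\<leftarrow>remy t. (cbin (Suc n))\<^sup>2 * ((hfun t' - hfun t)\<^sup>2 + ((- 2 * a) * (hfun t' - hfun t) + a\<^sup>2)))"
    unfolding zfun_diff a_def[symmetric]
    by (intro arg_cong[where f = sum_list] map_cong refl) (simp add: power2_eq_square algebra_simps)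
  also have "\<dots> = (cbin (Suc n))\<^sup>2 * (gfun t + ((- 2 * a) * (2 * (hfun t - 2)) + (4 * real n + 2) * a\<^sup>2))"
    unfolding sum_list_const_mult sum_list_addf hfun_remy_sum gfun_def
    by (simp add: sum_list_triv length_remy assms)
  also have "\<dots> = (cbin (Suc n))\<^sup>2 * (gfun t - (4 * real n + 2) * a\<^sup>2)"
    unfolding a by (simp add: power2_eq_square algebra_simps)
  also have "\<dots> = (4 * real n + 2) * qfun n t"
    unfolding qfun_def a_def[symmetric] by (simp add: field_simps)
  finally show ?thesis .
qed

text \<open>The increments of \<open>hfun\<close> and their mean are O(ln n), and the factor
  \<open>cbin\<close> is of order 1/sqrt n.\<close>

lemma zfun_diff_bounded:
  obtains C where "\<And>n t t'. size t = n \<Longrightarrow> t' \<in> set (remy t) \<Longrightarrow> \<bar>zfun (Suc n) t' - zfun n t\<bar> \<le> C"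
proof -
  define w where "w n = 1 / sqrt (2 * real (Suc n) + 1) * (8 * (1 + ln (real n + 2)))" for n :: nat
  have "w \<longlonglongrightarrow> 0"
    unfolding w_def by real_asymp
  then have "Bseq w"
    by (rule convergent_imp_Bseq[OF convergentI])
  then obtain C where C: "norm (w n) \<le> C" for n
    by (auto simp: Bseq_def)
  have "\<bar>zfun (Suc n) t' - zfun n t\<bar> \<le> C" if t: "size t = n" and t': "t' \<in> set (remy t)" for n t t'
  proof -
    define L where "L = 1 + ln (real n + 2)"
    have L1: "L \<ge> 1"
      by (simp add: L_def)
    have "\<bar>htoll (Suc n)\<bar> \<le> 4 * L"
      using abs_htoll_le[of "Suc n"] by (simp add: L_def add.commute)
    then have A: "\<bar>hfun t' - hfun t\<bar> \<le> 4 * L"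
      using hfun_remy_bounds[OF t'] L1 unfolding t by linarith
    have "\<bar>hfun t\<bar> \<le> real n * (4 * (1 + ln (real n + 1)))"
      using hfun_abs_le[of t] by (simp add: t)
    also have "\<dots> \<le> real n * (4 * L)"
      by (intro mult_left_mono) (auto simp: L_def)
    finally have "\<bar>hfun t - 2\<bar> \<le> real n * (4 * L) + 2"
      by linarith
    also have "\<dots> \<le> (2 * real n) * (4 * L) + 4 * L"
      using L1 by (intro add_mono mult_right_mono) auto
    also have "\<dots> = (2 * real n + 1) * (4 * L)"
      by (simp add: algebra_simps)
    finally have B: "\<bar>(hfun t - 2) / (2 * real n + 1)\<bar> \<le> 4 * L"
      by (simp add: divide_simps mult.commute)
    have "\<bar>(hfun t' - hfun t) - (hfun t - 2) / (2 * real n + 1)\<bar> \<le> 8 * L"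
      using A B by linarith
    then have "\<bar>zfun (Suc n) t' - zfun n t\<bar> \<le> 1 / sqrt (2 * real (Suc n) + 1) * (8 * L)"
      unfolding zfun_diff abs_mult abs_of_pos[OF cbin_pos] by (intro mult_mono cbin_le) auto
    also have "\<dots> \<le> C"
      using C[of n] unfolding w_def L_def by (auto simp: abs_le_iff)
    finally show ?thesis .
  qed
  then show ?thesis
    using that by blast
qed

text \<open>Orthogonality of martingale increments: the mixed term vanishes already for each fixed
  tree.\<close>

lemma avg_zfun_square_Suc:
  "avg (Suc n) (\<lambda>t. (zfun (Suc n) t)\<^sup>2) = avg n (\<lambda>t. (zfun n t)\<^sup>2) + avg n (qfun n)"
proof -
  have "avg (Suc n) (\<lambda>t. (zfun (Suc n) t)\<^sup>2) = avg n (\<lambda>t. (zfun n t)\<^sup>2 + qfun n t)"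
    unfolding avg_Suc_remy
  proof (rule avg_cong)
    fix t :: "unit tree" assume t: "size t = n"
    have "(\<Sum>t'\<leftarrow>remy t. (zfun (Suc n) t')\<^sup>2) = (\<Sum>t'\<leftarrow>remy t. (zfun (Suc n) t' - zfun n t)\<^sup>2
        + (2 * zfun n t * (zfun (Suc n) t' - zfun n t) + (zfun n t)\<^sup>2))"
      by (intro arg_cong[where f = sum_list] map_cong refl) (simp add: power2_eq_square algebra_simps)
    also have "\<dots> = (4 * real n + 2) * (qfun n t + (zfun n t)\<^sup>2)"
      unfolding sum_list_const_mult sum_list_addf zfun_remy_sum[OF t] zfun_remy_square_sum[OF t]
      by (simp add: sum_list_triv length_remy t algebra_simps)
    finally show "(\<Sum>t'\<leftarrow>remy t. (zfun (Suc n) t')\<^sup>2) /\<^sub>R (4 * real n + 2) = (zfun n t)\<^sup>2 + qfun n t"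
      by (simp add: divide_simps)
  qed
  then show ?thesis
    by (simp add: avg_add)
qed

section \<open>Logarithmic averages and the size of the conditional variance\<close>

lemma harm_lessThan: "harm n = (\<Sum>k<n. 1 / (real k + 1))"
  by (induction n) (auto simp: harm_Suc harm_expand inverse_eq_divide add.commute)

lemma harm_ln_ratio: "(\<lambda>n. harm n / ln (real n)) \<longlonglongrightarrow> 1"
proof -
  have "(\<lambda>n. (harm n - ln (real n)) * (1 / ln (real n)) + 1) \<longlonglongrightarrow> euler_mascheroni * 0 + 1"
    by (intro tendsto_add tendsto_mult euler_mascheroni_LIMSEQ tendsto_const) real_asymp
  then have "(\<lambda>n. (harm n - ln (real n)) * (1 / ln (real n)) + 1) \<longlonglongrightarrow> (1 :: real)"
    by simp
  then show ?thesis
  proof (rule Lim_transform_eventually)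
    show "\<forall>\<^sub>F n in sequentially. (harm n - ln (real n)) * (1 / ln (real n)) + 1 = harm n / ln (real n)"
      using eventually_gt_at_top[of 1] by eventually_elim (simp add: field_simps)
  qed
qed

text \<open>Cesaro's argument with weights 1/(k + 1), whose total is asymptotic to ln n.\<close>

lemma log_average_null:
  fixes \<eta> :: "nat \<Rightarrow> real"
  assumes "\<eta> \<longlonglongrightarrow> 0"
  shows "(\<lambda>n. (\<Sum>k<n. \<eta> k / (real k + 1)) / ln (real n)) \<longlonglongrightarrow> 0"
proof (rule LIMSEQ_I)
  fix \<epsilon> :: real assume \<epsilon>: "\<epsilon> > 0"
  obtain N where N: "\<bar>\<eta> k\<bar> < \<epsilon> / 4" if "k \<ge> N" for k
    using LIMSEQ_D[OF assms, of "\<epsilon> / 4"] \<epsilon> by auto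
  define A where "A = (\<Sum>k<N. \<bar>\<eta> k\<bar> / (real k + 1))"
  have bound: "\<bar>\<Sum>k<n. \<eta> k / (real k + 1)\<bar> \<le> A + \<epsilon> / 4 * harm n" for n
  proof -
    have "\<bar>\<Sum>k<n. \<eta> k / (real k + 1)\<bar> \<le> (\<Sum>k<n. (if k < N then \<bar>\<eta> k\<bar> / (real k + 1) else 0) + \<epsilon> / 4 * (1 / (real k + 1)))"
    proof (intro order.trans[OF sum_abs] sum_mono)
      fix k
      have "\<bar>\<eta> k\<bar> / (real k + 1) \<le> (\<epsilon> / 4) / (real k + 1)" if "k \<ge> N"
        using N[OF that] by (intro divide_right_mono) auto
      then show "\<bar>\<eta> k / (real k + 1)\<bar> \<le> (if k < N then \<bar>\<eta> k\<bar> / (real k + 1) else 0) + \<epsilon> / 4 * (1 / (real k + 1))"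
        using \<epsilon> by (auto simp: abs_divide)
    qed
    also have "\<dots> = (\<Sum>k<n. if k < N then \<bar>\<eta> k\<bar> / (real k + 1) else 0) + \<epsilon> / 4 * harm n"
      unfolding sum.distrib harm_lessThan sum_distrib_left ..
    also have "(\<Sum>k<n. if k < N then \<bar>\<eta> k\<bar> / (real k + 1) else 0) = (\<Sum>k\<in>{..<n} \<inter> {..<N}. \<bar>\<eta> k\<bar> / (real k + 1))"
      by (simp add: sum.inter_restrict)
    also have "\<dots> \<le> A"
      unfolding A_def by (intro sum_mono2) auto
    finally show ?thesis by simp
  qed
  have "(\<lambda>n. A * (1 / ln (real n)) + \<epsilon> / 4 * (harm n / ln (real n))) \<longlonglongrightarrow> A * 0 + \<epsilon> / 4 * 1"
    by (intro tendsto_add tendsto_mult tendsto_const harm_ln_ratio) real_asymp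
  then have "(\<lambda>n. A * (1 / ln (real n)) + \<epsilon> / 4 * (harm n / ln (real n))) \<longlonglongrightarrow> \<epsilon> / 4"
    by simp
  from order_tendstoD(2)[OF this, of "\<epsilon>"]
  have "\<forall>\<^sub>F n in sequentially. A * (1 / ln (real n)) + \<epsilon> / 4 * (harm n / ln (real n)) < \<epsilon>"
    using \<epsilon> by simp
  then have "\<forall>\<^sub>F n in sequentially. norm ((\<Sum>k<n. \<eta> k / (real k + 1)) / ln (real n) - 0) < \<epsilon>"
    using eventually_gt_at_top[of 1]
  proof eventually_elim
    case (elim n)
    then have "ln (real n) > 0"
      by simp
    then have "norm ((\<Sum>k<n. \<eta> k / (real k + 1)) / ln (real n) - 0) \<le> (A + \<epsilon> / 4 * harm n) / ln (real n)"
      using bound[of n] by (simp add: divide_right_mono)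
    also have "\<dots> < \<epsilon>"
      using elim by (simp add: add_divide_distrib)
    finally show ?case .
  qed
  then show "\<exists>N. \<forall>n\<ge>N. norm ((\<Sum>k<n. \<eta> k / (real k + 1)) / ln (real n) - 0) < \<epsilon>"
    by (simp add: eventually_sequentially)
qed

text \<open>The limit of n times the conditional variance of a step of \<open>zfun\<close>. It is
  the variance of the theorem divided by pi, since \<open>cbin n\<close> is asymptotic to 1/sqrt (pi
  n).\<close>

definition svar :: real where "svar = 8 * (1 - ln 2) / pi"

lemma svar_nonneg: "0 \<le> svar"
  using ln_2_less_1 by (simp add: svar_def)

lemma cbin_Suc_asymp: "(\<lambda>n. (real n + 1) * (cbin (Suc n))\<^sup>2) \<longlonglongrightarrow> 1 / pi"
proof -
  have "(\<lambda>n. ((cbin (Suc n))\<^sup>2 * (2 * real (Suc n) + 1)) * ((real n + 1) / (2 * real (Suc n) + 1))) \<longlonglongrightarrow> 2 / pi * (1 / 2)"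
    by (intro tendsto_mult LIMSEQ_Suc[OF cbin_asymp]) real_asymp
  moreover have "((cbin (Suc n))\<^sup>2 * (2 * real (Suc n) + 1)) * ((real n + 1) / (2 * real (Suc n) + 1)) = (real n + 1) * (cbin (Suc n))\<^sup>2" for n
    by (simp add: divide_simps)
  ultimately show ?thesis
    by (simp only: mult_1_right) simp
qed

lemma qfun_scaled:
  "(real n + 1) * qfun n t = (real n + 1) * (cbin (Suc n))\<^sup>2 * ((real n + 1) / (4 * real n + 2)) * (gfun t / (real n + 1))
     - (real n + 1) * (cbin (Suc n))\<^sup>2 * ((hfun t - 2) / (2 * real n + 1))\<^sup>2"
  unfolding qfun_def right_diff_distrib by simp

text \<open>A first bound for a bootstrap: dropping the negative square in \<open>qfun\<close> gives
  O(1/n), hence a second moment O(ln n) for \<open>zfun\<close>. With this the dropped square turns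
  out negligible, and the sharp asymptotics follow in \<open>qfun_lln\<close>.\<close>

lemma avg_qfun_le:
  obtains K where "\<And>n. avg n (qfun n) \<le> K / (real n + 1)"
proof -
  define \<theta> :: real where "\<theta> = 32 * (1 - ln 2)"
  have "Bseq (\<lambda>n. avg n (\<lambda>t. \<bar>gfun t / (real n + 1) - \<theta>\<bar>))"
    using gfun_lln unfolding \<theta>_def by (intro convergent_imp_Bseq convergentI)
  then obtain K where K: "avg n (\<lambda>t. \<bar>gfun t / (real n + 1) - \<theta>\<bar>) \<le> K" for n
    by (auto simp: Bseq_def abs_le_iff)
  have "avg n (qfun n) \<le> (K + \<theta>) / (real n + 1)" for n
  proof -
    have "(real n + 1) * (cbin (Suc n))\<^sup>2 \<le> (2 * real (Suc n) + 1) * (cbin (Suc n))\<^sup>2"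
      by (intro mult_right_mono) auto
    also have "\<dots> \<le> 1"
      using cbin_sq_le[of "Suc n"] by (simp add: mult.commute)
    finally have c: "(real n + 1) * (cbin (Suc n))\<^sup>2 \<le> 1" .
    have "(real n + 1) * avg n (qfun n) = avg n (\<lambda>t. (real n + 1) * qfun n t)"
      by (simp add: avg_cmult)
    also have "\<dots> \<le> avg n (\<lambda>t. \<bar>gfun t / (real n + 1) - \<theta>\<bar> + \<theta>)"
    proof (rule avg_mono)
      fix t
      have "(real n + 1) * qfun n t \<le> (real n + 1) * (cbin (Suc n))\<^sup>2 * ((real n + 1) / (4 * real n + 2)) * (gfun t / (real n + 1))"
        unfolding qfun_scaled by simp
      also have "\<dots> \<le> 1 * 1 * (gfun t / (real n + 1))"
        using c gfun_nonneg[of t] by (intro mult_mono) (auto simp: divide_simps)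
      also have "\<dots> \<le> \<bar>gfun t / (real n + 1) - \<theta>\<bar> + \<theta>"
        by linarith
      finally show "(real n + 1) * qfun n t \<le> \<bar>gfun t / (real n + 1) - \<theta>\<bar> + \<theta>" .
    qed
    also have "\<dots> \<le> K + \<theta>"
      using K[of n] by (simp add: avg_add)
    finally show ?thesis
      by (simp add: divide_simps mult.commute)
  qed
  then show ?thesis
    using that by blast
qed

text \<open>The 4 is the square of the starting value \<open>zfun 0 Leaf\<close> = -2.\<close>

lemma avg_zfun_square: "avg n (\<lambda>t. (zfun n t)\<^sup>2) = 4 + (\<Sum>k<n. avg k (qfun k))"
  by (induction n) (auto simp: avg_zfun_square_Suc, simp add: zfun_def)

text \<open>Rewritten through \<open>zfun\<close>, the mean is its second moment O(ln n) divided by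
  2n + 1 and by a factor tending to 2/pi.\<close>

lemma avg_hfun_square_null: "(\<lambda>n. avg n (\<lambda>t. ((hfun t - 2) / (2 * real n + 1))\<^sup>2)) \<longlonglongrightarrow> 0"
proof -
  obtain K where K: "\<And>n. avg n (qfun n) \<le> K / (real n + 1)"
    using avg_qfun_le by blast
  have z: "avg n (\<lambda>t. (zfun n t)\<^sup>2) \<le> 4 + K * harm n" for n
    unfolding avg_zfun_square harm_lessThan sum_distrib_left
    using K by (intro add_left_mono sum_mono) simp
  let ?c = "\<lambda>n. (cbin n)\<^sup>2 * (2 * real n + 1)"
  have eq: "avg n (\<lambda>t. ((hfun t - 2) / (2 * real n + 1))\<^sup>2) = avg n (\<lambda>t. (zfun n t)\<^sup>2) / (2 * real n + 1) / ?c n" for n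
    unfolding avg_divide[symmetric] by (intro avg_cong) (simp add: zfun_def power2_eq_square divide_simps)
  show ?thesis
  proof (rule tendsto_sandwich)
    show "\<forall>\<^sub>F n in sequentially. 0 \<le> avg n (\<lambda>t. ((hfun t - 2) / (2 * real n + 1))\<^sup>2)"
      by (intro always_eventually allI avg_nonneg) auto
    show "\<forall>\<^sub>F n in sequentially. avg n (\<lambda>t. ((hfun t - 2) / (2 * real n + 1))\<^sup>2)
        \<le> (4 / (2 * real n + 1) + K * ((harm n / ln (real n)) * (ln (real n) / (2 * real n + 1)))) / ?c n"
      using eventually_gt_at_top[of 1]
    proof eventually_elim
      case (elim n)
      have "avg n (\<lambda>t. ((hfun t - 2) / (2 * real n + 1))\<^sup>2) \<le> (4 + K * harm n) / (2 * real n + 1) / ?c n"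
        unfolding eq by (intro divide_right_mono z) auto
      also have "(4 + K * harm n) / (2 * real n + 1) = 4 / (2 * real n + 1) + K * ((harm n / ln (real n)) * (ln (real n) / (2 * real n + 1)))"
        using elim by (simp add: add_divide_distrib)
      finally show ?case .
    qed
    have "(\<lambda>n. (4 / (2 * real n + 1) + K * ((harm n / ln (real n)) * (ln (real n) / (2 * real n + 1)))) / ?c n)
        \<longlonglongrightarrow> (0 + K * (1 * 0)) / (2 / pi)"
      by (intro tendsto_divide tendsto_add tendsto_mult tendsto_const harm_ln_ratio cbin_asymp) (real_asymp | simp)+
    then show "(\<lambda>n. (4 / (2 * real n + 1) + K * ((harm n / ln (real n)) * (ln (real n) / (2 * real n + 1)))) / ?c n) \<longlonglongrightarrow> 0"
      by simp
  qed simp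
qed

text \<open>Convergence in mean absolute value, not only of the mean: in \<open>zchar_Suc\<close>
  the deviation is multiplied by a complex phase depending on the tree.\<close>

lemma qfun_lln: "(\<lambda>n. (real n + 1) * avg n (\<lambda>t. \<bar>qfun n t - svar / (real n + 1)\<bar>)) \<longlonglongrightarrow> 0"
proof -
  define \<theta> :: real where "\<theta> = 32 * (1 - ln 2)"
  define c where "c n = (real n + 1) * (cbin (Suc n))\<^sup>2" for n
  define a where "a n = c n * ((real n + 1) / (4 * real n + 2))" for n
  have c_lim: "c \<longlonglongrightarrow> 1 / pi"
    unfolding c_def[abs_def] by (rule cbin_Suc_asymp)
  have a_lim: "a \<longlonglongrightarrow> 1 / pi * (1 / 4)"
    unfolding a_def[abs_def] by (intro tendsto_mult c_lim) real_asymp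
  have c_nonneg: "0 \<le> c n" for n
    by (simp add: c_def)
  have a_nonneg: "0 \<le> a n" for n
    by (simp add: a_def c_nonneg)
  show ?thesis
  proof (rule tendsto_sandwich)
    show "\<forall>\<^sub>F n in sequentially. 0 \<le> (real n + 1) * avg n (\<lambda>t. \<bar>qfun n t - svar / (real n + 1)\<bar>)"
      by (intro always_eventually allI mult_nonneg_nonneg avg_nonneg) auto
    show "\<forall>\<^sub>F n in sequentially. (real n + 1) * avg n (\<lambda>t. \<bar>qfun n t - svar / (real n + 1)\<bar>)
        \<le> a n * avg n (\<lambda>t. \<bar>gfun t / (real n + 1) - \<theta>\<bar>) + \<bar>a n * \<theta> - svar\<bar>
          + c n * avg n (\<lambda>t. ((hfun t - 2) / (2 * real n + 1))\<^sup>2)"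
    proof (intro always_eventually allI)
      fix n
      have "(real n + 1) * avg n (\<lambda>t. \<bar>qfun n t - svar / (real n + 1)\<bar>)
          = avg n (\<lambda>t. (real n + 1) * \<bar>qfun n t - svar / (real n + 1)\<bar>)"
        by (simp add: avg_cmult)
      also have "\<dots> \<le> avg n (\<lambda>t. a n * \<bar>gfun t / (real n + 1) - \<theta>\<bar> + \<bar>a n * \<theta> - svar\<bar>
          + c n * ((hfun t - 2) / (2 * real n + 1))\<^sup>2)"
      proof (rule avg_mono)
        fix t
        define g where "g = gfun t / (real n + 1)"
        define f where "f = c n * ((hfun t - 2) / (2 * real n + 1))\<^sup>2"
        have f: "0 \<le> f"
          by (simp add: f_def c_nonneg)
        have pos: "0 < real n + 1"
          by simp
        have "(real n + 1) * \<bar>qfun n t - svar / (real n + 1)\<bar> = \<bar>(real n + 1) * (qfun n t - svar / (real n + 1))\<bar>"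
          by (simp add: abs_mult)
        also have "(real n + 1) * (qfun n t - svar / (real n + 1)) = (real n + 1) * qfun n t - svar"
          using pos by (simp add: right_diff_distrib)
        also have "(real n + 1) * qfun n t = a n * g - f"
          unfolding qfun_scaled a_def c_def g_def f_def by simp
        also have "\<bar>a n * g - f - svar\<bar> = \<bar>a n * (g - \<theta>) + (a n * \<theta> - svar) - f\<bar>"
          by (simp add: algebra_simps)
        also have "\<dots> \<le> \<bar>a n * (g - \<theta>)\<bar> + \<bar>a n * \<theta> - svar\<bar> + f"
          using f by linarith
        also have "\<bar>a n * (g - \<theta>)\<bar> = a n * \<bar>g - \<theta>\<bar>"
          using a_nonneg[of n] by (simp add: abs_mult)
        finally show "(real n + 1) * \<bar>qfun n t - svar / (real n + 1)\<bar> \<le> a n * \<bar>gfun t / (real n + 1) - \<theta>\<bar>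
            + \<bar>a n * \<theta> - svar\<bar> + c n * ((hfun t - 2) / (2 * real n + 1))\<^sup>2"
          by (simp only: g_def f_def)
      qed
      also have "\<dots> = a n * avg n (\<lambda>t. \<bar>gfun t / (real n + 1) - \<theta>\<bar>) + \<bar>a n * \<theta> - svar\<bar>
          + c n * avg n (\<lambda>t. ((hfun t - 2) / (2 * real n + 1))\<^sup>2)"
        unfolding avg_add avg_cmult by simp
      finally show "(real n + 1) * avg n (\<lambda>t. \<bar>qfun n t - svar / (real n + 1)\<bar>)
        \<le> a n * avg n (\<lambda>t. \<bar>gfun t / (real n + 1) - \<theta>\<bar>) + \<bar>a n * \<theta> - svar\<bar>
          + c n * avg n (\<lambda>t. ((hfun t - 2) / (2 * real n + 1))\<^sup>2)" .
    qed
    have "(\<lambda>n. a n * avg n (\<lambda>t. \<bar>gfun t / (real n + 1) - \<theta>\<bar>) + \<bar>a n * \<theta> - svar\<bar>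
          + c n * avg n (\<lambda>t. ((hfun t - 2) / (2 * real n + 1))\<^sup>2))
        \<longlonglongrightarrow> 1 / pi * (1 / 4) * 0 + \<bar>1 / pi * (1 / 4) * \<theta> - svar\<bar> + 1 / pi * 0"
      using gfun_lln[folded \<theta>_def] by (intro tendsto_intros a_lim c_lim avg_hfun_square_null)
    \<comment> \<open>The 1/4 is the limit of (n + 1)/(4n + 2), one over the graftings per
      node.\<close>
    moreover have "1 / pi * (1 / 4) * \<theta> - svar = 0"
      by (simp add: \<theta>_def svar_def field_simps)
    ultimately show "(\<lambda>n. a n * avg n (\<lambda>t. \<bar>gfun t / (real n + 1) - \<theta>\<bar>) + \<bar>a n * \<theta> - svar\<bar>
          + c n * avg n (\<lambda>t. ((hfun t - 2) / (2 * real n + 1))\<^sup>2)) \<longlonglongrightarrow> 0"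
      by simp
  qed simp
qed

lemma avg_zfun_square_limit: "(\<lambda>n. avg n (\<lambda>t. (zfun n t)\<^sup>2) / ln (real n)) \<longlonglongrightarrow> svar"
proof -
  define \<eta> where "\<eta> n = (real n + 1) * (avg n (qfun n) - svar / (real n + 1))" for n
  have "\<eta> \<longlonglongrightarrow> 0"
  proof (rule Lim_null_comparison)
    show "\<forall>\<^sub>F n in sequentially. norm (\<eta> n) \<le> (real n + 1) * avg n (\<lambda>t. \<bar>qfun n t - svar / (real n + 1)\<bar>)"
    proof (intro always_eventually allI)
      fix n
      have "norm (\<eta> n) = (real n + 1) * \<bar>avg n (\<lambda>t. qfun n t - svar / (real n + 1))\<bar>"
        by (simp add: \<eta>_def abs_mult avg_diff)
      also have "\<dots> \<le> (real n + 1) * avg n (\<lambda>t. \<bar>qfun n t - svar / (real n + 1)\<bar>)"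
        by (intro mult_left_mono abs_avg_le) simp
      finally show "norm (\<eta> n) \<le> (real n + 1) * avg n (\<lambda>t. \<bar>qfun n t - svar / (real n + 1)\<bar>)" .
    qed
  qed (rule qfun_lln)
  from log_average_null[OF this]
  have L: "(\<lambda>n. 4 * (1 / ln (real n)) + svar * (harm n / ln (real n)) + (\<Sum>k<n. \<eta> k / (real k + 1)) / ln (real n))
      \<longlonglongrightarrow> 4 * 0 + svar * 1 + 0"
    by (intro tendsto_add tendsto_mult tendsto_const harm_ln_ratio) real_asymp
  have "avg k (qfun k) = svar * (1 / (real k + 1)) + \<eta> k / (real k + 1)" for k
    by (simp add: \<eta>_def)
  then have "avg n (\<lambda>t. (zfun n t)\<^sup>2) = 4 + svar * harm n + (\<Sum>k<n. \<eta> k / (real k + 1))" for n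
    unfolding avg_zfun_square harm_lessThan by (simp add: sum.distrib sum_distrib_left)
  with L show ?thesis
    by (simp add: add_divide_distrib)
qed

section \<open>Convergence of characteristic functions\<close>

lemma exp_minus_bound:
  fixes y :: real
  assumes "0 \<le> y"
  shows "\<bar>1 - y - exp (- y)\<bar> \<le> y\<^sup>2"
proof -
  have "1 - y \<le> exp (- y)"
    using exp_ge_add_one_self[of "- y"] by simp
  moreover have "exp (- y) \<le> 1 / (1 + y)"
    using exp_ge_add_one_self[of y] assms by (simp add: exp_minus inverse_eq_divide frac_le)
  moreover have "1 / (1 + y) \<le> 1 - y + y\<^sup>2"
    using assms by (simp add: divide_simps power2_eq_square algebra_simps)
  ultimately show ?thesis
    by linarith
qed

lemma iexp_second_order: "cmod (iexp x - (1 + \<i> * x - x\<^sup>2 / 2)) \<le> \<bar>x\<bar> ^ 3 / 6"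
proof -
  have "(\<Sum>k\<le>2. (\<i> * complex_of_real x) ^ k / fact k) = 1 + \<i> * x - x\<^sup>2 / 2"
    by (simp add: numeral_2_eq_2 power2_eq_square) (simp add: algebra_simps)
  then show ?thesis
    using iexp_approx1[of x 2] by (simp add: fact_numeral numeral_3_eq_3)
qed

lemma norm_sum_list_le: "norm (\<Sum>x\<leftarrow>xs. f x) \<le> (\<Sum>x\<leftarrow>xs. norm (f x))" for f :: "'b \<Rightarrow> 'a::real_normed_vector"
  by (induction xs) (auto intro: norm_triangle_le)

definition zchar :: "nat \<Rightarrow> real \<Rightarrow> complex" where
  "zchar n x = avg n (\<lambda>t. iexp (x * zfun n t))"

text \<open>In the second-order expansion the linear term vanishes by the martingale property and
  the quadratic one is \<open>qfun\<close>. Bounded increments estimate the cubic remainder by C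
  times the square, so the error is again a multiple of \<open>qfun\<close>.\<close>

lemma remy_char_approx:
  assumes t: "size t = n" and C: "\<And>t'. t' \<in> set (remy t) \<Longrightarrow> \<bar>zfun (Suc n) t' - zfun n t\<bar> \<le> C"
  shows "cmod ((\<Sum>t'\<leftarrow>remy t. iexp (x * (zfun (Suc n) t' - zfun n t))) /\<^sub>R (4 * real n + 2) - (1 - x\<^sup>2 * qfun n t / 2))
    \<le> \<bar>x\<bar> ^ 3 * C * qfun n t / 6"
proof -
  define D where "D t' = zfun (Suc n) t' - zfun n t" for t'
  have N: "4 * real n + 2 > 0"
    by simp
  have sum_of_real: "(\<Sum>t'\<leftarrow>ts. complex_of_real (f t')) = complex_of_real (\<Sum>t'\<leftarrow>ts. f t')" for f and ts :: "unit tree list"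
    by (induction ts) auto
  have "(\<Sum>t'\<leftarrow>remy t. 1 + \<i> * complex_of_real (x * D t') - complex_of_real ((x * D t')\<^sup>2) / 2)
      = (\<Sum>t'\<leftarrow>remy t. 1 + ((\<i> * x) * complex_of_real (D t') + (- (x\<^sup>2 / 2)) * complex_of_real ((D t')\<^sup>2)))"
    by (intro arg_cong[where f = sum_list] map_cong refl) (simp add: power_mult_distrib)
  also have "\<dots> = complex_of_real (4 * real n + 2) + ((\<i> * x) * complex_of_real (\<Sum>t'\<leftarrow>remy t. D t')
      + (- (x\<^sup>2 / 2)) * complex_of_real (\<Sum>t'\<leftarrow>remy t. (D t')\<^sup>2))"
    unfolding sum_list_addf sum_list_const_mult sum_of_real by (simp add: sum_list_triv length_remy t)
  also have "\<dots> = complex_of_real ((4 * real n + 2) * (1 - x\<^sup>2 * qfun n t / 2))"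
    unfolding D_def zfun_remy_sum[OF t] zfun_remy_square_sum[OF t] by (simp add: algebra_simps)
  finally have S: "(\<Sum>t'\<leftarrow>remy t. 1 + \<i> * complex_of_real (x * D t') - complex_of_real ((x * D t')\<^sup>2) / 2)
      = complex_of_real ((4 * real n + 2) * (1 - x\<^sup>2 * qfun n t / 2))" .
  have "cmod ((\<Sum>t'\<leftarrow>remy t. iexp (x * D t')) - complex_of_real ((4 * real n + 2) * (1 - x\<^sup>2 * qfun n t / 2)))
      = cmod (\<Sum>t'\<leftarrow>remy t. iexp (x * D t') - (1 + \<i> * complex_of_real (x * D t') - complex_of_real ((x * D t')\<^sup>2) / 2))"
    unfolding S[symmetric] sum_list_subtractf ..
  also have "\<dots> \<le> (\<Sum>t'\<leftarrow>remy t. cmod (iexp (x * D t') - (1 + \<i> * complex_of_real (x * D t') - complex_of_real ((x * D t')\<^sup>2) / 2)))"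
    by (rule norm_sum_list_le)
  also have "\<dots> \<le> (\<Sum>t'\<leftarrow>remy t. \<bar>x\<bar> ^ 3 * C / 6 * (D t')\<^sup>2)"
  proof (rule sum_list_mono)
    fix t' assume t': "t' \<in> set (remy t)"
    have "cmod (iexp (x * D t') - (1 + \<i> * complex_of_real (x * D t') - complex_of_real ((x * D t')\<^sup>2) / 2)) \<le> \<bar>x * D t'\<bar> ^ 3 / 6"
      using iexp_second_order[of "x * D t'"] by simp
    also have "\<dots> = \<bar>x\<bar> ^ 3 / 6 * (\<bar>D t'\<bar> * (D t')\<^sup>2)"
    proof -
      have "\<bar>D t'\<bar> ^ 3 = \<bar>D t'\<bar> * \<bar>D t'\<bar>\<^sup>2"
        by (simp only: power3_eq_cube power2_eq_square mult.assoc)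
      then show ?thesis
        by (simp add: abs_mult power_mult_distrib)
    qed
    also have "\<dots> \<le> \<bar>x\<bar> ^ 3 / 6 * (C * (D t')\<^sup>2)"
      using C[OF t'] by (intro mult_left_mono mult_right_mono) (auto simp: D_def)
    finally show "cmod (iexp (x * D t') - (1 + \<i> * complex_of_real (x * D t') - complex_of_real ((x * D t')\<^sup>2) / 2))
        \<le> \<bar>x\<bar> ^ 3 * C / 6 * (D t')\<^sup>2"
      by simp
  qed
  also have "\<dots> = (4 * real n + 2) * (\<bar>x\<bar> ^ 3 * C * qfun n t / 6)"
    unfolding sum_list_const_mult D_def zfun_remy_square_sum[OF t] by simp
  finally have M: "cmod ((\<Sum>t'\<leftarrow>remy t. iexp (x * D t')) - complex_of_real ((4 * real n + 2) * (1 - x\<^sup>2 * qfun n t / 2)))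
      \<le> (4 * real n + 2) * (\<bar>x\<bar> ^ 3 * C * qfun n t / 6)" .
  define Y where "Y = (\<Sum>t'\<leftarrow>remy t. iexp (x * D t'))"
  have scale: "Y /\<^sub>R a - complex_of_real w = (Y - complex_of_real (a * w)) /\<^sub>R a" if "a \<noteq> 0" for a w :: real
    using that by (simp add: scaleR_conv_of_real right_diff_distrib)
  have "Y /\<^sub>R (4 * real n + 2) - complex_of_real (1 - x\<^sup>2 * qfun n t / 2)
      = (Y - complex_of_real ((4 * real n + 2) * (1 - x\<^sup>2 * qfun n t / 2))) /\<^sub>R (4 * real n + 2)"
    using N by (intro scale) simp
  then have "cmod (Y /\<^sub>R (4 * real n + 2) - complex_of_real (1 - x\<^sup>2 * qfun n t / 2))
      = \<bar>inverse (4 * real n + 2)\<bar> * cmod (Y - complex_of_real ((4 * real n + 2) * (1 - x\<^sup>2 * qfun n t / 2)))"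
    by (simp only: norm_scaleR)
  also have "\<dots> \<le> \<bar>inverse (4 * real n + 2)\<bar> * ((4 * real n + 2) * (\<bar>x\<bar> ^ 3 * C * qfun n t / 6))"
    unfolding Y_def by (intro mult_left_mono M abs_ge_zero)
  also have "\<dots> = \<bar>x\<bar> ^ 3 * C * qfun n t / 6"
  proof -
    have "\<bar>inverse a\<bar> * (a * z) = z" if "a > 0" for a z :: real
      using that by simp
    from this[OF N] show ?thesis .
  qed
  finally show ?thesis
    unfolding Y_def D_def .
qed

text \<open>Conditioning on the tree of size n gives a random factor close to 1 - x^2
  \<open>qfun\<close>/2. It is exchanged for a deterministic exponential, which leaves the average
  and exposes \<open>zchar n x\<close>.\<close>

lemma zchar_Suc:
  assumes C: "\<And>n t t'. size t = n \<Longrightarrow> t' \<in> set (remy t) \<Longrightarrow> \<bar>zfun (Suc n) t' - zfun n t\<bar> \<le> C"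
  shows "cmod (zchar (Suc n) x - exp (- (x\<^sup>2 * svar / 2 * (1 / (real n + 1)))) * zchar n x)
    \<le> x\<^sup>2 / 2 * avg n (\<lambda>t. \<bar>qfun n t - svar / (real n + 1)\<bar>) + \<bar>x\<bar> ^ 3 * C / 6 * avg n (qfun n)
      + (x\<^sup>2 * svar / 2 * (1 / (real n + 1)))\<^sup>2"
proof -
  define y where "y = x\<^sup>2 * svar / 2 * (1 / (real n + 1))"
  have y: "0 \<le> y"
    by (simp add: y_def svar_nonneg)
  define E where "E t = (\<Sum>t'\<leftarrow>remy t. iexp (x * (zfun (Suc n) t' - zfun n t))) /\<^sub>R (4 * real n + 2)" for t
  have "zchar (Suc n) x = avg n (\<lambda>t. iexp (x * zfun n t) * E t)"
    unfolding zchar_def avg_Suc_remy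
  proof (rule avg_cong)
    fix t :: "unit tree"
    have "(\<Sum>t'\<leftarrow>remy t. iexp (x * zfun (Suc n) t'))
        = (\<Sum>t'\<leftarrow>remy t. iexp (x * zfun n t) * iexp (x * (zfun (Suc n) t' - zfun n t)))"
      by (intro arg_cong[where f = sum_list] map_cong refl) (simp add: exp_add[symmetric] algebra_simps)
    also have "\<dots> = iexp (x * zfun n t) * (\<Sum>t'\<leftarrow>remy t. iexp (x * (zfun (Suc n) t' - zfun n t)))"
      by (rule sum_list_const_mult)
    finally show "(\<Sum>t'\<leftarrow>remy t. iexp (x * zfun (Suc n) t')) /\<^sub>R (4 * real n + 2) = iexp (x * zfun n t) * E t"
      by (simp add: E_def)
  qed
  then have "zchar (Suc n) x - exp (- y) * zchar n x
      = avg n (\<lambda>t. iexp (x * zfun n t) * E t) - avg n (\<lambda>t. exp (- y) * iexp (x * zfun n t))"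
    unfolding zchar_def avg_cmult by simp
  also have "\<dots> = avg n (\<lambda>t. iexp (x * zfun n t) * (E t - exp (- y)))"
    unfolding avg_diff[symmetric] by (intro avg_cong) (simp add: algebra_simps)
  finally have "cmod (zchar (Suc n) x - exp (- y) * zchar n x)
      = cmod (avg n (\<lambda>t. iexp (x * zfun n t) * (E t - exp (- y))))"
    by simp
  also have "\<dots> \<le> avg n (\<lambda>t. cmod (iexp (x * zfun n t) * (E t - exp (- y))))"
    by (rule norm_avg_le)
  also have "\<dots> \<le> avg n (\<lambda>t. x\<^sup>2 / 2 * \<bar>qfun n t - svar / (real n + 1)\<bar> + \<bar>x\<bar> ^ 3 * C / 6 * qfun n t + y\<^sup>2)"
  proof (rule avg_mono)
    fix t :: "unit tree" assume t: "size t = n"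
    have "cmod (iexp (x * zfun n t) * (E t - exp (- y))) = cmod (E t - exp (- y))"
      by (simp add: norm_mult)
    also have "E t - complex_of_real (exp (- y)) = (E t - (1 - x\<^sup>2 * qfun n t / 2))
        + complex_of_real (1 - x\<^sup>2 * qfun n t / 2 - exp (- y))"
      by simp
    also have "cmod \<dots> \<le> cmod (E t - (1 - x\<^sup>2 * qfun n t / 2)) + \<bar>1 - x\<^sup>2 * qfun n t / 2 - exp (- y)\<bar>"
      by (rule order.trans[OF norm_triangle_ineq]) (simp only: norm_of_real)
    also have "cmod (E t - (1 - x\<^sup>2 * qfun n t / 2)) \<le> \<bar>x\<bar> ^ 3 * C * qfun n t / 6"
      unfolding E_def using remy_char_approx[OF t C[OF t], of x] by simp
    also have "\<bar>1 - x\<^sup>2 * qfun n t / 2 - exp (- y)\<bar> \<le> \<bar>x\<^sup>2 / 2 * (qfun n t - svar / (real n + 1))\<bar> + y\<^sup>2"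
    proof -
      have "1 - x\<^sup>2 * qfun n t / 2 - exp (- y) = (1 - y - exp (- y)) - x\<^sup>2 / 2 * (qfun n t - svar / (real n + 1))"
        by (simp add: y_def right_diff_distrib)
      then show ?thesis
        using exp_minus_bound[OF y] by linarith
    qed
    also have "\<bar>x\<^sup>2 / 2 * (qfun n t - svar / (real n + 1))\<bar> = x\<^sup>2 / 2 * \<bar>qfun n t - svar / (real n + 1)\<bar>"
      by (simp add: abs_mult)
    finally show "cmod (iexp (x * zfun n t) * (E t - exp (- y)))
        \<le> x\<^sup>2 / 2 * \<bar>qfun n t - svar / (real n + 1)\<bar> + \<bar>x\<bar> ^ 3 * C / 6 * qfun n t + y\<^sup>2"
      by simp
  qed
  also have "\<dots> = x\<^sup>2 / 2 * avg n (\<lambda>t. \<bar>qfun n t - svar / (real n + 1)\<bar>) + \<bar>x\<bar> ^ 3 * C / 6 * avg n (qfun n) + y\<^sup>2"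
    unfolding avg_add avg_cmult by simp
  finally show ?thesis
    unfolding y_def .
qed

text \<open>The one-step errors accumulate without amplification because all multipliers are at most
  1. At u = x / sqrt (ln n) the cubic and quartic terms carry (ln n) powr (-3/2) and (ln n) powr
  (-2) against a harmonic sum, and the variance error is a null logarithmic average.\<close>

lemma zchar_limit: "(\<lambda>n. zchar n (x / sqrt (ln (real n)))) \<longlonglongrightarrow> exp (- (x\<^sup>2 * svar / 2))"
proof -
  obtain C1 where C1: "\<And>n t t'. size t = n \<Longrightarrow> t' \<in> set (remy t) \<Longrightarrow> \<bar>zfun (Suc n) t' - zfun n t\<bar> \<le> C1"
    using zfun_diff_bounded by blast
  define C where "C = \<bar>C1\<bar>"
  have C: "\<And>n t t'. size t = n \<Longrightarrow> t' \<in> set (remy t) \<Longrightarrow> \<bar>zfun (Suc n) t' - zfun n t\<bar> \<le> C"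
    using C1 unfolding C_def by (meson abs_ge_self order.trans)
  have C_nonneg: "0 \<le> C"
    by (simp add: C_def)
  obtain K where K: "\<And>n. avg n (qfun n) \<le> K / (real n + 1)"
    using avg_qfun_le by blast
  define \<eta> where "\<eta> n = (real n + 1) * avg n (\<lambda>t. \<bar>qfun n t - svar / (real n + 1)\<bar>)" for n
  have \<eta>: "\<eta> \<longlonglongrightarrow> 0"
    unfolding \<eta>_def[abs_def] by (rule qfun_lln)
  define W where "W n = (\<Sum>k<n. \<eta> k / (real k + 1))" for n
  define R where "R n u = u\<^sup>2 / 2 * W n + (\<bar>u\<bar> ^ 3 * C * K / 6 + (u\<^sup>2 * svar / 2)\<^sup>2) * harm n" for n u
  \<comment> \<open>The argument u stays fixed throughout the induction; only afterwards is it made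
    to depend on the final n.\<close>
  have main: "cmod (zchar n u - exp (- (u\<^sup>2 * svar / 2 * harm n)) * zchar 0 u) \<le> R n u" for n u
  proof (induction n)
    case 0
    then show ?case
      by (simp add: R_def W_def harm_expand)
  next
    case (Suc n)
    define y where "y = u\<^sup>2 * svar / 2 * (1 / (real n + 1))"
    have y: "0 \<le> y"
      by (simp add: y_def svar_nonneg)
    have h: "harm (Suc n) = harm n + 1 / (real n + 1)"
      unfolding harm_lessThan by simp
    have "exp (- (u\<^sup>2 * svar / 2 * harm (Suc n))) = exp (- y) * exp (- (u\<^sup>2 * svar / 2 * harm n))"
      unfolding h y_def exp_add[symmetric] by (simp add: distrib_left)
    then have "zchar (Suc n) u - exp (- (u\<^sup>2 * svar / 2 * harm (Suc n))) * zchar 0 u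
        = (zchar (Suc n) u - exp (- y) * zchar n u)
          + exp (- y) * (zchar n u - exp (- (u\<^sup>2 * svar / 2 * harm n)) * zchar 0 u)"
      by (simp add: algebra_simps)
    also have "cmod \<dots> \<le> cmod (zchar (Suc n) u - exp (- y) * zchar n u)
        + cmod (exp (- y) * (zchar n u - exp (- (u\<^sup>2 * svar / 2 * harm n)) * zchar 0 u))"
      by (rule norm_triangle_ineq)
    also have "cmod (exp (- y) * (zchar n u - exp (- (u\<^sup>2 * svar / 2 * harm n)) * zchar 0 u)) \<le> 1 * R n u"
      unfolding norm_mult using y by (intro mult_mono Suc.IH) auto
    also have "cmod (zchar (Suc n) u - exp (- y) * zchar n u) \<le> u\<^sup>2 / 2 * (\<eta> n / (real n + 1))
        + \<bar>u\<bar> ^ 3 * C * K / 6 * (1 / (real n + 1)) + (u\<^sup>2 * svar / 2)\<^sup>2 * (1 / (real n + 1))"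
    proof -
      have "cmod (zchar (Suc n) u - exp (- y) * zchar n u)
          \<le> u\<^sup>2 / 2 * avg n (\<lambda>t. \<bar>qfun n t - svar / (real n + 1)\<bar>) + \<bar>u\<bar> ^ 3 * C / 6 * avg n (qfun n) + y\<^sup>2"
        using zchar_Suc[OF C, of n u] unfolding y_def .
      also have "avg n (\<lambda>t. \<bar>qfun n t - svar / (real n + 1)\<bar>) = \<eta> n / (real n + 1)"
        by (simp add: \<eta>_def)
      also have "\<bar>u\<bar> ^ 3 * C / 6 * avg n (qfun n) \<le> \<bar>u\<bar> ^ 3 * C / 6 * (K / (real n + 1))"
        by (intro mult_left_mono K) (use C_nonneg in auto)
      also have "y\<^sup>2 = (u\<^sup>2 * svar / 2)\<^sup>2 * (1 / (real n + 1))\<^sup>2"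
        unfolding y_def by (rule power_mult_distrib)
      also have "\<dots> \<le> (u\<^sup>2 * svar / 2)\<^sup>2 * (1 / (real n + 1))"
      proof (rule mult_left_mono)
        have "1 / (real n + 1) * (1 / (real n + 1)) \<le> 1 / (real n + 1) * 1"
          by (intro mult_left_mono) auto
        then show "(1 / (real n + 1))\<^sup>2 \<le> 1 / (real n + 1)"
          by (simp only: power2_eq_square mult_1_right)
      qed simp
      finally show ?thesis
        by simp
    qed
    also have "u\<^sup>2 / 2 * (\<eta> n / (real n + 1)) + \<bar>u\<bar> ^ 3 * C * K / 6 * (1 / (real n + 1))
        + (u\<^sup>2 * svar / 2)\<^sup>2 * (1 / (real n + 1)) + 1 * R n u = R (Suc n) u"
    proof -
      have "u\<^sup>2 / 2 * e + c * p + d * p + 1 * (u\<^sup>2 / 2 * w + (c + d) * h) = u\<^sup>2 / 2 * (w + e) + (c + d) * (h + p)"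
        for c d e h p w :: real
        by (simp add: algebra_simps)
      then show ?thesis
        unfolding R_def h W_def sum.lessThan_Suc .
    qed
    finally show ?case
      by simp
  qed
  let ?u = "\<lambda>n. x / sqrt (ln (real n))"
  have R_lim: "(\<lambda>n. R n (?u n)) \<longlonglongrightarrow> 0"
  proof -
    have "(\<lambda>n. x\<^sup>2 / 2 * (W n / ln (real n)) + (\<bar>x\<bar> ^ 3 * C * K / 6 * (1 / sqrt (ln (real n)))
        + (x\<^sup>2 * svar / 2)\<^sup>2 * (1 / ln (real n))) * (harm n / ln (real n)))
        \<longlonglongrightarrow> x\<^sup>2 / 2 * 0 + (\<bar>x\<bar> ^ 3 * C * K / 6 * 0 + (x\<^sup>2 * svar / 2)\<^sup>2 * 0) * 1"
      unfolding W_def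
      by (intro tendsto_add tendsto_mult tendsto_const log_average_null[OF \<eta>] harm_ln_ratio) real_asymp+
    then have "(\<lambda>n. x\<^sup>2 / 2 * (W n / ln (real n)) + (\<bar>x\<bar> ^ 3 * C * K / 6 * (1 / sqrt (ln (real n)))
        + (x\<^sup>2 * svar / 2)\<^sup>2 * (1 / ln (real n))) * (harm n / ln (real n))) \<longlonglongrightarrow> 0"
      by simp
    then show ?thesis
    proof (rule Lim_transform_eventually)
      show "\<forall>\<^sub>F n in sequentially. x\<^sup>2 / 2 * (W n / ln (real n)) + (\<bar>x\<bar> ^ 3 * C * K / 6 * (1 / sqrt (ln (real n)))
        + (x\<^sup>2 * svar / 2)\<^sup>2 * (1 / ln (real n))) * (harm n / ln (real n)) = R n (?u n)"
        using eventually_gt_at_top[of 1]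
      proof eventually_elim
        case (elim n)
        define r where "r = sqrt (ln (real n))"
        have r: "r > 0" "ln (real n) = r\<^sup>2"
          using elim by (auto simp: r_def)
        have "x\<^sup>2 / 2 * (W n / r\<^sup>2) + (\<bar>x\<bar> ^ 3 * C * K / 6 * (1 / r) + (x\<^sup>2 * svar / 2)\<^sup>2 * (1 / r\<^sup>2)) * (harm n / r\<^sup>2)
            = R n (x / r)"
        proof -
          have "(x / r)\<^sup>2 / 2 * W n = x\<^sup>2 / 2 * (W n / r\<^sup>2)"
            by (simp add: power_divide)
          moreover have "\<bar>x / r\<bar> ^ 3 * C * K / 6 * harm n = \<bar>x\<bar> ^ 3 * C * K / 6 * (1 / r) * (harm n / r\<^sup>2)"
            using r(1) by (simp add: abs_divide power_divide power3_eq_cube power2_eq_square)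
          moreover have "((x / r)\<^sup>2 * svar / 2)\<^sup>2 * harm n = (x\<^sup>2 * svar / 2)\<^sup>2 * (1 / r\<^sup>2) * (harm n / r\<^sup>2)"
            by (simp add: power_divide power2_eq_square)
          ultimately show ?thesis
            unfolding R_def distrib_right by simp
        qed
        then show ?case
          unfolding r_def[symmetric] unfolding r(2) .
      qed
    qed
  qed
  have diff: "(\<lambda>n. zchar n (?u n) - exp (- ((?u n)\<^sup>2 * svar / 2 * harm n)) * zchar 0 (?u n)) \<longlonglongrightarrow> 0"
    by (rule Lim_null_comparison[OF _ R_lim]) (intro always_eventually allI main)
  have u0: "?u \<longlonglongrightarrow> 0"
  proof -
    have "(\<lambda>n. x * (1 / sqrt (ln (real n)))) \<longlonglongrightarrow> x * 0"
      by (intro tendsto_mult tendsto_const) real_asymp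
    then show ?thesis by simp
  qed
  have z0: "(\<lambda>n. zchar 0 (?u n)) \<longlonglongrightarrow> 1"
  proof -
    have "(\<lambda>n. iexp (?u n * zfun 0 Leaf)) \<longlonglongrightarrow> iexp (0 * zfun 0 Leaf)"
      by (intro tendsto_intros u0)
    then show ?thesis
      by (simp add: zchar_def)
  qed
  have "(\<lambda>n. exp (- (x\<^sup>2 * svar / 2 * (harm n / ln (real n))))) \<longlonglongrightarrow> exp (- (x\<^sup>2 * svar / 2 * 1))"
    by (intro tendsto_intros harm_ln_ratio)
  then have "(\<lambda>n. exp (- ((?u n)\<^sup>2 * svar / 2 * harm n))) \<longlonglongrightarrow> exp (- (x\<^sup>2 * svar / 2 * 1))"
  proof (rule Lim_transform_eventually)
    show "\<forall>\<^sub>F n in sequentially. exp (- (x\<^sup>2 * svar / 2 * (harm n / ln (real n)))) = exp (- ((?u n)\<^sup>2 * svar / 2 * harm n))"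
      using eventually_gt_at_top[of 1]
    proof eventually_elim
      case (elim n)
      then have "(?u n)\<^sup>2 = x\<^sup>2 / ln (real n)"
        by (simp add: power_divide)
      then show ?case
        by simp
    qed
  qed
  then have "(\<lambda>n. complex_of_real (exp (- ((?u n)\<^sup>2 * svar / 2 * harm n)))) \<longlonglongrightarrow> complex_of_real (exp (- (x\<^sup>2 * svar / 2 * 1)))"
    by (rule tendsto_of_real)
  from tendsto_add[OF diff tendsto_mult[OF this z0]] show ?thesis
    by simp
qed

section \<open>The shape functional\<close>

abbreviation xfun :: "unit tree \<Rightarrow> real" where
  "xfun \<equiv> add_fun (\<lambda>k. ln (real k))"

text \<open>The difference of the two tolls is \<kappa> plus an error \<open>e k\<close> in
  [0, 1/k]. Evaluating the series of \<open>C0\<close> by means of \<open>bcat_htoll_sums\<close>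
  gives - \<kappa> - \<theta>, so the linear terms cancel. What remains of the error is centred and
  falls under \<open>avg_bounded\<close> and \<open>avg_square_bound\<close>.\<close>

lemma xfun_decomposition:
  obtains \<kappa> \<Phi> B where "\<And>t. xfun t - C0 * (real (size t) + 1) = hfun t + \<kappa> - \<Phi> t"
    and "\<And>n. avg n (\<lambda>t. (\<Phi> t)\<^sup>2) \<le> B * (2 * real n + 1)"
proof -
  obtain \<kappa> where \<kappa>: "\<And>k. k \<ge> 1 \<Longrightarrow> 0 \<le> htoll k - ln (real k) - \<kappa>"
      "\<And>k. k \<ge> 1 \<Longrightarrow> htoll k - ln (real k) - \<kappa> \<le> 1 / real k"
    using htoll_ln by blast
  define e where "e k = htoll k - ln (real k) - \<kappa>" for k
  have e: "\<bar>e k\<bar> \<le> 1 / real k" "\<bar>e k\<bar> \<le> 1" if "k \<ge> 1" for k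
  proof -
    show "\<bar>e k\<bar> \<le> 1 / real k"
      using \<kappa>[OF that] by (simp add: e_def)
    also have "1 / real k \<le> 1"
      using that by simp
    finally show "\<bar>e k\<bar> \<le> 1" .
  qed
  have b1: "(\<lambda>k. bcat (Suc k)) sums 1"
    using bcat_sums by (subst sums_Suc_iff) simp
  have "summable (\<lambda>k. bcat (Suc k) * e (Suc k))"
  proof (rule summable_comparison_test'[OF sums_summable[OF b1], of 0])
    fix k
    have "bcat (Suc k) * \<bar>e (Suc k)\<bar> \<le> bcat (Suc k) * 1"
      by (intro mult_left_mono e) auto
    then show "norm (bcat (Suc k) * e (Suc k)) \<le> bcat (Suc k)"
      by (simp add: abs_mult)
  qed
  then obtain \<theta> where \<theta>: "(\<lambda>k. bcat (Suc k) * e (Suc k)) sums \<theta>"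
    by (auto simp: summable_def)
  have "(\<lambda>k. bcat (Suc k) * htoll (Suc k) - \<kappa> * bcat (Suc k) - bcat (Suc k) * e (Suc k)) sums (0 - \<kappa> * 1 - \<theta>)"
    by (rule sums_diff[OF sums_diff[OF bcat_htoll_sums sums_mult[OF b1]] \<theta>])
  moreover have "bcat (Suc k) * htoll (Suc k) - \<kappa> * bcat (Suc k) - bcat (Suc k) * e (Suc k)
      = ln (real (Suc k)) * catalan_beta (Suc k) / 4 ^ Suc k" for k
    unfolding e_def bcat_catalan by (simp only: right_diff_distrib) (simp add: mult.commute)
  ultimately have "(\<lambda>k. ln (real (Suc k)) * catalan_beta (Suc k) / 4 ^ Suc k) sums (- \<kappa> - \<theta>)"
    by (simp only: mult_1_right diff_0)
  then have C0: "C0 = - \<kappa> - \<theta>"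
    unfolding C0_def by (rule sums_unique[symmetric])
  \<comment> \<open>The subtracted term acts as a leaf toll - \<theta>; with \<open>bcat 0\<close> =
    1 it cancels the sum of the series over positive sizes.\<close>
  define \<Phi> where "\<Phi> t = add_fun e t - \<theta> * (real (size t) + 1)" for t
  have "xfun t = hfun t - \<kappa> * real (size t) - add_fun e t" for t
    by (induction t) (auto simp: e_def algebra_simps)
  then have decomp: "xfun t - C0 * (real (size t) + 1) = hfun t + \<kappa> - \<Phi> t" for t
    unfolding C0 \<Phi>_def by (simp add: algebra_simps)
  have toll_Node: "toll \<Phi> t = e (size t)" if "size t \<noteq> 0" for t
    using that by (cases t) (auto simp: \<Phi>_def algebra_simps)
  have toll_avg: "avg k (toll \<Phi>) = e k" if "k \<ge> 1" for k
  proof -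
    have "avg k (toll \<Phi>) = avg k (\<lambda>_. e k)"
      using that by (intro avg_cong) (simp add: toll_Node)
    then show ?thesis
      by simp
  qed
  have "\<exists>M. \<forall>n. \<bar>avg n \<Phi>\<bar> \<le> M"
  proof (rule avg_bounded[where A = 1])
    have "(\<lambda>k. bcat (Suc k) * avg (Suc k) (toll \<Phi>)) sums \<theta>"
      using \<theta> by (simp add: toll_avg)
    then show "(\<lambda>k. bcat k * avg k (toll \<Phi>)) sums 0"
      by (subst (asm) sums_Suc_iff) (simp add: \<Phi>_def)
  qed (simp add: toll_avg e)
  then obtain M where M: "\<bar>avg n \<Phi>\<bar> \<le> M" for n
    by blast
  have M_nonneg: "0 \<le> M"
    using M[of 0] by linarith
  \<comment> \<open>The summand \<theta> squared covers n = 0, where toll and value are both -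
    \<theta>. For positive n the toll is a constant of absolute value at most 1.\<close>
  have "\<bar>avg n (\<lambda>t. toll \<Phi> t * \<Phi> t)\<bar> \<le> M + \<theta>\<^sup>2" for n
  proof (cases "n = 0")
    case True
    then show ?thesis
      using M_nonneg by (simp add: \<Phi>_def power2_eq_square)
  next
    case False
    have "avg n (\<lambda>t. toll \<Phi> t * \<Phi> t) = avg n (\<lambda>t. e n * \<Phi> t)"
      using False by (intro avg_cong) (simp add: toll_Node)
    also have "\<dots> = e n * avg n \<Phi>"
      by (rule avg_cmult)
    also have "\<bar>\<dots>\<bar> \<le> 1 * M"
      unfolding abs_mult using False by (intro mult_mono e M) auto
    finally show ?thesis
      by (simp add: add_increasing2)
  qed
  from avg_square_bound[OF M this] decomp show ?thesis
    using that by blast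
qed

section \<open>Comparison of the normalised shape functional with the martingale\<close>

lemma avg_Cauchy_Schwarz: "(avg n (\<lambda>t. f t * g t))\<^sup>2 \<le> avg n (\<lambda>t. (f t)\<^sup>2) * avg n (\<lambda>t. (g t)\<^sup>2)"
  for f g :: "unit tree \<Rightarrow> real"
proof -
  have "(\<Sum>t\<in>bin_trees n. f t * g t)\<^sup>2 \<le> (\<Sum>t\<in>bin_trees n. (f t)\<^sup>2) * (\<Sum>t\<in>bin_trees n. (g t)\<^sup>2)"
    by (rule Cauchy_Schwarz_ineq_sum)
  then have "(\<Sum>t\<in>bin_trees n. f t * g t)\<^sup>2 * (inverse (real (card (bin_trees n))))\<^sup>2
      \<le> (\<Sum>t\<in>bin_trees n. (f t)\<^sup>2) * (\<Sum>t\<in>bin_trees n. (g t)\<^sup>2) * (inverse (real (card (bin_trees n))))\<^sup>2"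
    by (rule mult_right_mono) simp
  then show ?thesis
    unfolding avg_def by (simp add: power2_eq_square mult_ac)
qed

definition yfun :: "nat \<Rightarrow> unit tree \<Rightarrow> real" where
  "yfun n t = (xfun t - C0 * (real n + 1)) / sqrt (real n * ln (real n))"

text \<open>The factor sqrt pi compensates \<open>cbin n\<close> ~ 1/sqrt (pi n), so this is the
  martingale on the scale of \<open>yfun\<close>.\<close>

definition wfun :: "nat \<Rightarrow> unit tree \<Rightarrow> real" where
  "wfun n t = sqrt pi / sqrt (ln (real n)) * zfun n t"

lemma cbin_sqrt_asymp: "(\<lambda>n. sqrt pi * (cbin n * sqrt (real n))) \<longlonglongrightarrow> 1"
proof -
  have "(\<lambda>n. sqrt pi * sqrt ((cbin n)\<^sup>2 * (2 * real n + 1) * (real n / (2 * real n + 1)))) \<longlonglongrightarrow> sqrt pi * sqrt (2 / pi * (1 / 2))"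
    by (intro tendsto_mult tendsto_const tendsto_real_sqrt cbin_asymp) real_asymp
  moreover have "sqrt ((cbin n)\<^sup>2 * (2 * real n + 1) * (real n / (2 * real n + 1))) = cbin n * sqrt (real n)" for n
  proof -
    have "(cbin n)\<^sup>2 * (2 * real n + 1) * (real n / (2 * real n + 1)) = (cbin n)\<^sup>2 * real n"
      by (simp add: divide_simps)
    then show ?thesis
      by (simp add: real_sqrt_mult)
  qed
  moreover have "sqrt pi * sqrt (2 / pi * (1 / 2)) = 1"
    by (simp add: real_sqrt_mult[symmetric])
  ultimately show ?thesis
    by (simp only:)
qed

lemma avg_wfun_square: "(\<lambda>n. avg n (\<lambda>t. (wfun n t)\<^sup>2)) \<longlonglongrightarrow> 8 * (1 - ln 2)"
proof -
  have "(\<lambda>n. pi * (avg n (\<lambda>t. (zfun n t)\<^sup>2) / ln (real n))) \<longlonglongrightarrow> pi * svar"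
    by (intro tendsto_mult tendsto_const avg_zfun_square_limit)
  moreover have "avg n (\<lambda>t. (wfun n t)\<^sup>2) = pi * (avg n (\<lambda>t. (zfun n t)\<^sup>2) / ln (real n))" for n
  proof -
    have "ln (real n) \<ge> 0"
      by (cases n) auto
    then have "avg n (\<lambda>t. (wfun n t)\<^sup>2) = avg n (\<lambda>t. pi / ln (real n) * (zfun n t)\<^sup>2)"
      by (intro avg_cong) (simp add: wfun_def power_mult_distrib power_divide)
    then show ?thesis
      by (simp only: avg_cmult) simp
  qed
  ultimately show ?thesis
    by (simp add: svar_def)
qed

lemma avg_wfun: "(\<lambda>n. avg n (wfun n)) \<longlonglongrightarrow> 0"
proof -
  have "avg n (wfun n) = - 2 * sqrt pi * (1 / sqrt (ln (real n)))" for n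
    unfolding wfun_def zfun_def avg_cmult avg_diff by (simp add: avg_hfun)
  moreover have "(\<lambda>n. - 2 * sqrt pi * (1 / sqrt (ln (real n)))) \<longlonglongrightarrow> - 2 * sqrt pi * 0"
    by (intro tendsto_mult tendsto_const) real_asymp
  ultimately show ?thesis
    by simp
qed

text \<open>Closeness in mean square serves twice: it transfers the limit law, and it transfers the
  first two moments on which the standardised version depends.\<close>

lemma yfun_wfun: "(\<lambda>n. avg n (\<lambda>t. (yfun n t - wfun n t)\<^sup>2)) \<longlonglongrightarrow> 0"
proof -
  obtain \<kappa> \<Phi> B where decomp: "\<And>t. xfun t - C0 * (real (size t) + 1) = hfun t + \<kappa> - \<Phi> t"
    and B: "\<And>n. avg n (\<lambda>t. (\<Phi> t)\<^sup>2) \<le> B * (2 * real n + 1)"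
    by (rule xfun_decomposition, rule that)
  \<comment> \<open>The relative error made when \<open>cbin n\<close> is replaced by 1/sqrt (pi
    n).\<close>
  define u where "u n = 1 / (sqrt pi * (cbin n * sqrt (real n))) - 1" for n
  have "(\<lambda>n. 1 / (sqrt pi * (cbin n * sqrt (real n))) - 1) \<longlonglongrightarrow> 1 / 1 - 1"
    by (intro tendsto_diff tendsto_divide tendsto_const cbin_sqrt_asymp) auto
  then have u: "u \<longlonglongrightarrow> 0"
    by (simp add: u_def[abs_def])
  show ?thesis
  proof (rule tendsto_sandwich)
    show "\<forall>\<^sub>F n in sequentially. 0 \<le> avg n (\<lambda>t. (yfun n t - wfun n t)\<^sup>2)"
      by (intro always_eventually allI avg_nonneg) auto
    show "\<forall>\<^sub>F n in sequentially. avg n (\<lambda>t. (yfun n t - wfun n t)\<^sup>2)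
        \<le> 2 * (u n)\<^sup>2 * avg n (\<lambda>t. (wfun n t)\<^sup>2) + 4 * (\<kappa> + 2)\<^sup>2 * (1 / (real n * ln (real n)))
          + 4 * B * ((2 * real n + 1) / (real n * ln (real n)))"
      using eventually_gt_at_top[of 1]
    proof eventually_elim
      case (elim n)
      define \<nu> where "\<nu> = sqrt (real n * ln (real n))"
      have \<nu>: "\<nu> > 0" "\<nu>\<^sup>2 = real n * ln (real n)"
        using elim by (auto simp: \<nu>_def)
      have "avg n (\<lambda>t. (yfun n t - wfun n t)\<^sup>2) \<le> avg n (\<lambda>t. 2 * (u n)\<^sup>2 * (wfun n t)\<^sup>2
          + (4 * (\<kappa> + 2)\<^sup>2 / \<nu>\<^sup>2 + 4 / \<nu>\<^sup>2 * (\<Phi> t)\<^sup>2))"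
      proof (rule avg_mono)
        fix t :: "unit tree" assume t: "size t = n"
        define P where "P = (hfun t - 2) / \<nu>"
        define Q where "Q = (\<kappa> + 2 - \<Phi> t) / \<nu>"
        have "wfun n t = sqrt pi * (cbin n * sqrt (real n)) * P"
          using elim by (simp add: wfun_def zfun_def P_def \<nu>_def real_sqrt_mult)
        then have P: "P = (u n + 1) * wfun n t"
          using elim by (simp add: u_def)
        have "yfun n t = (hfun t + \<kappa> - \<Phi> t) / \<nu>"
          unfolding yfun_def \<nu>_def using decomp[of t] by (simp add: t)
        also have "\<dots> = P + Q"
          by (simp add: P_def Q_def add_divide_distrib diff_divide_distrib)
        finally have "yfun n t - wfun n t = u n * wfun n t + Q"
          unfolding P by (simp add: algebra_simps)
        moreover have sq: "(a + b)\<^sup>2 \<le> 2 * a\<^sup>2 + 2 * b\<^sup>2" for a b :: real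
          using zero_le_power2[of "a - b"] by (simp add: power2_eq_square algebra_simps)
        ultimately have "(yfun n t - wfun n t)\<^sup>2 \<le> 2 * (u n * wfun n t)\<^sup>2 + 2 * Q\<^sup>2"
          by simp
        also have "Q\<^sup>2 \<le> (2 * (\<kappa> + 2)\<^sup>2 + 2 * (\<Phi> t)\<^sup>2) / \<nu>\<^sup>2"
          unfolding Q_def power_divide using sq[of "\<kappa> + 2" "- \<Phi> t"] by (intro divide_right_mono) auto
        finally show "(yfun n t - wfun n t)\<^sup>2 \<le> 2 * (u n)\<^sup>2 * (wfun n t)\<^sup>2 + (4 * (\<kappa> + 2)\<^sup>2 / \<nu>\<^sup>2 + 4 / \<nu>\<^sup>2 * (\<Phi> t)\<^sup>2)"
          by (simp add: power_mult_distrib add_divide_distrib)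
      qed
      also have "\<dots> = 2 * (u n)\<^sup>2 * avg n (\<lambda>t. (wfun n t)\<^sup>2) + (4 * (\<kappa> + 2)\<^sup>2 / \<nu>\<^sup>2 + 4 / \<nu>\<^sup>2 * avg n (\<lambda>t. (\<Phi> t)\<^sup>2))"
        unfolding avg_add avg_cmult by simp
      also have "\<dots> \<le> 2 * (u n)\<^sup>2 * avg n (\<lambda>t. (wfun n t)\<^sup>2) + (4 * (\<kappa> + 2)\<^sup>2 / \<nu>\<^sup>2 + 4 / \<nu>\<^sup>2 * (B * (2 * real n + 1)))"
        by (intro add_left_mono mult_left_mono B) auto
      finally show ?case
        unfolding \<nu>(2) by simp
    qed
    have "(\<lambda>n. 2 * (u n)\<^sup>2 * avg n (\<lambda>t. (wfun n t)\<^sup>2) + 4 * (\<kappa> + 2)\<^sup>2 * (1 / (real n * ln (real n)))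
          + 4 * B * ((2 * real n + 1) / (real n * ln (real n))))
        \<longlonglongrightarrow> 2 * 0\<^sup>2 * (8 * (1 - ln 2)) + 4 * (\<kappa> + 2)\<^sup>2 * 0 + 4 * B * 0"
      by (intro tendsto_add tendsto_mult tendsto_const tendsto_power u avg_wfun_square) real_asymp+
    then show "(\<lambda>n. 2 * (u n)\<^sup>2 * avg n (\<lambda>t. (wfun n t)\<^sup>2) + 4 * (\<kappa> + 2)\<^sup>2 * (1 / (real n * ln (real n)))
          + 4 * B * ((2 * real n + 1) / (real n * ln (real n)))) \<longlonglongrightarrow> 0"
      by simp
  qed simp
qed

lemma yfun_wfun_L1: "(\<lambda>n. avg n (\<lambda>t. \<bar>yfun n t - wfun n t\<bar>)) \<longlonglongrightarrow> 0"
proof (rule tendsto_sandwich)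
  show "\<forall>\<^sub>F n in sequentially. 0 \<le> avg n (\<lambda>t. \<bar>yfun n t - wfun n t\<bar>)"
    by (intro always_eventually allI avg_nonneg) auto
  show "\<forall>\<^sub>F n in sequentially. avg n (\<lambda>t. \<bar>yfun n t - wfun n t\<bar>) \<le> sqrt (avg n (\<lambda>t. (yfun n t - wfun n t)\<^sup>2))"
    by (intro always_eventually allI avg_abs_le_sqrt)
  show "(\<lambda>n. sqrt (avg n (\<lambda>t. (yfun n t - wfun n t)\<^sup>2))) \<longlonglongrightarrow> 0"
    using tendsto_real_sqrt[OF yfun_wfun] by simp
qed simp

lemma avg_yfun: "(\<lambda>n. avg n (yfun n)) \<longlonglongrightarrow> 0"
proof -
  have "(\<lambda>n. avg n (\<lambda>t. yfun n t - wfun n t)) \<longlonglongrightarrow> 0"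
    by (rule Lim_null_comparison[OF _ yfun_wfun_L1]) (use abs_avg_le in \<open>auto intro!: always_eventually\<close>)
  from tendsto_add[OF this avg_wfun] show ?thesis
    by (simp add: avg_diff)
qed

text \<open>Weak convergence alone would not give the variance. Expanding around \<open>wfun\<close>
  leaves a cross term, which the Cauchy-Schwarz inequality makes vanish.\<close>

lemma avg_yfun_square: "(\<lambda>n. avg n (\<lambda>t. (yfun n t)\<^sup>2)) \<longlonglongrightarrow> 8 * (1 - ln 2)"
proof -
  let ?d = "\<lambda>n t. yfun n t - wfun n t"
  have cross: "(\<lambda>n. avg n (\<lambda>t. wfun n t * ?d n t)) \<longlonglongrightarrow> 0"
  proof (rule Lim_null_comparison)
    show "\<forall>\<^sub>F n in sequentially. norm (avg n (\<lambda>t. wfun n t * ?d n t))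
        \<le> sqrt (avg n (\<lambda>t. (wfun n t)\<^sup>2) * avg n (\<lambda>t. (?d n t)\<^sup>2))"
      using avg_Cauchy_Schwarz by (intro always_eventually allI real_le_rsqrt) simp
    show "(\<lambda>n. sqrt (avg n (\<lambda>t. (wfun n t)\<^sup>2) * avg n (\<lambda>t. (?d n t)\<^sup>2))) \<longlonglongrightarrow> 0"
      using tendsto_real_sqrt[OF tendsto_mult[OF avg_wfun_square yfun_wfun]] by simp
  qed
  have "avg n (\<lambda>t. (yfun n t)\<^sup>2) = avg n (\<lambda>t. (wfun n t)\<^sup>2) + 2 * avg n (\<lambda>t. wfun n t * ?d n t) + avg n (\<lambda>t. (?d n t)\<^sup>2)" for n
    unfolding avg_cmult[symmetric] avg_add[symmetric] by (intro avg_cong) (simp add: power2_eq_square algebra_simps)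
  then show ?thesis
    using tendsto_add[OF tendsto_add[OF avg_wfun_square tendsto_mult[OF tendsto_const[of 2] cross]] yfun_wfun] by simp
qed

lemma iexp_diff_le: "cmod (iexp a - iexp b) \<le> \<bar>a - b\<bar>"
proof -
  have "iexp a - iexp b = iexp b * (iexp (a - b) - 1)"
    by (simp add: right_diff_distrib exp_add[symmetric])
  also have "cmod \<dots> = cmod (iexp (a - b) - 1)"
    by (simp add: norm_mult)
  also have "\<dots> \<le> \<bar>a - b\<bar>"
    using iexp_approx1[of "a - b" 0] by simp
  finally show ?thesis .
qed

text \<open>Characteristic functions are Lipschitz in the variable, so closeness in mean absolute
  value is enough. The factor c lets one lemma serve both normalisations: 1 for the first and the
  inverse standard deviation for the second.\<close>

lemma char_limit_of_L1_close:
  assumes "(\<lambda>n. avg n (\<lambda>t. \<bar>U n t - c * wfun n t\<bar>)) \<longlonglongrightarrow> 0"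
  shows "(\<lambda>n. avg n (\<lambda>t. iexp (x * U n t))) \<longlonglongrightarrow> exp (- ((x * c)\<^sup>2 * (8 * (1 - ln 2)) / 2))"
proof -
  have "(\<lambda>n. avg n (\<lambda>t. iexp (x * U n t)) - avg n (\<lambda>t. iexp (x * (c * wfun n t)))) \<longlonglongrightarrow> 0"
  proof (rule Lim_null_comparison)
    show "\<forall>\<^sub>F n in sequentially. norm (avg n (\<lambda>t. iexp (x * U n t)) - avg n (\<lambda>t. iexp (x * (c * wfun n t))))
        \<le> \<bar>x\<bar> * avg n (\<lambda>t. \<bar>U n t - c * wfun n t\<bar>)"
    proof (intro always_eventually allI)
      fix n
      have "norm (avg n (\<lambda>t. iexp (x * U n t)) - avg n (\<lambda>t. iexp (x * (c * wfun n t))))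
          \<le> avg n (\<lambda>t. norm (iexp (x * U n t) - iexp (x * (c * wfun n t))))"
        unfolding avg_diff[symmetric] by (rule norm_avg_le)
      also have "\<dots> \<le> avg n (\<lambda>t. \<bar>x\<bar> * \<bar>U n t - c * wfun n t\<bar>)"
        by (intro avg_mono order.trans[OF iexp_diff_le]) (simp add: abs_mult[symmetric] right_diff_distrib)
      finally show "norm (avg n (\<lambda>t. iexp (x * U n t)) - avg n (\<lambda>t. iexp (x * (c * wfun n t))))
          \<le> \<bar>x\<bar> * avg n (\<lambda>t. \<bar>U n t - c * wfun n t\<bar>)"
        by (simp add: avg_cmult)
    qed
    show "(\<lambda>n. \<bar>x\<bar> * avg n (\<lambda>t. \<bar>U n t - c * wfun n t\<bar>)) \<longlonglongrightarrow> 0"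
      using tendsto_mult[OF tendsto_const[of "\<bar>x\<bar>"] assms] by simp
  qed
  moreover have "avg n (\<lambda>t. iexp (x * (c * wfun n t))) = zchar n ((x * c * sqrt pi) / sqrt (ln (real n)))" for n
    unfolding zchar_def wfun_def by (intro avg_cong) (simp add: mult.assoc)
  moreover note tendsto_add[OF _ zchar_limit[of "x * c * sqrt pi"]]
  ultimately have "(\<lambda>n. avg n (\<lambda>t. iexp (x * U n t))) \<longlonglongrightarrow> 0 + complex_of_real (exp (- ((x * c * sqrt pi)\<^sup>2 * svar / 2)))"
    by fastforce
  moreover have "(x * c * sqrt pi)\<^sup>2 * svar / 2 = (x * c)\<^sup>2 * (8 * (1 - ln 2)) / 2"
    by (simp add: svar_def power_mult_distrib)
  ultimately show ?thesis
    by simp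
qed

section \<open>From averages over trees to weak convergence\<close>

lemma expectation_shape_dist:
  fixes f :: "real \<Rightarrow> 'a :: {banach, second_countable_topology}"
  shows "measure_pmf.expectation (shape_dist n) f = avg n (\<lambda>t. f (xfun t))"
proof -
  have "measure_pmf.expectation (shape_dist n) f = measure_pmf.expectation (pmf_of_set (bin_trees n)) (\<lambda>t. f (xfun t))"
    unfolding shape_dist_def by (rule integral_map_pmf)
  also have "\<dots> = (\<Sum>t\<in>bin_trees n. pmf (pmf_of_set (bin_trees n)) t *\<^sub>R f (xfun t))"
    by (rule integral_measure_pmf) auto
  also have "\<dots> = avg n (\<lambda>t. f (xfun t))"
    unfolding avg_def scaleR_sum_right by (intro sum.cong) (auto simp: inverse_eq_divide)
  finally show ?thesis .
qed

lemma char_shape_dist: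
  "char (distr (measure_pmf (shape_dist n)) borel g) x = avg n (\<lambda>t. iexp (x * g (xfun t)))"
  unfolding char_def by (subst integral_distr) (auto simp: expectation_shape_dist)

lemma weak_conv_shape_dist:
  assumes "real_distribution N"
    and "\<And>x. (\<lambda>n. avg n (\<lambda>t. iexp (x * g n (xfun t)))) \<longlonglongrightarrow> char N x"
  shows "weak_conv_m (\<lambda>n. distr (measure_pmf (shape_dist n)) borel (g n)) N"
proof (rule levy_continuity)
  show "real_distribution (distr (measure_pmf (shape_dist n)) borel (g n))" for n
    by (rule prob_space.real_distribution_distr[OF prob_space_measure_pmf]) simp
qed (use assms in \<open>simp_all add: char_shape_dist\<close>)

lemma char_normal_distribution:
  assumes "0 < \<sigma>"
  shows "char (density lborel (normal_density 0 \<sigma>)) x = exp (- ((x * \<sigma>)\<^sup>2 / 2))"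
proof -
  interpret S: prob_space std_normal_distribution
    by (rule prob_space_normal_density) simp
  have "distributed std_normal_distribution lborel (\<lambda>y. y) std_normal_density"
    by (auto simp: distributed_def distr_id2)
  from S.normal_density_affine[OF this, of \<sigma> 0] assms
  have "distributed std_normal_distribution lborel (\<lambda>y. \<sigma> * y) (normal_density 0 \<sigma>)"
    by simp
  then have eq: "density lborel (normal_density 0 \<sigma>) = distr std_normal_distribution lborel (\<lambda>y. \<sigma> * y)"
    by (rule distributed_distr_eq_density[symmetric])
  have "char (density lborel (normal_density 0 \<sigma>)) x = (CLINT y|std_normal_distribution. iexp (x * (\<sigma> * y)))"
    unfolding char_def eq by (rule integral_distr) auto
  also have "\<dots> = char std_normal_distribution (x * \<sigma>)"
    unfolding char_def by (simp add: mult.assoc)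
  finally show ?thesis
    by (simp add: char_std_normal_distribution)
qed

lemma real_distribution_normal: "0 < \<sigma> \<Longrightarrow> real_distribution (density lborel (normal_density \<mu> \<sigma>))"
  by (auto simp: real_distribution_def real_distribution_axioms_def prob_space_normal_density)

text \<open>Standardisation is invariant under increasing affine maps, so \<open>xfun\<close> may be
  replaced by \<open>yfun\<close>, whose mean tends to 0 and whose variance \<open>V\<close> tends
  to a positive limit.\<close>

lemma standardized_L1:
  defines "v \<equiv> \<lambda>n. avg n (\<lambda>t. (xfun t - avg n xfun)\<^sup>2)"
  shows "(\<lambda>n. avg n (\<lambda>t. \<bar>(xfun t - avg n xfun) / sqrt (v n) - 1 / sqrt (8 * (1 - ln 2)) * wfun n t\<bar>)) \<longlonglongrightarrow> 0"
proof -
  define \<sigma> :: real where "\<sigma> = sqrt (8 * (1 - ln 2))"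
  have \<sigma>2: "0 < 8 * (1 - ln (2::real))"
    using ln_2_less_1 by simp
  have \<sigma>: "0 < \<sigma>"
    using \<sigma>2 by (simp add: \<sigma>_def)
  define V where "V n = avg n (\<lambda>t. (yfun n t)\<^sup>2) - (avg n (yfun n))\<^sup>2" for n
  have "(\<lambda>n. avg n (\<lambda>t. (yfun n t)\<^sup>2) - (avg n (yfun n))\<^sup>2) \<longlonglongrightarrow> 8 * (1 - ln 2) - 0\<^sup>2"
    by (intro tendsto_diff tendsto_power avg_yfun_square avg_yfun)
  then have V: "V \<longlonglongrightarrow> 8 * (1 - ln 2)"
    by (simp add: V_def[abs_def])
  have inv: "(\<lambda>n. 1 / sqrt (V n)) \<longlonglongrightarrow> 1 / \<sigma>"
    unfolding \<sigma>_def by (intro tendsto_divide tendsto_real_sqrt V tendsto_const) (use \<sigma>2 in auto)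
  show ?thesis
    unfolding \<sigma>_def[symmetric]
  proof (rule tendsto_sandwich)
    show "\<forall>\<^sub>F n in sequentially. 0 \<le> avg n (\<lambda>t. \<bar>(xfun t - avg n xfun) / sqrt (v n) - 1 / \<sigma> * wfun n t\<bar>)"
      by (intro always_eventually allI avg_nonneg) auto
    show "\<forall>\<^sub>F n in sequentially. avg n (\<lambda>t. \<bar>(xfun t - avg n xfun) / sqrt (v n) - 1 / \<sigma> * wfun n t\<bar>)
        \<le> \<bar>1 / sqrt (V n) - 1 / \<sigma>\<bar> * sqrt (avg n (\<lambda>t. (yfun n t)\<^sup>2)) + \<bar>avg n (yfun n)\<bar> * \<bar>1 / sqrt (V n)\<bar>
          + 1 / \<sigma> * avg n (\<lambda>t. \<bar>yfun n t - wfun n t\<bar>)"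
      using eventually_gt_at_top[of 1]
    proof eventually_elim
      case (elim n)
      \<comment> \<open>For n at most 1 this scale is 0 and \<open>yfun\<close> degenerates by
        division by zero, hence the restriction to n > 1.\<close>
      define \<nu> where "\<nu> = sqrt (real n * ln (real n))"
      have \<nu>: "\<nu> > 0"
        using elim by (auto simp: \<nu>_def)
      have x: "xfun t = C0 * (real n + 1) + \<nu> * yfun n t" for t
        using \<nu> unfolding yfun_def \<nu>_def[symmetric] by simp
      have "avg n xfun = avg n (\<lambda>t. C0 * (real n + 1) + \<nu> * yfun n t)"
        by (intro avg_cong x)
      then have mean: "avg n xfun = C0 * (real n + 1) + \<nu> * avg n (yfun n)"
        unfolding avg_add avg_cmult by simp
      have centred: "xfun t - avg n xfun = \<nu> * (yfun n t - avg n (yfun n))" for t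
        unfolding mean x by (simp add: right_diff_distrib)
      have "avg n (\<lambda>t. (yfun n t - avg n (yfun n))\<^sup>2) = V n"
      proof -
        have "avg n (\<lambda>t. (yfun n t - avg n (yfun n))\<^sup>2)
            = avg n (\<lambda>t. (yfun n t)\<^sup>2 + ((avg n (yfun n))\<^sup>2 - 2 * avg n (yfun n) * yfun n t))"
          by (intro avg_cong) (simp add: power2_eq_square algebra_simps)
        then show ?thesis
          unfolding avg_add avg_diff avg_cmult V_def by (simp add: power2_eq_square)
      qed
      then have v: "v n = \<nu>\<^sup>2 * V n"
        unfolding v_def centred power_mult_distrib avg_cmult by simp
      have standard: "(xfun t - avg n xfun) / sqrt (v n) = (yfun n t - avg n (yfun n)) * (1 / sqrt (V n))" for t
        unfolding centred v using \<nu> by (simp add: real_sqrt_mult)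
      have "avg n (\<lambda>t. \<bar>(xfun t - avg n xfun) / sqrt (v n) - 1 / \<sigma> * wfun n t\<bar>)
          \<le> avg n (\<lambda>t. \<bar>1 / sqrt (V n) - 1 / \<sigma>\<bar> * \<bar>yfun n t\<bar> + \<bar>avg n (yfun n)\<bar> * \<bar>1 / sqrt (V n)\<bar>
            + 1 / \<sigma> * \<bar>yfun n t - wfun n t\<bar>)"
      proof (rule avg_mono)
        fix t
        define p where "p = 1 / sqrt (V n)"
        define q where "q = 1 / \<sigma>"
        have q: "0 < q"
          using \<sigma> by (simp add: q_def)
        have "(yfun n t - avg n (yfun n)) * p - q * wfun n t
            = (p - q) * yfun n t - avg n (yfun n) * p + q * (yfun n t - wfun n t)"
          by (simp add: algebra_simps)
        also have "\<bar>\<dots>\<bar> \<le> \<bar>(p - q) * yfun n t\<bar> + \<bar>avg n (yfun n) * p\<bar> + \<bar>q * (yfun n t - wfun n t)\<bar>"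
          by linarith
        also have "\<dots> = \<bar>p - q\<bar> * \<bar>yfun n t\<bar> + \<bar>avg n (yfun n)\<bar> * \<bar>p\<bar> + q * \<bar>yfun n t - wfun n t\<bar>"
          using q by (simp add: abs_mult)
        finally show "\<bar>(xfun t - avg n xfun) / sqrt (v n) - 1 / \<sigma> * wfun n t\<bar>
            \<le> \<bar>1 / sqrt (V n) - 1 / \<sigma>\<bar> * \<bar>yfun n t\<bar> + \<bar>avg n (yfun n)\<bar> * \<bar>1 / sqrt (V n)\<bar> + 1 / \<sigma> * \<bar>yfun n t - wfun n t\<bar>"
          unfolding standard p_def q_def .
      qed
      also have "\<dots> = \<bar>1 / sqrt (V n) - 1 / \<sigma>\<bar> * avg n (\<lambda>t. \<bar>yfun n t\<bar>) + \<bar>avg n (yfun n)\<bar> * \<bar>1 / sqrt (V n)\<bar>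
            + 1 / \<sigma> * avg n (\<lambda>t. \<bar>yfun n t - wfun n t\<bar>)"
        unfolding avg_add avg_cmult by simp
      also have "\<dots> \<le> \<bar>1 / sqrt (V n) - 1 / \<sigma>\<bar> * sqrt (avg n (\<lambda>t. (yfun n t)\<^sup>2)) + \<bar>avg n (yfun n)\<bar> * \<bar>1 / sqrt (V n)\<bar>
            + 1 / \<sigma> * avg n (\<lambda>t. \<bar>yfun n t - wfun n t\<bar>)"
        by (intro add_right_mono mult_left_mono avg_abs_le_sqrt) auto
      finally show ?case .
    qed
    have "(\<lambda>n. \<bar>1 / sqrt (V n) - 1 / \<sigma>\<bar> * sqrt (avg n (\<lambda>t. (yfun n t)\<^sup>2)) + \<bar>avg n (yfun n)\<bar> * \<bar>1 / sqrt (V n)\<bar>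
          + 1 / \<sigma> * avg n (\<lambda>t. \<bar>yfun n t - wfun n t\<bar>))
        \<longlonglongrightarrow> \<bar>1 / \<sigma> - 1 / \<sigma>\<bar> * sqrt (8 * (1 - ln 2)) + \<bar>0\<bar> * \<bar>1 / \<sigma>\<bar> + 1 / \<sigma> * 0"
      by (intro tendsto_add tendsto_mult tendsto_rabs tendsto_diff tendsto_const tendsto_real_sqrt inv avg_yfun avg_yfun_square yfun_wfun_L1)
    then show "(\<lambda>n. \<bar>1 / sqrt (V n) - 1 / \<sigma>\<bar> * sqrt (avg n (\<lambda>t. (yfun n t)\<^sup>2)) + \<bar>avg n (yfun n)\<bar> * \<bar>1 / sqrt (V n)\<bar>
          + 1 / \<sigma> * avg n (\<lambda>t. \<bar>yfun n t - wfun n t\<bar>)) \<longlonglongrightarrow> 0"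
      by simp
  qed simp
qed

theorem theorem4p2:
  shows "weak_conv_m
           (\<lambda>n. distr (measure_pmf (shape_dist n)) borel
                   (\<lambda>x. (x - C0 * (real n + 1)) / sqrt (real n * ln (real n))))
           (density lborel (normal_density 0 (sqrt (8 * (1 - ln 2)))))
       \<and> weak_conv_m
           (\<lambda>n. distr (measure_pmf (shape_dist n)) borel
                   (\<lambda>x. (x - measure_pmf.expectation (shape_dist n) (\<lambda>y. y))
                        / sqrt (measure_pmf.variance (shape_dist n) (\<lambda>y. y))))
           std_normal_distribution"
proof
  have \<sigma>2: "0 < 8 * (1 - ln (2::real))"
    using ln_2_less_1 by simp
  then have \<sigma>: "0 < sqrt (8 * (1 - ln (2::real)))"
    by simp
  show "weak_conv_m
           (\<lambda>n. distr (measure_pmf (shape_dist n)) borel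
                   (\<lambda>x. (x - C0 * (real n + 1)) / sqrt (real n * ln (real n))))
           (density lborel (normal_density 0 (sqrt (8 * (1 - ln 2)))))"
  proof (rule weak_conv_shape_dist)
    fix x
    \<comment> \<open>Here the multiplier c of \<open>char_limit_of_L1_close\<close> is 1, which
      explains the factor \<open>x * 1\<close>.\<close>
    have "(\<lambda>n. avg n (\<lambda>t. iexp (x * yfun n t))) \<longlonglongrightarrow> exp (- ((x * 1)\<^sup>2 * (8 * (1 - ln 2)) / 2))"
      by (rule char_limit_of_L1_close) (use yfun_wfun_L1 in simp)
    moreover have "(x * sqrt (8 * (1 - ln 2)))\<^sup>2 / 2 = (x * 1)\<^sup>2 * (8 * (1 - ln 2)) / 2"
      using \<sigma>2 by (simp add: power_mult_distrib)
    ultimately show "(\<lambda>n. avg n (\<lambda>t. iexp (x * ((xfun t - C0 * (real n + 1)) / sqrt (real n * ln (real n))))))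
        \<longlonglongrightarrow> char (density lborel (normal_density 0 (sqrt (8 * (1 - ln 2))))) x"
      unfolding char_normal_distribution[OF \<sigma>] yfun_def by metis
  qed (rule real_distribution_normal[OF \<sigma>])
  show "weak_conv_m
           (\<lambda>n. distr (measure_pmf (shape_dist n)) borel
                   (\<lambda>x. (x - measure_pmf.expectation (shape_dist n) (\<lambda>y. y))
                        / sqrt (measure_pmf.variance (shape_dist n) (\<lambda>y. y))))
           std_normal_distribution"
  proof (rule weak_conv_shape_dist)
    fix x
    have "(\<lambda>n. avg n (\<lambda>t. iexp (x * ((xfun t - avg n xfun) / sqrt (avg n (\<lambda>t. (xfun t - avg n xfun)\<^sup>2))))))
        \<longlonglongrightarrow> exp (- ((x * (1 / sqrt (8 * (1 - ln 2))))\<^sup>2 * (8 * (1 - ln 2)) / 2))"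
      by (rule char_limit_of_L1_close) (rule standardized_L1)
    moreover have "(x * (1 / sqrt (8 * (1 - ln 2))))\<^sup>2 * (8 * (1 - ln 2)) / 2 = x\<^sup>2 / 2"
      using \<sigma>2 by (simp add: power_mult_distrib power_divide)
    ultimately show "(\<lambda>n. avg n (\<lambda>t. iexp (x * ((xfun t - measure_pmf.expectation (shape_dist n) (\<lambda>y. y))
        / sqrt (measure_pmf.variance (shape_dist n) (\<lambda>y. y)))))) \<longlonglongrightarrow> char std_normal_distribution x"
      unfolding char_std_normal_distribution expectation_shape_dist by (simp only: minus_divide_left)
  qed (rule real_dist_normal_dist)
qed

end
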